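(* The group of conformal automorphisms of the symmetric cubic form $\det dU$ is isomorphic to $Sp(6)$.
   Context: $U=[u_{ij}]$ is a $3\times3$ symmetric matrix. The $6$-dimensional space of such matrices is a local coordinate chart on the Lagrangian Grassmannian $\Lambda$ of Lagrangian $3$-planes in a $6$-dimensional symplectic space with canonical coordinates $\mathbf{x}=(x^1,x^2,x^3)^t$, $\mathbf{p}=(p_1,p_2,p_3)^t$: the matrix $U$ corresponds to the Lagrangian plane $d\mathbf{p}=U\,d\mathbf{x}$. The symmetric cubic form $\det dU$ is $$\det dU=du_{11}du_{22}du_{33}+2\,du_{12}du_{13}du_{23}-du_{11}(du_{23})^2-du_{22}(du_{13})^2-du_{33}(du_{12})^2 .$$ A conformal automorphism of this form is a transformation of the variables $u_{ij}$ which preserves $\det dU$ up to multiplication by a function (that is, preserves its conformal class). $Sp(6)$ is the linear symplectic group, consisting of block matrices $\begin{pmatrix}A&B\\ C&D\end{pmatrix}$ with $3\times3$ blocks satisfying $A^tC=C^tA$, $B^tD=D^tB$, $A^tD-C^tB=\mathrm{id}$; its natural action on $\Lambda$ is $U\mapsto(AU+B)(CU+D)^{-1}$, and this action preserves the conformal class of $\det dU$.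
   Formalization: Taken over the complex numbers with holomorphic local transformations identified under continuation; since −id acts trivially on U, the conformal group is shown isomorphic to Sp(6)/{id, −id} via the natural action, not to Sp(6) itself. *)

theory Defs
  imports "HOL-Analysis.Analysis" "HOL-Algebra.Coset"
begin

section \<open>Symmetric matrices and the cubic form\<close>

type_synonym cmat = "complex^3^3"

definition symmat :: "cmat set" where
  "symmat = {U. transpose U = U}"

definition cscale :: "complex \<Rightarrow> cmat \<Rightarrow> cmat" where
  "cscale c X = (\<chi> i j. c * X $ i $ j)"

text \<open>
  The form \<open>det dU\<close> has constant coefficients on the space of symmetric matrices.  Its value on a
  tangent vector \<open>X\<close> (that is, at \<open>du\<^sub>i\<^sub>j = X\<^sub>i\<^sub>j\<close>) is the determinant of \<open>X\<close>.
\<close>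

definition det_form :: "cmat \<Rightarrow> complex" where
  "det_form X = det X"

lemma det_form_symmat:
  assumes "X \<in> symmat"
  shows "det_form X = X$1$1 * X$2$2 * X$3$3 + 2 * X$1$2 * X$1$3 * X$2$3
           - X$1$1 * (X$2$3)^2 - X$2$2 * (X$1$3)^2 - X$3$3 * (X$1$2)^2"
proof -
  have "X $ i $ j = X $ j $ i" for i j
    using assms by (auto simp: symmat_def transpose_def vec_eq_iff)
  then have "X$2$1 = X$1$2" "X$3$1 = X$1$3" "X$3$2 = X$2$3"
    by blast+
  then show ?thesis
    by (simp add: det_form_def det_3 power2_eq_square algebra_simps)
qed


section \<open>Conformal automorphisms\<close>

text \<open>
  A transformation of the variables \<open>u\<^sub>i\<^sub>j\<close> is a partial map whose domain is a nonempty connected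
  open subset of the 6-dimensional space \<open>symmat\<close>, and which is injective and holomorphic there.
  The derivative is taken within \<open>symmat\<close>, so only the restriction of \<open>F\<close> to \<open>symmat\<close> is
  meaningful; \<open>has_derivative\<close> provides a real-linear \<open>F\<close>, so complex homogeneity is required
  separately.  The number \<open>k\<close> is the value at \<open>U\<close> of the nowhere vanishing conformal factor.
\<close>

definition conformal_transformation :: "(cmat \<rightharpoonup> cmat) \<Rightarrow> bool" where
  "conformal_transformation f \<longleftrightarrow>
     openin (top_of_set symmat) (dom f) \<and> connected (dom f) \<and> dom f \<noteq> {} \<and>
     ran f \<subseteq> symmat \<and> inj_on f (dom f) \<and>
     (\<forall>U\<in>dom f. \<exists>F. ((\<lambda>V. the (f V)) has_derivative F) (at U within symmat) \<and>
        (\<forall>c. \<forall>X\<in>symmat. F (cscale c X) = cscale c (F X)) \<and>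
        (\<exists>k. k \<noteq> 0 \<and> (\<forall>X\<in>symmat. det_form (F X) = k * det_form X)))"

text \<open>
  Elements of the Lagrangian Grassmannian's symmetry group act on the chart \<open>symmat\<close> only partially,
  so the transformations have to be identified under analytic continuation to form a group.  This
  is done by taking as elements the conformal transformations that cannot be extended to a larger
  domain.  The product is the inextensible transformation that agrees with the composite on some
  nonempty open set on which the composite is defined.
\<close>

definition conformal_automorphism :: "(cmat \<rightharpoonup> cmat) \<Rightarrow> bool" where
  "conformal_automorphism f \<longleftrightarrow>
     conformal_transformation f \<and> (\<forall>g. conformal_transformation g \<and> f \<subseteq>\<^sub>m g \<longrightarrow> g = f)"

definition conformal_mult :: "(cmat \<rightharpoonup> cmat) \<Rightarrow> (cmat \<rightharpoonup> cmat) \<Rightarrow> (cmat \<rightharpoonup> cmat)" where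
  "conformal_mult f g = (THE h. conformal_automorphism h \<and>
     (\<exists>V. openin (top_of_set symmat) V \<and> V \<noteq> {} \<and> V \<subseteq> dom (f \<circ>\<^sub>m g) \<and>
          (\<forall>U\<in>V. h U = (f \<circ>\<^sub>m g) U)))"

definition conformal_group :: "(cmat \<rightharpoonup> cmat) monoid" where
  "conformal_group =
     \<lparr>carrier = {f. conformal_automorphism f}, mult = conformal_mult, one = Some |` symmat\<rparr>"


section \<open>The symplectic group and its action\<close>

type_synonym cmat6 = "complex^(3 + 3)^(3 + 3)"

definition blockA :: "cmat6 \<Rightarrow> cmat" where
  "blockA M = (\<chi> i j. M $ Inl i $ Inl j)"

definition blockB :: "cmat6 \<Rightarrow> cmat" where
  "blockB M = (\<chi> i j. M $ Inl i $ Inr j)"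

definition blockC :: "cmat6 \<Rightarrow> cmat" where
  "blockC M = (\<chi> i j. M $ Inr i $ Inl j)"

definition blockD :: "cmat6 \<Rightarrow> cmat" where
  "blockD M = (\<chi> i j. M $ Inr i $ Inr j)"

definition Sp6 :: "cmat6 monoid" where
  "Sp6 = \<lparr>carrier = {M.
       transpose (blockA M) ** blockC M = transpose (blockC M) ** blockA M \<and>
       transpose (blockB M) ** blockD M = transpose (blockD M) ** blockB M \<and>
       transpose (blockA M) ** blockD M - transpose (blockC M) ** blockB M = mat 1},
     mult = (**), one = mat 1\<rparr>"

definition sp_action :: "cmat6 \<Rightarrow> (cmat \<rightharpoonup> cmat)" where
  "sp_action M = (\<lambda>U.
     if U \<in> symmat \<and> invertible (blockC M ** U + blockD M)
     then Some ((blockA M ** U + blockB M) ** matrix_inv (blockC M ** U + blockD M))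
     else None)"

end

theory Submission
  imports Defs "HOL-Complex_Analysis.Cauchy_Integral_Formula"
begin

text \<open>
  The proof is a Liouville theorem.  A linear map that preserves \<open>det\<close> on symmetric matrices up to a
  factor has the form \<open>X \<mapsto> P X P\<^sup>t\<close>, so the second derivatives of a conformal transformation \<open>f\<close> take
  values in the first prolongation of the corresponding Lie algebra:
  \<open>D\<^sup>2f(X, Y) = Df(X T Y + Y T X)\<close> for a field \<open>T\<close> of symmetric matrices.  The second prolongation
  vanishes; comparing third derivatives, this means that \<open>T\<close> satisfies the Riccati equation
  \<open>DT(Z) = T Z T\<close>.  Solving it shows that \<open>f\<close> agrees near each point with the fractional linear action
  of a symplectic matrix, which is unique up to sign and therefore the same for the whole
  connected domain.  The action of a symplectic matrix is inextensible, because at a point where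
  \<open>C U + D\<close> is singular a continuous extension \<open>W\<close> would satisfy \<open>W (C U + D) = A U + B\<close>, and then
  \<open>A\<^sup>t - C\<^sup>t W\<close> would be a left inverse of \<open>C U + D\<close>.
\<close>

section \<open>Symmetric matrices\<close>

text \<open>A conformal transformation is assumed complex differentiable only once, and only along
  the six-dimensional subspace of symmetric matrices. Second and third derivatives are therefore
  extracted from Cauchy's integral formula on complex lines, after composing with the linear
  projection onto symmetric matrices so that derivatives can be taken on an open set of all
  matrices. The conformal factor is given only pointwise; \<open>det\<close> of the derivative at
  the identity matrix displays it as a function of the first derivative, whose smoothness it
  inherits. The field \<open>T\<close> comes from a pointwise choice as well, and becomes
  differentiable through formulas that express its entries rationally by first and second
  derivatives. Complex scalars matter twice more: a symmetric matrix of rank one is the square of a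
  vector, and a complex line minus finitely many points is connected, so the singular locus of an
  action does not separate its domain.\<close>

lemma cscale_nth [simp]: "cscale c X $ i $ j = c * X $ i $ j"
  by (simp add: cscale_def)

lemma cscale_add_right: "cscale c (X + Y) = cscale c X + cscale c Y"
  by (simp add: vec_eq_iff algebra_simps)

lemma cscale_add_left: "cscale (c + d) X = cscale c X + cscale d X"
  by (simp add: vec_eq_iff algebra_simps)

lemma cscale_0_left [simp]: "cscale 0 X = 0"
  by (simp add: vec_eq_iff)

lemma cscale_1 [simp]: "cscale 1 X = X"
  by (simp add: vec_eq_iff)

lemma cscale_scaleR: "cscale (r *\<^sub>R c) X = r *\<^sub>R cscale c X"
  by (simp add: vec_eq_iff)

lemma norm_cscale: "norm (cscale c X) = norm c * norm X"
  by (simp add: norm_vec_def norm_mult L2_set_right_distrib)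

lemma bounded_linear_cscale_left: "bounded_linear (\<lambda>c. cscale c X)"
  by (rule bounded_linear_intro[where K = "norm X"])
     (simp_all add: cscale_add_left cscale_scaleR norm_cscale mult.commute)

lemmas has_derivative_cscale_left [derivative_intros] =
  bounded_linear.has_derivative[OF bounded_linear_cscale_left]

lemmas continuous_on_cscale_left [continuous_intros] =
  bounded_linear.continuous_on[OF bounded_linear_cscale_left]

definition smat :: "complex \<Rightarrow> complex \<Rightarrow> complex \<Rightarrow> complex \<Rightarrow> complex \<Rightarrow> complex \<Rightarrow> cmat" where
  "smat p q r s t u = vector [vector [p, s, t], vector [s, q, u], vector [t, u, r]]"

lemma smat_nth [simp]:
  "smat p q r s t u $ 1 $ 1 = p" "smat p q r s t u $ 1 $ 2 = s" "smat p q r s t u $ 1 $ 3 = t"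
  "smat p q r s t u $ 2 $ 1 = s" "smat p q r s t u $ 2 $ 2 = q" "smat p q r s t u $ 2 $ 3 = u"
  "smat p q r s t u $ 3 $ 1 = t" "smat p q r s t u $ 3 $ 2 = u" "smat p q r s t u $ 3 $ 3 = r"
  by (simp_all add: smat_def vector_3)

lemma cmat_eq_iff: "(X :: cmat) = Y \<longleftrightarrow>
    X $ 1 $ 1 = Y $ 1 $ 1 \<and> X $ 1 $ 2 = Y $ 1 $ 2 \<and> X $ 1 $ 3 = Y $ 1 $ 3 \<and>
    X $ 2 $ 1 = Y $ 2 $ 1 \<and> X $ 2 $ 2 = Y $ 2 $ 2 \<and> X $ 2 $ 3 = Y $ 2 $ 3 \<and>
    X $ 3 $ 1 = Y $ 3 $ 1 \<and> X $ 3 $ 2 = Y $ 3 $ 2 \<and> X $ 3 $ 3 = Y $ 3 $ 3"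
  by (auto simp: vec_eq_iff forall_3)

lemma cmat_mult_nth: "((X :: cmat) ** Y) $ i $ j = X $ i $ 1 * Y $ 1 $ j + X $ i $ 2 * Y $ 2 $ j + X $ i $ 3 * Y $ 3 $ j"
  by (simp add: matrix_matrix_mult_def sum_3)

lemma transpose_nth: "transpose X $ i $ j = X $ j $ i"
  by (simp add: transpose_def)

lemma symmat_iff: "X \<in> symmat \<longleftrightarrow> X $ 2 $ 1 = X $ 1 $ 2 \<and> X $ 3 $ 1 = X $ 1 $ 3 \<and> X $ 3 $ 2 = X $ 2 $ 3"
  by (auto simp: symmat_def cmat_eq_iff transpose_nth)

lemma smat_in_symmat [simp]: "smat p q r s t u \<in> symmat"
  by (simp add: symmat_iff)

lemma symmat_cases:
  assumes "X \<in> symmat"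
  obtains p q r s t u where "X = smat p q r s t u"
proof (rule that)
  show "X = smat (X $ 1 $ 1) (X $ 2 $ 2) (X $ 3 $ 3) (X $ 1 $ 2) (X $ 1 $ 3) (X $ 2 $ 3)"
    using assms by (simp add: cmat_eq_iff symmat_iff)
qed

lemma cscale_smat: "cscale c (smat p q r s t u) = smat (c * p) (c * q) (c * r) (c * s) (c * t) (c * u)"
  by (simp add: cmat_eq_iff cscale_def)

lemma smat_add: "smat p q r s t u + smat p' q' r' s' t' u' = smat (p+p') (q+q') (r+r') (s+s') (t+t') (u+u')"
  by (simp add: cmat_eq_iff)

lemma smat_diff: "smat p q r s t u - smat p' q' r' s' t' u' = smat (p-p') (q-q') (r-r') (s-s') (t-t') (u-u')"
  by (simp add: cmat_eq_iff)

lemma symmat_add: "X \<in> symmat \<Longrightarrow> Y \<in> symmat \<Longrightarrow> X + Y \<in> symmat"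
  and symmat_diff: "X \<in> symmat \<Longrightarrow> Y \<in> symmat \<Longrightarrow> X - Y \<in> symmat"
  and symmat_cscale: "X \<in> symmat \<Longrightarrow> cscale c X \<in> symmat"
  and symmat_0: "0 \<in> symmat" and symmat_1: "mat 1 \<in> symmat"
  by (auto simp: symmat_iff cscale_def mat_def)

text \<open>A complex linear projection onto \<open>symmat\<close> that does not increase the norm,
  so that composing with it preserves holomorphy and maps balls around symmetric matrices into
  themselves.\<close>

definition symmetric_part :: "cmat \<Rightarrow> cmat" where
  "symmetric_part X = (1/2) *\<^sub>R (X + transpose X)"

lemma symmetric_part_symmat: "symmetric_part X \<in> symmat"
  by (simp add: symmetric_part_def symmat_iff transpose_nth add.commute)

lemma symmetric_part_id: "X \<in> symmat \<Longrightarrow> symmetric_part X = X"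
  by (simp add: symmetric_part_def symmat_def vec_eq_iff)

lemma symmetric_part_idem [simp]: "symmetric_part (symmetric_part X) = symmetric_part X"
  by (simp add: symmetric_part_id symmetric_part_symmat)

lemma bounded_linear_symmetric_part: "bounded_linear symmetric_part"
  unfolding linear_conv_bounded_linear[symmetric]
  by (rule linearI) (simp_all add: symmetric_part_def vec_eq_iff transpose_nth algebra_simps)

lemma symmetric_part_cscale: "symmetric_part (cscale c X) = cscale c (symmetric_part X)"
  by (simp add: symmetric_part_def vec_eq_iff transpose_nth algebra_simps)

section \<open>The symmetry algebra of the determinant and its prolongations\<close>

text \<open>The derivative of \<open>det\<close> at a symmetric matrix \<open>Y\<close> in a symmetric direction \<open>Z\<close>.\<close>

definition ddet :: "cmat \<Rightarrow> cmat \<Rightarrow> complex" where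
  "ddet Y Z =
     (Y$2$2 * Y$3$3 - (Y$2$3)^2) * Z$1$1 + (Y$1$1 * Y$3$3 - (Y$1$3)^2) * Z$2$2 + (Y$1$1 * Y$2$2 - (Y$1$2)^2) * Z$3$3
     + 2 * (Y$1$3 * Y$2$3 - Y$1$2 * Y$3$3) * Z$1$2 + 2 * (Y$1$2 * Y$2$3 - Y$1$3 * Y$2$2) * Z$1$3
     + 2 * (Y$1$2 * Y$1$3 - Y$1$1 * Y$2$3) * Z$2$3"

definition linear_on_symmat :: "(cmat \<Rightarrow> cmat) \<Rightarrow> bool" where
  "linear_on_symmat a \<longleftrightarrow>
     (\<forall>X\<in>symmat. \<forall>Y\<in>symmat. a (X + Y) = a X + a Y) \<and>
     (\<forall>c. \<forall>X\<in>symmat. a (cscale c X) = cscale c (a X)) \<and> (\<forall>X\<in>symmat. a X \<in> symmat)"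

abbreviation "E11 \<equiv> smat 1 0 0 0 0 0"
abbreviation "E22 \<equiv> smat 0 1 0 0 0 0"
abbreviation "E33 \<equiv> smat 0 0 1 0 0 0"
abbreviation "E12 \<equiv> smat 0 0 0 1 0 0"
abbreviation "E13 \<equiv> smat 0 0 0 0 1 0"
abbreviation "E23 \<equiv> smat 0 0 0 0 0 1"

lemma linear_on_symmat_smat:
  assumes "linear_on_symmat a"
  shows "a (smat p q r s t u) = cscale p (a E11) + cscale q (a E22) + cscale r (a E33)
    + cscale s (a E12) + cscale t (a E13) + cscale u (a E23)"
proof -
  have 1: "a (X + Y) = a X + a Y" if "X \<in> symmat" "Y \<in> symmat" for X Y
    using assms that unfolding linear_on_symmat_def by blast
  have 2: "a (cscale c X) = cscale c (a X)" if "X \<in> symmat" for c X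
    using assms that unfolding linear_on_symmat_def by blast
  have "smat p q r s t u = cscale p E11 + cscale q E22 + cscale r E33 + cscale s E12 + cscale t E13 + cscale u E23"
    by (simp add: cscale_smat smat_add)
  then show ?thesis
    by (simp only: 1 2 symmat_add symmat_cscale smat_in_symmat)
qed

lemma linear_on_symmat_nth:
  assumes "linear_on_symmat a"
  shows "a (smat p q r s t u) $ i $ j = p * a E11 $ i $ j + q * a E22 $ i $ j + r * a E33 $ i $ j
    + s * a E12 $ i $ j + t * a E13 $ i $ j + u * a E23 $ i $ j"
  by (simp add: linear_on_symmat_smat[OF assms, of p q r s t u] cscale_def)

lemma linear_on_symmat_sym:
  assumes "linear_on_symmat a" "X \<in> symmat"
  shows "a X $ 2 $ 1 = a X $ 1 $ 2" "a X $ 3 $ 1 = a X $ 1 $ 3" "a X $ 3 $ 2 = a X $ 2 $ 3"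
  using assms by (auto simp: linear_on_symmat_def symmat_iff)

text \<open>The hypothesis on \<open>c\<close> is an identity between cubic polynomials in the six
  coordinates. Evaluation at points with few nonzero small integer coordinates isolates one or two
  coefficients at a time.\<close>

lemma det_symmetry_algebra_normalised:
  assumes a: "linear_on_symmat a" and c: "\<And>Y. Y \<in> symmat \<Longrightarrow> ddet Y (a Y) = c * det Y"
    and 0: "a E11 = 0" "a E22 = 0" "a E33 = 0" and Y: "Y \<in> symmat"
  shows "a Y = 0"
proof -
  note nth = linear_on_symmat_nth[OF a]
  have P: "(q * r - u^2) * (s * a E12 $ 1 $ 1 + t * a E13 $ 1 $ 1 + u * a E23 $ 1 $ 1)
    + (p * r - t^2) * (s * a E12 $ 2 $ 2 + t * a E13 $ 2 $ 2 + u * a E23 $ 2 $ 2)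
    + (p * q - s^2) * (s * a E12 $ 3 $ 3 + t * a E13 $ 3 $ 3 + u * a E23 $ 3 $ 3)
    + 2 * (t * u - s * r) * (s * a E12 $ 1 $ 2 + t * a E13 $ 1 $ 2 + u * a E23 $ 1 $ 2)
    + 2 * (s * u - t * q) * (s * a E12 $ 1 $ 3 + t * a E13 $ 1 $ 3 + u * a E23 $ 1 $ 3)
    + 2 * (s * t - p * u) * (s * a E12 $ 2 $ 3 + t * a E13 $ 2 $ 3 + u * a E23 $ 2 $ 3)
    = c * (p * q * r + 2 * s * t * u - p * u^2 - q * t^2 - r * s^2)" for p q r s t u
    using c[of "smat p q r s t u"] det_form_symmat[of "smat p q r s t u"]
    by (simp add: ddet_def nth[of p q r s t u] det_form_def 0)
  \<comment> \<open>At the identity matrix the left-hand side involves only images of diagonal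
    units, which vanish, while the determinant is 1.\<close>
  have c0: "c = 0" using P[where p=1 and q=1 and r=1 and s=0 and t=0 and u=0] by simp
  have s33: "a E12 $ 3 $ 3 = 0" using P[where p=1 and q=2 and r=0 and s=1 and t=0 and u=0] c0 by simp
  have t22: "a E13 $ 2 $ 2 = 0" using P[where p=1 and q=0 and r=2 and s=0 and t=1 and u=0] c0 by simp
  have u11: "a E23 $ 1 $ 1 = 0" using P[where p=0 and q=1 and r=2 and s=0 and t=0 and u=1] c0 by simp
  have s11: "a E12 $ 1 $ 1 = 0" and s12: "a E12 $ 1 $ 2 = 0"
    using P[where p=0 and q=1 and r=1 and s=1 and t=0 and u=0] P[where p=0 and q="-1" and r=1 and s=1 and t=0 and u=0] c0 s33 by (simp; algebra)+
  have s22: "a E12 $ 2 $ 2 = 0"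
    using P[where p=1 and q=0 and r=1 and s=1 and t=0 and u=0] c0 s33 s12 by simp
  have t11: "a E13 $ 1 $ 1 = 0" and t13: "a E13 $ 1 $ 3 = 0"
    using P[where p=0 and q=1 and r=1 and s=0 and t=1 and u=0] P[where p=0 and q=1 and r="-1" and s=0 and t=1 and u=0] c0 t22 by (simp; algebra)+
  have t33: "a E13 $ 3 $ 3 = 0"
    using P[where p=1 and q=1 and r=0 and s=0 and t=1 and u=0] c0 t22 t13 by simp
  have u22: "a E23 $ 2 $ 2 = 0" and u23: "a E23 $ 2 $ 3 = 0"
    using P[where p=1 and q=0 and r=1 and s=0 and t=0 and u=1] P[where p=1 and q=0 and r="-1" and s=0 and t=0 and u=1] c0 u11 by (simp; algebra)+
  have u33: "a E23 $ 3 $ 3 = 0"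
    using P[where p=1 and q=1 and r=0 and s=0 and t=0 and u=1] c0 u11 u23 by simp
  note z = c0 s33 t22 u11 s11 s12 s22 t11 t13 t33 u22 u23 u33
  have s13: "a E12 $ 1 $ 3 = 0" using P[where p=0 and q=1 and r=0 and s=1 and t=1 and u=0] P[where p=0 and q=0 and r=0 and s=1 and t=1 and u=0] z by simp
  have t12: "a E13 $ 1 $ 2 = 0" using P[where p=0 and q=0 and r=1 and s=1 and t=1 and u=0] P[where p=0 and q=0 and r=0 and s=1 and t=1 and u=0] z by simp
  have s23: "a E12 $ 2 $ 3 = 0" using P[where p=1 and q=0 and r=0 and s=1 and t=0 and u=1] P[where p=0 and q=0 and r=0 and s=1 and t=0 and u=1] z by simp
  have u12: "a E23 $ 1 $ 2 = 0" using P[where p=0 and q=0 and r=1 and s=1 and t=0 and u=1] P[where p=0 and q=0 and r=0 and s=1 and t=0 and u=1] z by simp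
  have t23: "a E13 $ 2 $ 3 = 0" using P[where p=1 and q=0 and r=0 and s=0 and t=1 and u=1] P[where p=0 and q=0 and r=0 and s=0 and t=1 and u=1] z by simp
  have u13: "a E23 $ 1 $ 3 = 0" using P[where p=0 and q=1 and r=0 and s=0 and t=1 and u=1] P[where p=0 and q=0 and r=0 and s=0 and t=1 and u=1] z by simp
  note sym = linear_on_symmat_sym[OF a]
  have "a E12 = 0" "a E13 = 0" "a E23 = 0"
    using z s13 t12 s23 u12 t23 u13 by (simp_all add: cmat_eq_iff sym)
  then have "a (smat p q r s t u) = 0" for p q r s t u
    by (simp add: linear_on_symmat_smat[OF a, of p q r s t u] 0 cscale_def vec_eq_iff)
  then show ?thesis
    using symmat_cases[OF Y] by metis
qed

lemma det_smat: "det (smat p q r s t u) = p * q * r + 2 * s * t * u - p * u^2 - q * t^2 - r * s^2"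
  using det_form_symmat[of "smat p q r s t u"] by (simp add: det_form_def)

lemma ddet_derivation:
  assumes "Y \<in> symmat"
  shows "ddet Y (A ** Y + Y ** transpose A) = 2 * (A$1$1 + A$2$2 + A$3$3) * det Y"
proof -
  obtain p q r s t u where Y: "Y = smat p q r s t u" using symmat_cases[OF assms] .
  show ?thesis
    by (simp add: Y ddet_def det_smat cmat_mult_nth transpose_nth power2_eq_square algebra_simps)
qed

lemma ddet_diff: "ddet Y (Z - W) = ddet Y Z - ddet Y W"
  by (simp add: ddet_def algebra_simps)

lemma linear_on_symmat_derivation: "linear_on_symmat (\<lambda>Y. A ** Y + Y ** transpose A)"
  unfolding linear_on_symmat_def
  by (auto simp: cmat_eq_iff cmat_mult_nth transpose_nth symmat_iff cscale_def algebra_simps)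

lemma linear_on_symmat_diff:
  assumes "linear_on_symmat a" "linear_on_symmat b"
  shows "linear_on_symmat (\<lambda>Y. a Y - b Y)"
  using assms unfolding linear_on_symmat_def by (auto intro: symmat_diff simp: vec_eq_iff cscale_def algebra_simps)

text \<open>The linear maps preserving \<open>det\<close> infinitesimally up to a factor form a copy
  of \<open>gl(3)\<close>, acting by \<open>Y |-> A Y + Y A^t\<close>. The matrix \<open>A\<close>
  is chosen to match \<open>a\<close> on the three diagonal units; the difference is again such a
  symmetry and vanishes on them, so the normalised case applies.\<close>

lemma det_symmetry_algebra:
  assumes a: "linear_on_symmat a" and c: "\<And>Y. Y \<in> symmat \<Longrightarrow> ddet Y (a Y) = c * det Y"
  obtains A where "\<And>Y. Y \<in> symmat \<Longrightarrow> a Y = A ** Y + Y ** transpose A"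
proof -
  note nth = linear_on_symmat_nth[OF a]
  note sym = linear_on_symmat_sym[OF a]
  let ?l = "\<lambda>p q r s t u (i::3) (j::3). p * a E11 $ i $ j + q * a E22 $ i $ j + r * a E33 $ i $ j
    + s * a E12 $ i $ j + t * a E13 $ i $ j + u * a E23 $ i $ j"
  have Q: "(q * r - u^2) * ?l p q r s t u 1 1 + (p * r - t^2) * ?l p q r s t u 2 2
    + (p * q - s^2) * ?l p q r s t u 3 3 + 2 * (t * u - s * r) * ?l p q r s t u 1 2
    + 2 * (s * u - t * q) * ?l p q r s t u 1 3 + 2 * (s * t - p * u) * ?l p q r s t u 2 3
    = c * (p * q * r + 2 * s * t * u - p * u^2 - q * t^2 - r * s^2)" for p q r s t u
    using c[of "smat p q r s t u"] by (simp add: ddet_def det_smat nth[of p q r s t u])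
  \<comment> \<open>These entries lie outside row and column \<open>i\<close> of the image of the
    \<open>i\<close>-th diagonal unit \<open>E\<close>, where a matrix \<open>A E + E A^t\<close>
    has only zeros.\<close>
  have p22: "a E11 $ 2 $ 2 = 0" and r22: "a E33 $ 2 $ 2 = 0"
    using Q[where p=1 and q=0 and r=1 and s=0 and t=0 and u=0] Q[where p=1 and q=0 and r="-1" and s=0 and t=0 and u=0] by (simp; algebra)+
  have p33: "a E11 $ 3 $ 3 = 0" and q33: "a E22 $ 3 $ 3 = 0"
    using Q[where p=1 and q=1 and r=0 and s=0 and t=0 and u=0] Q[where p=1 and q="-1" and r=0 and s=0 and t=0 and u=0] by (simp; algebra)+
  have q11: "a E22 $ 1 $ 1 = 0" and r11: "a E33 $ 1 $ 1 = 0"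
    using Q[where p=0 and q=1 and r=1 and s=0 and t=0 and u=0] Q[where p=0 and q=1 and r="-1" and s=0 and t=0 and u=0] by (simp; algebra)+
  have p23: "a E11 $ 2 $ 3 = 0"
    using Q[where p=1 and q=0 and r=0 and s=0 and t=0 and u=1] Q[where p=1 and q=0 and r=0 and s=0 and t=0 and u="-1"] Q[where p=2 and q=0 and r=0 and s=0 and t=0 and u=1] Q[where p=2 and q=0 and r=0 and s=0 and t=0 and u="-1"] by (simp; algebra)
  have q13: "a E22 $ 1 $ 3 = 0"
    using Q[where p=0 and q=1 and r=0 and s=0 and t=1 and u=0] Q[where p=0 and q=1 and r=0 and s=0 and t="-1" and u=0] Q[where p=0 and q=2 and r=0 and s=0 and t=1 and u=0] Q[where p=0 and q=2 and r=0 and s=0 and t="-1" and u=0] by (simp; algebra)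
  have r12: "a E33 $ 1 $ 2 = 0"
    using Q[where p=0 and q=0 and r=1 and s=1 and t=0 and u=0] Q[where p=0 and q=0 and r=1 and s="-1" and t=0 and u=0] Q[where p=0 and q=0 and r=2 and s=1 and t=0 and u=0] Q[where p=0 and q=0 and r=2 and s="-1" and t=0 and u=0] by (simp; algebra)
  \<comment> \<open>\<open>A ** E11 + E11 ** transpose A\<close> carries the first column of
    \<open>A\<close> in its first row and column, with the corner entry doubled. Hence the columns
    of \<open>A\<close> are read off from the images of the diagonal units, with the diagonal
    entries halved.\<close>
  define A :: cmat where "A = vector
    [vector [a E11 $ 1 $ 1 / 2, a E22 $ 1 $ 2, a E33 $ 1 $ 3],
     vector [a E11 $ 1 $ 2, a E22 $ 2 $ 2 / 2, a E33 $ 2 $ 3],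
     vector [a E11 $ 1 $ 3, a E22 $ 2 $ 3, a E33 $ 3 $ 3 / 2]]"
  have A: "A $ 1 $ 1 = a E11 $ 1 $ 1 / 2" "A $ 1 $ 2 = a E22 $ 1 $ 2" "A $ 1 $ 3 = a E33 $ 1 $ 3"
    "A $ 2 $ 1 = a E11 $ 1 $ 2" "A $ 2 $ 2 = a E22 $ 2 $ 2 / 2" "A $ 2 $ 3 = a E33 $ 2 $ 3"
    "A $ 3 $ 1 = a E11 $ 1 $ 3" "A $ 3 $ 2 = a E22 $ 2 $ 3" "A $ 3 $ 3 = a E33 $ 3 $ 3 / 2"
    by (simp_all add: A_def vector_3)
  define b where "b = (\<lambda>Y. a Y - (A ** Y + Y ** transpose A))"
  have b: "linear_on_symmat b"
    unfolding b_def by (rule linear_on_symmat_diff[OF a linear_on_symmat_derivation])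
  have "ddet Y (b Y) = (c - 2 * (A$1$1 + A$2$2 + A$3$3)) * det Y" if Y: "Y \<in> symmat" for Y
    by (simp add: b_def ddet_diff ddet_derivation[OF Y] c[OF Y] algebra_simps)
  moreover have "b E11 = 0" "b E22 = 0" "b E33 = 0"
    by (simp_all add: b_def cmat_eq_iff cmat_mult_nth transpose_nth A sym p22 r22 p33 q33 q11 r11 p23 q13 r12)
  ultimately have "b Y = 0" if "Y \<in> symmat" for Y
    using det_symmetry_algebra_normalised[OF b] that by blast
  then show thesis by (intro that[of A]) (simp add: b_def)
qed

text \<open>An element of the first prolongation is a symmetric bilinear map whose partial maps all
  lie in the algebra. Comparing unit matrices pins \<open>A E\<close> down as \<open>E ** S\<close>
  for diagonal units \<open>E\<close>; the symmetry of \<open>a\<close> then transfers this formula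
  to every other argument.\<close>

lemma det_symmetry_prolongation:
  assumes A: "\<And>X Y. X \<in> symmat \<Longrightarrow> Y \<in> symmat \<Longrightarrow> a X Y = A X ** Y + Y ** transpose (A X)"
    and comm: "\<And>X Y. X \<in> symmat \<Longrightarrow> Y \<in> symmat \<Longrightarrow> a X Y = a Y X"
  obtains S where "S \<in> symmat" "\<And>X Y. X \<in> symmat \<Longrightarrow> Y \<in> symmat \<Longrightarrow> a X Y = X ** S ** Y + Y ** S ** X"
proof -
  have eq: "A X ** Y + Y ** transpose (A X) = A Y ** X + X ** transpose (A Y)"
    if "X \<in> symmat" "Y \<in> symmat" for X Y
    using A comm that by metis
  note expand = cmat_eq_iff cmat_mult_nth transpose_nth
  have e12: "A E11 $ 2 $ 2 = 0" "A E11 $ 3 $ 2 = 0" "A E22 $ 1 $ 1 = 0" "A E22 $ 3 $ 1 = 0" "A E22 $ 2 $ 1 = A E11 $ 1 $ 2"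
    using eq[of E11 E22] by (simp_all add: expand)
  have e13: "A E11 $ 3 $ 3 = 0" "A E11 $ 2 $ 3 = 0" "A E33 $ 1 $ 1 = 0" "A E33 $ 2 $ 1 = 0" "A E33 $ 3 $ 1 = A E11 $ 1 $ 3"
    using eq[of E11 E33] by (simp_all add: expand)
  have e23: "A E22 $ 3 $ 3 = 0" "A E22 $ 1 $ 3 = 0" "A E33 $ 2 $ 2 = 0" "A E33 $ 1 $ 2 = 0" "A E33 $ 3 $ 2 = A E22 $ 2 $ 3"
    using eq[of E22 E33] by (simp_all add: expand)
  have f1: "A E11 $ 3 $ 1 = 0" "A E11 $ 2 $ 1 = 0" using eq[of E11 E12] by (simp_all add: expand)
  have f2: "A E22 $ 3 $ 2 = 0" "A E22 $ 1 $ 2 = 0" using eq[of E22 E12] by (simp_all add: expand)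
  have f3: "A E33 $ 2 $ 3 = 0" "A E33 $ 1 $ 3 = 0" using eq[of E33 E13] by (simp_all add: expand)
  \<comment> \<open>\<open>E11 ** S\<close> retains only the first row of \<open>S\<close>, so this
    row comes from \<open>A E11\<close>, and the remaining entries come from \<open>A E22\<close>
    and \<open>A E33\<close>.\<close>
  define S where "S = smat (A E11 $ 1 $ 1) (A E22 $ 2 $ 2) (A E33 $ 3 $ 3) (A E11 $ 1 $ 2) (A E11 $ 1 $ 3) (A E22 $ 2 $ 3)"
  have S: "S \<in> symmat" by (simp add: S_def)
  have AE: "A E11 = E11 ** S" "A E22 = E22 ** S" "A E33 = E33 ** S"
    using e12 e13 e23 f1 f2 f3 by (simp_all add: expand S_def)
  have AY: "A Y = Y ** S" if Y: "Y \<in> symmat" for Y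
  proof -
    \<comment> \<open>The symmetry of \<open>a\<close> makes \<open>B\<close> act trivially on each
      diagonal unit \<open>E\<close>, and \<open>B E + E B^t = 0\<close> kills one column of
      \<open>B\<close>.\<close>
    define B where "B = A Y - Y ** S"
    have B: "B ** E + E ** transpose B = 0" if E: "E \<in> symmat" "A E = E ** S" for E
    proof -
      have "B ** E + E ** transpose B = (A Y ** E + E ** transpose (A Y)) - (Y ** S ** E + E ** transpose (Y ** S))"
        by (simp add: B_def expand algebra_simps)
      also have "A Y ** E + E ** transpose (A Y) = A E ** Y + Y ** transpose (A E)"
        by (rule eq[OF Y E(1)])
      also have "\<dots> = Y ** S ** E + E ** transpose (Y ** S)"
        using E Y S by (simp add: symmat_def matrix_transpose_mul matrix_mul_assoc add.commute)
      finally show ?thesis by simp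
    qed
    have "B = 0"
      using B[of E11] B[of E22] B[of E33] AE by (simp add: expand)
    then show ?thesis by (simp add: B_def)
  qed
  show thesis
  proof (rule that[OF S])
    fix X Y assume XY: "X \<in> symmat" "Y \<in> symmat"
    then show "a X Y = X ** S ** Y + Y ** S ** X"
      using S by (simp add: A AY matrix_transpose_mul matrix_mul_assoc symmat_def)
  qed
qed

text \<open>The exchange of \<open>Y\<close> and \<open>Z\<close> overdetermines \<open>T\<close>:
  instances at unit matrices force \<open>T\<close> to vanish on the diagonal units, and exchanging
  \<open>Z\<close> with a diagonal unit then extracts all entries of \<open>T Z\<close>.\<close>

lemma det_symmetry_second_prolongation:
  assumes T: "\<And>Z. Z \<in> symmat \<Longrightarrow> T Z \<in> symmat"
    and eq: "\<And>X Y Z. X \<in> symmat \<Longrightarrow> Y \<in> symmat \<Longrightarrow> Z \<in> symmat \<Longrightarrow>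
      X ** T Z ** Y + Y ** T Z ** X = X ** T Y ** Z + Z ** T Y ** X"
    and Z: "Z \<in> symmat"
  shows "T Z = 0"
proof -
  note expand = cmat_eq_iff cmat_mult_nth
  have sym: "T Z $ 2 $ 1 = T Z $ 1 $ 2" "T Z $ 3 $ 1 = T Z $ 1 $ 3" "T Z $ 3 $ 2 = T Z $ 2 $ 3" if "Z \<in> symmat" for Z
    using T[OF that] by (auto simp: symmat_iff)
  have "T E22 $ 1 $ 1 = 0 \<and> T E11 $ 1 $ 2 = 0" using eq[of E11 E11 E22] by (simp add: expand)
  moreover have "T E33 $ 1 $ 1 = 0 \<and> T E11 $ 1 $ 3 = 0" using eq[of E11 E11 E33] by (simp add: expand)
  moreover have "T E11 $ 2 $ 2 = 0 \<and> T E22 $ 1 $ 2 = 0" using eq[of E22 E22 E11] by (simp add: expand sym)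
  moreover have "T E33 $ 2 $ 2 = 0 \<and> T E22 $ 2 $ 3 = 0" using eq[of E22 E22 E33] by (simp add: expand sym)
  moreover have "T E11 $ 3 $ 3 = 0 \<and> T E33 $ 1 $ 3 = 0" using eq[of E33 E33 E11] by (simp add: expand sym)
  moreover have "T E22 $ 3 $ 3 = 0 \<and> T E33 $ 2 $ 3 = 0" using eq[of E33 E33 E22] by (simp add: expand sym)
  moreover have "T E11 $ 2 $ 3 = 0" using eq[of E22 E33 E11] by (simp add: expand sym)
  moreover have "T E22 $ 1 $ 3 = 0" using eq[of E11 E33 E22] by (simp add: expand sym)
  moreover have "T E33 $ 1 $ 2 = 0" using eq[of E11 E22 E33] by (simp add: expand sym)
  moreover have "T E11 $ 1 $ 1 = 0" using eq[of E11 E11 E12] by (simp add: expand sym)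
  moreover have "T E22 $ 2 $ 2 = 0" using eq[of E22 E22 E12] by (simp add: expand sym)
  moreover have "T E33 $ 3 $ 3 = 0" using eq[of E33 E33 E13] by (simp add: expand sym)
  ultimately have T0: "T E11 = 0" "T E22 = 0" "T E33 = 0"
    by (simp_all add: cmat_eq_iff sym)
  have mult_0: "M ** 0 = 0" "0 ** M = 0" for M :: cmat
    by (simp_all add: expand)
  have D: "E ** T Z ** F + F ** T Z ** E = 0" if "E \<in> symmat" "F \<in> symmat" "T F = 0" for E F
    using eq[OF that(1,2) Z] that(3) by (simp add: mult_0)
  show ?thesis
    using D[OF _ _ T0(1), of E11] D[OF _ _ T0(2), of E22] D[OF _ _ T0(3), of E33]
      D[OF _ _ T0(2), of E11] D[OF _ _ T0(3), of E11] D[OF _ _ T0(3), of E22]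
    by (simp add: expand sym[OF Z])
qed

section \<open>Linear maps preserving the determinant up to a factor\<close>

text \<open>For a cubic form, subtracting the value at \<open>X - Y\<close> cancels the terms of
  even degree in \<open>Y\<close> and leaves those of degree 1 and 3. This expresses the derivative
  through values of \<open>det\<close>, so that a linear map scaling \<open>det\<close> also scales
  \<open>ddet\<close>.\<close>

lemma ddet_polarisation:
  assumes "X \<in> symmat" "Y \<in> symmat"
  shows "2 * ddet X Y = det (X + Y) - det (X - Y) - 2 * det Y"
  by (rule symmat_cases[OF assms(1)], rule symmat_cases[OF assms(2)])
     (simp add: smat_add smat_diff det_smat ddet_def power2_eq_square algebra_simps)

lemma linear_on_symmatD:
  assumes "linear_on_symmat F" "X \<in> symmat" "Y \<in> symmat"
  shows "F (X + Y) = F X + F Y" "F (cscale c X) = cscale c (F X)" "F X \<in> symmat" "F (X - Y) = F X - F Y" "F 0 = 0"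
proof -
  show add: "F (X + Y) = F X + F Y" and scale: "F (cscale c X) = cscale c (F X)" and "F X \<in> symmat"
    using assms by (auto simp: linear_on_symmat_def)
  have neg: "F (cscale (-1) Y) = cscale (-1) (F Y)" and 0: "F (cscale 0 X) = cscale 0 (F X)"
    using assms unfolding linear_on_symmat_def by blast+
  have "F (X + cscale (-1) Y) = F X + F (cscale (-1) Y)"
    using assms symmat_cscale by (auto simp: linear_on_symmat_def)
  moreover have "cscale (-1) Z = - Z" for Z by (simp add: cscale_def vec_eq_iff)
  ultimately show "F (X - Y) = F X - F Y" using neg by simp
  have "cscale 0 Z = 0" for Z by (simp add: cscale_def vec_eq_iff)
  then show "F 0 = 0" using 0 by simp
qed

lemma linear_on_symmat_scale:
  assumes "linear_on_symmat F" "X \<in> symmat"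
  shows "F (cscale c X) = cscale c (F X)"
  using linear_on_symmatD(2)[OF assms assms(2)] .

text \<open>The first three test matrices extract the diagonal entries of \<open>X\<close>; each of
  the others then isolates one off-diagonal entry.\<close>

lemma ddet_nondegenerate:
  assumes "X \<in> symmat" "\<And>Y. Y \<in> symmat \<Longrightarrow> ddet Y X = 0"
  shows "X = 0"
  using assms(2)[of "smat 0 1 1 0 0 0"] assms(2)[of "smat 1 0 1 0 0 0"] assms(2)[of "smat 1 1 0 0 0 0"]
    assms(2)[of "smat 0 0 1 1 0 0"] assms(2)[of "smat 0 1 0 0 1 0"] assms(2)[of "smat 1 0 0 0 0 1"]
    assms(1)
  by (simp add: ddet_def cmat_eq_iff symmat_iff)

definition det_similitude :: "complex \<Rightarrow> (cmat \<Rightarrow> cmat) \<Rightarrow> bool" where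
  "det_similitude k F \<longleftrightarrow> linear_on_symmat F \<and> k \<noteq> 0 \<and> (\<forall>X\<in>symmat. det (F X) = k * det X)"

lemma det_similitude_ddet:
  assumes "det_similitude k F" "X \<in> symmat" "Y \<in> symmat"
  shows "ddet (F X) (F Y) = k * ddet X Y"
proof -
  have lin: "linear_on_symmat F" and det: "\<And>X. X \<in> symmat \<Longrightarrow> det (F X) = k * det X"
    using assms by (auto simp: det_similitude_def)
  note XY = assms(2,3)
  have "2 * ddet (F X) (F Y) = det (F X + F Y) - det (F X - F Y) - 2 * det (F Y)"
    by (intro ddet_polarisation linear_on_symmatD(3)[OF lin XY(1) XY(1)] linear_on_symmatD(3)[OF lin XY(2) XY(2)])
  also have "\<dots> = k * (det (X + Y) - det (X - Y) - 2 * det Y)"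
    using XY by (simp add: det symmat_add symmat_diff algebra_simps flip: linear_on_symmatD(1,4)[OF lin XY])
  also have "\<dots> = k * (2 * ddet X Y)" by (simp only: ddet_polarisation[OF XY])
  finally have "2 * ddet (F X) (F Y) = 2 * (k * ddet X Y)" by simp
  then show ?thesis by simp
qed

text \<open>A nonzero kernel element of \<open>F\<close> would be annihilated by all derivatives of
  \<open>det\<close>, contradicting nondegeneracy; surjectivity is then a dimension count.\<close>

lemma det_similitude_bij:
  assumes "det_similitude k F"
  shows "bij_betw F symmat symmat"
proof -
  have lin: "linear_on_symmat F" and k: "k \<noteq> 0" using assms by (auto simp: det_similitude_def)
  have ker: "X = 0" if X: "X \<in> symmat" "F X = 0" for X
  proof (rule ddet_nondegenerate[OF X(1)])
    fix Y assume "Y \<in> symmat"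
    then show "ddet Y X = 0"
      using det_similitude_ddet[OF assms \<open>Y \<in> symmat\<close> X(1)] X(2) k by (simp add: ddet_def)
  qed
  have sylin: "linear symmetric_part"
    by (rule bounded_linear.linear[OF bounded_linear_symmetric_part])
  have Fr: "F (r *\<^sub>R X) = r *\<^sub>R F X" if "X \<in> symmat" for r X
  proof -
    have "r *\<^sub>R Z = cscale (complex_of_real r) Z" for Z
      by (simp add: cscale_def vec_eq_iff scaleR_conv_of_real[where 'a = complex])
    then show ?thesis using linear_on_symmatD(2)[OF lin that that] by simp
  qed
  \<comment> \<open>Extends \<open>F\<close> by the identity on antisymmetric matrices to an
    endomorphism of the full matrix space, where injective linear maps are surjective.\<close>
  define G where "G = (\<lambda>X. F (symmetric_part X) + (X - symmetric_part X))"
  have G: "linear G"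
    by (rule linearI)
       (simp_all add: G_def linear_add[OF sylin] linear_scale[OF sylin] linear_on_symmatD(1)[OF lin] symmetric_part_symmat Fr algebra_simps)
  have syG: "symmetric_part (G X) = F (symmetric_part X)" for X
  proof -
    have "symmetric_part (X - symmetric_part X) = 0" using symmetric_part_id[OF symmetric_part_symmat[of X]] by (simp add: linear_diff[OF sylin])
    then show ?thesis
      by (simp add: G_def linear_add[OF sylin] symmetric_part_id[OF linear_on_symmatD(3)[OF lin symmetric_part_symmat symmetric_part_symmat]])
  qed
  have "inj G"
  proof (rule linear_injective_0[OF G, THEN iffD2], intro allI impI)
    fix X assume 0: "G X = 0"
    then have "F (symmetric_part X) = 0" using syG[of X] by (simp add: linear_0[OF sylin])
    then show "X = 0" using ker[OF symmetric_part_symmat, of X] 0 by (simp add: G_def linear_on_symmatD(5)[OF lin symmat_0 symmat_0])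
  qed
  then have "surj G" using G linear_injective_imp_surjective by blast
  show ?thesis
  proof (rule bij_betw_imageI)
    show "inj_on F symmat"
      by (rule inj_onI) (metis eq_iff_diff_eq_0 ker lin linear_on_symmatD(4) symmat_diff)
    show "F ` symmat = symmat"
    proof
      show "F ` symmat \<subseteq> symmat" using linear_on_symmatD(3)[OF lin] by auto
      show "symmat \<subseteq> F ` symmat"
      proof
        fix W assume "W \<in> symmat"
        obtain X where "G X = W" using \<open>surj G\<close> by (metis surjD)
        then show "W \<in> F ` symmat" using syG[of X] symmetric_part_id[OF \<open>W \<in> symmat\<close>] symmetric_part_symmat by force
      qed
    qed
  qed
qed

text \<open>Rank at most one is expressed as vanishing of the whole differential of
  \<open>det\<close>, that is, of all 2 by 2 minors. In this form it is visibly invariant under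
  bijections that scale \<open>ddet\<close>.\<close>

definition rank_le_1 :: "cmat \<Rightarrow> bool" where
  "rank_le_1 X \<longleftrightarrow> X \<in> symmat \<and> (\<forall>Y\<in>symmat. ddet X Y = 0)"

lemma rank_le_1_smat:
  "rank_le_1 (smat p q r s t u) \<longleftrightarrow>
     q * r = u^2 \<and> p * r = t^2 \<and> p * q = s^2 \<and> t * u = s * r \<and> s * u = t * q \<and> s * t = p * u"
proof
  assume "rank_le_1 (smat p q r s t u)"
  then have *: "ddet (smat p q r s t u) Y = 0" if "Y \<in> symmat" for Y
    using that by (auto simp: rank_le_1_def)
  show "q * r = u^2 \<and> p * r = t^2 \<and> p * q = s^2 \<and> t * u = s * r \<and> s * u = t * q \<and> s * t = p * u"
    using *[of E11] *[of E22] *[of E33] *[of E12] *[of E13] *[of E23] by (simp add: ddet_def)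
qed (auto simp: rank_le_1_def ddet_def)

lemma det_similitude_rank_le_1:
  assumes F: "det_similitude k F" and X: "rank_le_1 X"
  shows "rank_le_1 (F X)"
proof -
  have "ddet (F X) W = 0" if "W \<in> symmat" for W
  proof -
    obtain Y where Y: "Y \<in> symmat" "W = F Y"
      using det_similitude_bij[OF F] \<open>W \<in> symmat\<close> by (metis bij_betw_imp_surj_on imageE)
    then show ?thesis using det_similitude_ddet[OF F _ Y(1), of X] X by (simp add: rank_le_1_def)
  qed
  then show ?thesis
    using F X linear_on_symmatD(3) by (auto simp: rank_le_1_def det_similitude_def)
qed

text \<open>The product \<open>v v^t\<close> for the column vector
  \<open>v = (x, y, z)^t\<close>.\<close>

definition sq_smat :: "complex \<Rightarrow> complex \<Rightarrow> complex \<Rightarrow> cmat" where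
  "sq_smat x y z = smat (x^2) (y^2) (z^2) (x * y) (x * z) (y * z)"

text \<open>The vector is found by taking a square root of the first nonzero diagonal entry and
  dividing its row by that root. If the first two diagonal entries vanish, the minors leave only the
  third.\<close>

lemma rank_le_1_sq:
  assumes "rank_le_1 X"
  obtains x y z where "X = sq_smat x y z"
proof -
  obtain p q r s t u where X: "X = smat p q r s t u"
    using assms symmat_cases by (metis rank_le_1_def)
  have eqs: "q * r = u^2" "p * r = t^2" "p * q = s^2" "t * u = s * r" "s * u = t * q" "s * t = p * u"
    using assms by (simp_all add: X rank_le_1_smat)
  consider "p \<noteq> 0" | "p = 0" "q \<noteq> 0" | "p = 0" "q = 0" by blast
  then show thesis
  proof cases
    case 1
    define x where "x = csqrt p"
    have x: "x^2 = p" "x \<noteq> 0" using 1 by (auto simp: x_def)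
    have "X = sq_smat x (s / x) (t / x)"
      using eqs x 1 by (simp add: X sq_smat_def cmat_eq_iff power_divide nonzero_eq_divide_eq mult.commute flip: power2_eq_square)
    then show thesis by (rule that)
  next
    case 2
    define y where "y = csqrt q"
    have y: "y^2 = q" "y \<noteq> 0" using 2 by (auto simp: y_def)
    have "X = sq_smat 0 y (u / y)"
      using eqs y 2 by (simp add: X sq_smat_def cmat_eq_iff power_divide nonzero_eq_divide_eq mult.commute flip: power2_eq_square)
    then show thesis by (rule that)
  next
    case 3
    have "X = sq_smat 0 0 (csqrt r)" using eqs 3 by (simp add: X sq_smat_def cmat_eq_iff)
    then show thesis by (rule that)
  qed
qed

text \<open>The image of every \<open>v v^t\<close> again has vanishing minors, which gives
  polynomial identities in the coordinates of \<open>v\<close>. With the diagonal units fixed, they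
  force each off-diagonal unit to be multiplied by a sign.\<close>

lemma det_similitude_normalised:
  assumes G: "det_similitude 1 G" and id: "G E11 = E11" "G E22 = E22" "G E33 = E33"
  obtains D where "\<And>X. X \<in> symmat \<Longrightarrow> G X = D ** X ** transpose D"
proof -
  have lin: "linear_on_symmat G" using G by (simp add: det_similitude_def)
  note nth = linear_on_symmat_nth[OF lin]
  have rk: "rank_le_1 (G (sq_smat x y z))" for x y z
    by (rule det_similitude_rank_le_1[OF G]) (simp add: sq_smat_def rank_le_1_smat power2_eq_square)
  have Gs: "G X = smat (G X $ 1 $ 1) (G X $ 2 $ 2) (G X $ 3 $ 3) (G X $ 1 $ 2) (G X $ 1 $ 3) (G X $ 2 $ 3)" if "X \<in> symmat" for X
    using linear_on_symmatD(3)[OF lin that that] by (auto simp: cmat_eq_iff symmat_iff)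
  have K: "b * c = f^2 \<and> a * c = e^2 \<and> a * b = d^2 \<and> e * f = d * c \<and> d * f = e * b \<and> d * e = a * f"
    if "a = x^2 + x * y * G E12 $ 1 $ 1 + x * z * G E13 $ 1 $ 1 + y * z * G E23 $ 1 $ 1"
      "b = y^2 + x * y * G E12 $ 2 $ 2 + x * z * G E13 $ 2 $ 2 + y * z * G E23 $ 2 $ 2"
      "c = z^2 + x * y * G E12 $ 3 $ 3 + x * z * G E13 $ 3 $ 3 + y * z * G E23 $ 3 $ 3"
      "d = x * y * G E12 $ 1 $ 2 + x * z * G E13 $ 1 $ 2 + y * z * G E23 $ 1 $ 2"
      "e = x * y * G E12 $ 1 $ 3 + x * z * G E13 $ 1 $ 3 + y * z * G E23 $ 1 $ 3"
      "f = x * y * G E12 $ 2 $ 3 + x * z * G E13 $ 2 $ 3 + y * z * G E23 $ 2 $ 3" for x y z a b c d e f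
    using rk[of x y z] unfolding sq_smat_def
    by (subst (asm) Gs) (simp_all add: nth[of "x^2" "y^2" "z^2" "x * y" "x * z" "y * z"] id rank_le_1_smat that)
  note K = K[OF refl refl refl refl refl refl]
  have s33: "G E12 $ 3 $ 3 = 0"
    using K[where x=1 and y=1 and z=0] K[where x=1 and y="-1" and z=0] by (simp, elim conjE, algebra)
  have s13: "G E12 $ 1 $ 3 = 0" and s23: "G E12 $ 2 $ 3 = 0"
    using K[where x=1 and y=1 and z=0] by (simp_all add: s33)
  have sab: "G E12 $ 1 $ 1 + G E12 $ 2 $ 2 = 0" "4 * G E12 $ 1 $ 1 + G E12 $ 2 $ 2 = 0"
    using K[where x=1 and y=1 and z=0] K[where x=1 and y="-1" and z=0] K[where x=1 and y=2 and z=0] by (simp, elim conjE, algebra)+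
  then have s11: "G E12 $ 1 $ 1 = 0" and s22: "G E12 $ 2 $ 2 = 0"
    by algebra+
  have s12: "(G E12 $ 1 $ 2)^2 = 1"
    using K[where x=1 and y=1 and z=0] by (simp add: s11 s22)
  have t22: "G E13 $ 2 $ 2 = 0"
    using K[where x=1 and y=0 and z=1] K[where x=1 and y=0 and z="-1"] by (simp, elim conjE, algebra)
  have t12: "G E13 $ 1 $ 2 = 0" and t23: "G E13 $ 2 $ 3 = 0"
    using K[where x=1 and y=0 and z=1] by (simp_all add: t22)
  have tab: "G E13 $ 1 $ 1 + G E13 $ 3 $ 3 = 0" "4 * G E13 $ 1 $ 1 + G E13 $ 3 $ 3 = 0"
    using K[where x=1 and y=0 and z=1] K[where x=1 and y=0 and z="-1"] K[where x=1 and y=0 and z=2] by (simp, elim conjE, algebra)+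
  then have t11: "G E13 $ 1 $ 1 = 0" and t33: "G E13 $ 3 $ 3 = 0"
    by algebra+
  have t13: "(G E13 $ 1 $ 3)^2 = 1"
    using K[where x=1 and y=0 and z=1] by (simp add: t11 t33)
  have u11: "G E23 $ 1 $ 1 = 0"
    using K[where x=0 and y=1 and z=1] K[where x=0 and y=1 and z="-1"] by (simp, elim conjE, algebra)
  have u12: "G E23 $ 1 $ 2 = 0" and u13: "G E23 $ 1 $ 3 = 0"
    using K[where x=0 and y=1 and z=1] by (simp_all add: u11)
  have uab: "G E23 $ 2 $ 2 + G E23 $ 3 $ 3 = 0" "4 * G E23 $ 2 $ 2 + G E23 $ 3 $ 3 = 0"
    using K[where x=0 and y=1 and z=1] K[where x=0 and y=1 and z="-1"] K[where x=0 and y=1 and z=2] by (simp, elim conjE, algebra)+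
  then have u22: "G E23 $ 2 $ 2 = 0" and u33: "G E23 $ 3 $ 3 = 0"
    by algebra+
  have u23: "(G E23 $ 2 $ 3)^2 = 1"
    using K[where x=0 and y=1 and z=1] by (simp add: u22 u33)
  note z = s33 s13 s23 s11 s22 t22 t12 t23 t11 t33 u11 u12 u13 u22 u33
  define \<alpha> \<beta> \<gamma> where "\<alpha> = G E12 $ 1 $ 2" and "\<beta> = G E13 $ 1 $ 3" and "\<gamma> = G E23 $ 2 $ 3"
  have sq: "\<alpha>^2 = 1" "\<beta>^2 = 1" "\<gamma>^2 = 1" using s12 t13 u23 by (simp_all add: \<alpha>_def \<beta>_def \<gamma>_def)
  have G_smat: "G (smat p q r s t u) = smat p q r (s * \<alpha>) (t * \<beta>) (u * \<gamma>)" for p q r s t u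
    by (subst Gs) (simp_all add: nth[of p q r s t u] id z \<alpha>_def \<beta>_def \<gamma>_def)
  \<comment> \<open>On this matrix only the term \<open>2 * s * t * u\<close> of the determinant
    survives, so preservation of \<open>det\<close> links the three signs.\<close>
  have "det (G (smat 0 0 0 1 1 1)) = det (smat 0 0 0 1 1 1)"
    using G unfolding det_similitude_def by (metis mult_1 smat_in_symmat)
  then have "\<alpha> * \<beta> * \<gamma> = 1" unfolding G_smat det_smat by (simp add: mult.assoc)
  then have \<gamma>: "\<gamma> = \<alpha> * \<beta>" using sq by algebra
  \<comment> \<open>Congruence by \<open>diag(1, \<alpha>, \<beta>)\<close> multiplies the three
    off-diagonal positions by \<open>\<alpha>\<close>, \<open>\<beta>\<close> and
    \<open>\<alpha> * \<beta>\<close>.\<close>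
  define D where "D = smat 1 \<alpha> \<beta> 0 0 0"
  have "G X = D ** X ** transpose D" if X: "X \<in> symmat" for X
  proof -
    obtain p q r s t u where X: "X = smat p q r s t u" using symmat_cases[OF X] .
    show ?thesis
      unfolding X using sq by (simp add: G_smat cmat_eq_iff cmat_mult_nth transpose_nth D_def \<gamma> power2_eq_square algebra_simps)
  qed
  then show thesis by (rule that)
qed

lemma det_congruence: "det (P ** X ** transpose P) = det P ^ 2 * det (X :: cmat)"
  by (simp add: det_mul power2_eq_square)

lemma linear_on_symmat_congruence:
  assumes "linear_on_symmat F"
  shows "linear_on_symmat (\<lambda>X. P ** F X ** transpose P)"
  using assms unfolding linear_on_symmat_def
  by (auto simp: cmat_eq_iff cmat_mult_nth transpose_nth symmat_iff cscale_def algebra_simps)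

text \<open>The diagonal units have rank one, so their images are \<open>p p^t\<close>,
  \<open>q q^t\<close> and \<open>r r^t\<close>. The matrix \<open>P\<close> with columns
  \<open>p\<close>, \<open>q\<close>, \<open>r\<close> produces the same images, and undoing
  \<open>P\<close> leaves a map that fixes the diagonal units.\<close>

theorem det_similitude_congruence:
  assumes F: "det_similitude k F"
  obtains P where "invertible P" "\<And>X. X \<in> symmat \<Longrightarrow> F X = P ** X ** transpose P"
proof -
  have lin: "linear_on_symmat F" and k: "k \<noteq> 0" and det: "\<And>X. X \<in> symmat \<Longrightarrow> det (F X) = k * det X"
    using F by (auto simp: det_similitude_def)
  have rk: "rank_le_1 (F E11)" "rank_le_1 (F E22)" "rank_le_1 (F E33)"
    by (rule det_similitude_rank_le_1[OF F], simp add: rank_le_1_smat)+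
  obtain p1 p2 p3 where p: "F E11 = sq_smat p1 p2 p3" using rank_le_1_sq[OF rk(1)] .
  obtain q1 q2 q3 where q: "F E22 = sq_smat q1 q2 q3" using rank_le_1_sq[OF rk(2)] .
  obtain r1 r2 r3 where r: "F E33 = sq_smat r1 r2 r3" using rank_le_1_sq[OF rk(3)] .
  define P :: cmat where "P = vector [vector [p1, q1, r1], vector [p2, q2, r2], vector [p3, q3, r3]]"
  have Pn: "P $ 1 $ 1 = p1" "P $ 1 $ 2 = q1" "P $ 1 $ 3 = r1" "P $ 2 $ 1 = p2" "P $ 2 $ 2 = q2" "P $ 2 $ 3 = r2"
    "P $ 3 $ 1 = p3" "P $ 3 $ 2 = q3" "P $ 3 $ 3 = r3" by (simp_all add: P_def vector_3)
  have P1: "P ** E11 ** transpose P = F E11" "P ** E22 ** transpose P = F E22" "P ** E33 ** transpose P = F E33"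
    by (simp_all add: cmat_eq_iff cmat_mult_nth transpose_nth Pn p q r sq_smat_def power2_eq_square)
  \<comment> \<open>Evaluation at the identity matrix shows that \<open>det P ^ 2\<close> is the
    factor \<open>k\<close>; hence \<open>P\<close> is invertible and the normalised map has factor
    1.\<close>
  have "F (smat 1 1 1 0 0 0) = P ** smat 1 1 1 0 0 0 ** transpose P"
    by (simp add: cmat_eq_iff linear_on_symmat_nth[OF lin, of 1 1 1 0 0 0] p q r sq_smat_def cmat_mult_nth transpose_nth Pn power2_eq_square)
  then have detP: "det P ^ 2 = k"
    using det[of "smat 1 1 1 0 0 0"] by (simp add: det_congruence det_smat)
  then have "invertible P" using k by (auto simp: invertible_det_nz)
  then obtain Q where Q: "Q ** P = mat 1" "P ** Q = mat 1" by (auto simp: invertible_def)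
  have QT: "transpose P ** transpose Q = mat 1" "transpose Q ** transpose P = mat 1"
    by (simp_all add: Q flip: matrix_transpose_mul)
  have detQ: "det Q * det P = 1" by (simp add: Q flip: det_mul)
  define G where "G = (\<lambda>X. Q ** F X ** transpose Q)"
  have cancel: "Q ** (P ** X ** transpose P) ** transpose Q = X" "P ** (Q ** X ** transpose Q) ** transpose P = X" for X
    by (metis Q QT matrix_mul_assoc matrix_mul_lid matrix_mul_rid)+
  have "det_similitude 1 G"
    unfolding det_similitude_def
  proof (intro conjI ballI)
    show "linear_on_symmat G" unfolding G_def by (rule linear_on_symmat_congruence[OF lin])
    fix X assume "X \<in> symmat"
    then show "det (G X) = 1 * det X"
      unfolding G_def det_congruence det[OF \<open>X \<in> symmat\<close>] detP[symmetric]
      using detQ by algebra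
  qed simp
  moreover have "G E11 = E11" "G E22 = E22" "G E33 = E33"
    by (simp_all only: G_def P1[symmetric] cancel)
  ultimately obtain D where D: "\<And>X. X \<in> symmat \<Longrightarrow> G X = D ** X ** transpose D"
    using det_similitude_normalised by blast
  have FX: "F X = (P ** D) ** X ** transpose (P ** D)" if "X \<in> symmat" for X
  proof -
    have "F X = P ** G X ** transpose P" by (simp add: G_def cancel)
    then show ?thesis using D[OF that] by (simp add: matrix_transpose_mul matrix_mul_assoc)
  qed
  have "det (F (mat 1)) \<noteq> 0" using det[OF symmat_1] k by simp
  then have "invertible (P ** D)"
    by (simp add: FX[OF symmat_1] det_mul invertible_det_nz)
  then show thesis using that FX by blast
qed

section \<open>The symplectic group and its action\<close>

lemma matrix_mult_add_left: "(A + B) ** C = A ** C + B ** (C :: 'a::ring_1^'n^'m)"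
  and matrix_mult_add_right: "D ** (E + F) = D ** E + D ** (F :: 'a::ring_1^'n^'m)"
  and matrix_mult_diff_left: "(A - B) ** C = A ** C - B ** C"
  and matrix_mult_diff_right: "D ** (E - F) = D ** E - D ** F"
  and matrix_mult_minus_left: "(- A) ** C = - (A ** C)"
  and matrix_mult_minus_right: "D ** (- E) = - (D ** E)"
  and matrix_mult_0_left: "(0 :: 'a^'m^'k) ** C = 0"
  and matrix_mult_0_right: "D ** 0 = (0 :: 'a^'n^'m)"
  by (simp_all add: vec_eq_iff matrix_matrix_mult_def algebra_simps sum.distrib sum_subtractf sum_negf)

lemma transpose_add: "transpose (A + B) = transpose A + transpose (B :: 'a::ab_group_add^'n^'m)"
  and transpose_diff: "transpose (A - B) = transpose A - transpose B"
  and transpose_minus: "transpose (- A) = - transpose A"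
  and transpose_0: "transpose (0 :: 'b::zero^'n^'m) = 0"
  by (simp_all add: vec_eq_iff transpose_nth)

lemmas matrix_ring_simps = matrix_mult_add_left matrix_mult_add_right matrix_mult_diff_left matrix_mult_diff_right
  matrix_mult_minus_left matrix_mult_minus_right matrix_mult_0_left matrix_mult_0_right
  transpose_add transpose_diff transpose_minus transpose_0 matrix_transpose_mul matrix_mul_assoc

lemma matrix_inv_eqI:
  fixes A :: "'a::field^'n^'n"
  assumes "A ** B = mat 1"
  shows "matrix_inv A = B"
proof -
  have BA: "B ** A = mat 1" using assms matrix_left_right_inverse by blast
  have "\<exists>A'. A ** A' = mat 1 \<and> A' ** A = mat 1" using assms BA by blast
  then have "A ** matrix_inv A = mat 1 \<and> matrix_inv A ** A = mat 1"
    unfolding matrix_inv_def by (rule someI_ex)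
  then show ?thesis by (metis BA matrix_mul_assoc matrix_mul_lid matrix_mul_rid)
qed

lemma matrix_inv_mult:
  fixes A :: "'a::field^'n^'n"
  assumes "invertible A"
  shows "A ** matrix_inv A = mat 1" "matrix_inv A ** A = mat 1"
  using assms matrix_inv_eqI unfolding invertible_def by metis+

lemma invertible_cancel_right:
  fixes A :: "'a::field^'n^'n"
  assumes "invertible A" "B ** A = C ** A"
  shows "B = C"
  by (metis assms matrix_inv_mult(1) matrix_mul_assoc matrix_mul_rid)

lemma sum_UNIV_Plus: "(\<Sum>x\<in>(UNIV :: ('a::finite + 'b::finite) set). f x) = (\<Sum>x\<in>UNIV. f (Inl x)) + (\<Sum>x\<in>UNIV. f (Inr x))"
  unfolding UNIV_Plus_UNIV[symmetric] by (subst sum.Plus) auto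

definition block_matrix :: "cmat \<Rightarrow> cmat \<Rightarrow> cmat \<Rightarrow> cmat \<Rightarrow> cmat6" where
  "block_matrix A B C D = (\<chi> i j. case i of
     Inl i' \<Rightarrow> (case j of Inl j' \<Rightarrow> A $ i' $ j' | Inr j' \<Rightarrow> B $ i' $ j')
   | Inr i' \<Rightarrow> (case j of Inl j' \<Rightarrow> C $ i' $ j' | Inr j' \<Rightarrow> D $ i' $ j'))"

lemma blocks_block_matrix [simp]:
  "blockA (block_matrix A B C D) = A" "blockB (block_matrix A B C D) = B"
  "blockC (block_matrix A B C D) = C" "blockD (block_matrix A B C D) = D"
  by (simp_all add: vec_eq_iff blockA_def blockB_def blockC_def blockD_def block_matrix_def)

lemma blocks_mult:
  "blockA (M ** N) = blockA M ** blockA N + blockB M ** blockC N"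
  "blockB (M ** N) = blockA M ** blockB N + blockB M ** blockD N"
  "blockC (M ** N) = blockC M ** blockA N + blockD M ** blockC N"
  "blockD (M ** N) = blockC M ** blockB N + blockD M ** blockD N"
  by (simp_all add: vec_eq_iff blockA_def blockB_def blockC_def blockD_def matrix_matrix_mult_def sum_UNIV_Plus)

lemma blocks_mat_1 [simp]:
  "blockA (mat 1) = mat 1" "blockB (mat 1) = 0" "blockC (mat 1) = 0" "blockD (mat 1) = mat 1"
  by (simp_all add: vec_eq_iff blockA_def blockB_def blockC_def blockD_def mat_def)

lemma blocks_minus [simp]:
  "blockA (- M) = - blockA M" "blockB (- M) = - blockB M" "blockC (- M) = - blockC M" "blockD (- M) = - blockD M"
  by (simp_all add: vec_eq_iff blockA_def blockB_def blockC_def blockD_def)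

lemma block_eqI:
  assumes "blockA M = blockA N" "blockB M = blockB N" "blockC M = blockC N" "blockD M = blockD N"
  shows "M = N"
proof -
  have "M $ i $ j = N $ i $ j" for i j
    using assms by (cases i; cases j) (simp_all add: vec_eq_iff blockA_def blockB_def blockC_def blockD_def)
  then show ?thesis by (simp add: vec_eq_iff)
qed

text \<open>The adjoint \<open>J^{-1} M^t J\<close> with respect to the symplectic form
  \<open>J\<close>, written in blocks. It reverses products for all matrices, and it is the inverse
  of \<open>M\<close> exactly when \<open>M\<close> is symplectic.\<close>

definition sp_inverse :: "cmat6 \<Rightarrow> cmat6" where
  "sp_inverse M = block_matrix (transpose (blockD M)) (- transpose (blockB M)) (- transpose (blockC M)) (transpose (blockA M))"

lemma blocks_sp_inverse [simp]:
  "blockA (sp_inverse M) = transpose (blockD M)" "blockB (sp_inverse M) = - transpose (blockB M)"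
  "blockC (sp_inverse M) = - transpose (blockC M)" "blockD (sp_inverse M) = transpose (blockA M)"
  by (simp_all add: sp_inverse_def)

lemma sp_inverse_mult: "sp_inverse (M ** N) = sp_inverse N ** sp_inverse M"
  by (rule block_eqI) (simp_all add: blocks_mult matrix_ring_simps add.commute)

lemma sp_inverse_sp_inverse: "sp_inverse (sp_inverse M) = M"
  by (rule block_eqI) (simp_all add: matrix_ring_simps)

text \<open>Three blocks of the product are the defining relations; the remaining one is the
  transpose of the third relation.\<close>

lemma Sp6_iff: "M \<in> carrier Sp6 \<longleftrightarrow> sp_inverse M ** M = mat 1"
proof
  assume "M \<in> carrier Sp6"
  then have *: "transpose (blockA M) ** blockC M = transpose (blockC M) ** blockA M"
      "transpose (blockB M) ** blockD M = transpose (blockD M) ** blockB M"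
      "transpose (blockA M) ** blockD M - transpose (blockC M) ** blockB M = mat 1"
    by (simp_all add: Sp6_def)
  have **: "transpose (blockD M) ** blockA M - transpose (blockB M) ** blockC M = mat 1"
    using arg_cong[OF *(3), of transpose] by (simp add: matrix_ring_simps)
  show "sp_inverse M ** M = mat 1"
    using * ** by (intro block_eqI) (simp_all add: blocks_mult matrix_ring_simps)
next
  assume *: "sp_inverse M ** M = mat 1"
  show "M \<in> carrier Sp6"
    using arg_cong[OF *, of blockB] arg_cong[OF *, of blockC] arg_cong[OF *, of blockD]
    by (simp add: Sp6_def blocks_mult matrix_ring_simps)
qed

lemma Sp6_simps: "mult Sp6 M N = M ** N" "one Sp6 = mat 1"
  by (simp_all add: Sp6_def)

lemma Sp6_inverse:
  assumes "M \<in> carrier Sp6"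
  shows "sp_inverse M ** M = mat 1" "M ** sp_inverse M = mat 1" "sp_inverse M \<in> carrier Sp6"
proof -
  show 1: "sp_inverse M ** M = mat 1" using assms Sp6_iff by blast
  then show 2: "M ** sp_inverse M = mat 1" using matrix_left_right_inverse by blast
  then show "sp_inverse M \<in> carrier Sp6" by (simp add: Sp6_iff sp_inverse_sp_inverse)
qed

lemma Sp6_mult:
  assumes "M \<in> carrier Sp6" "N \<in> carrier Sp6"
  shows "M ** N \<in> carrier Sp6"
proof -
  have "sp_inverse N ** sp_inverse M ** (M ** N) = sp_inverse N ** (sp_inverse M ** M) ** N"
    by (simp only: matrix_mul_assoc)
  then show ?thesis using assms by (simp add: Sp6_iff sp_inverse_mult)
qed

lemma Sp6_one: "mat 1 \<in> carrier Sp6"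
  by (simp add: Sp6_def transpose_0 matrix_ring_simps)

theorem Sp6_group: "group Sp6"
proof (rule groupI)
  fix M assume "M \<in> carrier Sp6"
  then show "\<exists>N\<in>carrier Sp6. N \<otimes>\<^bsub>Sp6\<^esub> M = \<one>\<^bsub>Sp6\<^esub>"
    using Sp6_inverse by (auto simp: Sp6_simps)
qed (auto simp: Sp6_simps Sp6_mult Sp6_one matrix_mul_assoc)

text \<open>The defining relations pair the block columns of \<open>M\<close>. Reading
  \<open>M ** sp_inverse M\<close> instead of \<open>sp_inverse M ** M\<close> yields the last two,
  which pair its block rows.\<close>

lemma Sp6_relations:
  assumes "M \<in> carrier Sp6"
  shows "transpose (blockA M) ** blockC M = transpose (blockC M) ** blockA M"
    "transpose (blockB M) ** blockD M = transpose (blockD M) ** blockB M"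
    "transpose (blockA M) ** blockD M - transpose (blockC M) ** blockB M = mat 1"
    "transpose (blockD M) ** blockA M - transpose (blockB M) ** blockC M = mat 1"
    "blockC M ** transpose (blockD M) = blockD M ** transpose (blockC M)"
    "blockD M ** transpose (blockA M) - blockC M ** transpose (blockB M) = mat 1"
proof -
  note L = Sp6_inverse(1)[OF assms] and R = Sp6_inverse(2)[OF assms]
  show "transpose (blockA M) ** blockC M = transpose (blockC M) ** blockA M"
    "transpose (blockB M) ** blockD M = transpose (blockD M) ** blockB M"
    "transpose (blockA M) ** blockD M - transpose (blockC M) ** blockB M = mat 1"
    using assms by (simp_all add: Sp6_def)
  show "transpose (blockD M) ** blockA M - transpose (blockB M) ** blockC M = mat 1"
    using arg_cong[OF L, of blockA] by (simp add: blocks_mult matrix_ring_simps)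
  show "blockC M ** transpose (blockD M) = blockD M ** transpose (blockC M)"
    using arg_cong[OF R, of blockC] by (simp add: blocks_mult matrix_ring_simps)
  show "blockD M ** transpose (blockA M) - blockC M ** transpose (blockB M) = mat 1"
    using arg_cong[OF R, of blockD] by (simp add: blocks_mult matrix_ring_simps)
qed

section \<open>The fractional linear action and its cocycle\<close>

definition num :: "cmat6 \<Rightarrow> cmat \<Rightarrow> cmat" where "num M U = blockA M ** U + blockB M"
definition den :: "cmat6 \<Rightarrow> cmat \<Rightarrow> cmat" where "den M U = blockC M ** U + blockD M"
definition act :: "cmat6 \<Rightarrow> cmat \<Rightarrow> cmat" where "act M U = num M U ** matrix_inv (den M U)"

lemma sp_action_eq: "sp_action M U = (if U \<in> symmat \<and> invertible (den M U) then Some (act M U) else None)"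
  by (simp add: sp_action_def num_def den_def act_def)

lemma dom_sp_action: "U \<in> dom (sp_action M) \<longleftrightarrow> U \<in> symmat \<and> invertible (den M U)"
  by (simp add: sp_action_eq dom_def)

lemma the_sp_action: "U \<in> dom (sp_action M) \<Longrightarrow> the (sp_action M U) = act M U"
  by (auto simp: sp_action_eq split: if_splits)

lemma act_den: "invertible (den M U) \<Longrightarrow> act M U ** den M U = num M U"
  by (simp add: act_def matrix_inv_mult flip: matrix_mul_assoc)

lemma act_eqI: "invertible (den M U) \<Longrightarrow> W ** den M U = num M U \<Longrightarrow> act M U = W"
  using act_den invertible_cancel_right by metis

text \<open>The pair \<open>(num N U, den N U)\<close> is \<open>N\<close> applied to the
  homogeneous coordinates \<open>(U, 1)\<close> of a Lagrangian plane. The hypothesis says that it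
  equals \<open>(W, 1)\<close> times \<open>den N U\<close>, and applying \<open>M\<close> to this
  gives the cocycle rule.\<close>

lemma num_den_mult:
  assumes "W ** den N U = num N U"
  shows "num (M ** N) U = num M W ** den N U" "den (M ** N) U = den M W ** den N U"
proof -
  have "num (M ** N) U = blockA M ** num N U + blockB M ** den N U"
    "den (M ** N) U = blockC M ** num N U + blockD M ** den N U"
    by (simp_all add: num_def den_def blocks_mult matrix_ring_simps algebra_simps)
  then show "num (M ** N) U = num M W ** den N U" "den (M ** N) U = den M W ** den N U"
    by (simp_all add: num_def[of M] den_def[of M] matrix_mult_add_left assms flip: matrix_mul_assoc)
qed

lemma sp_action_mult:
  assumes "sp_action N U = Some W"
  shows "sp_action M W = Some Z \<Longrightarrow> sp_action (M ** N) U = Some Z"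
    and "W \<in> symmat \<Longrightarrow> U \<in> dom (sp_action (M ** N)) \<Longrightarrow> W \<in> dom (sp_action M)"
proof -
  have N: "U \<in> symmat" "invertible (den N U)" "W ** den N U = num N U"
    using assms act_den by (auto simp: sp_action_eq split: if_splits)
  note MN = num_den_mult[OF N(3), of M]
  show "sp_action (M ** N) U = Some Z" if "sp_action M W = Some Z"
  proof -
    have M: "invertible (den M W)" "Z ** den M W = num M W"
      using that act_den by (auto simp: sp_action_eq split: if_splits)
    have "invertible (den (M ** N) U)" using M N by (simp add: MN invertible_mult)
    moreover have "act (M ** N) U = Z"
      using calculation by (rule act_eqI) (simp add: MN matrix_mul_assoc M)
    ultimately show ?thesis by (simp add: sp_action_eq N)
  qed
  show "W \<in> dom (sp_action M)" if "W \<in> symmat" "U \<in> dom (sp_action (M ** N))"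
    using that by (simp add: dom_sp_action MN invertible_det_nz det_mul)
qed

text \<open>After clearing denominators, the left-hand side is the symplectic pairing of the images
  of the block columns \<open>(U, 1)\<close> and \<open>(V, 1)\<close>. The matrix \<open>M\<close>
  preserves this pairing, whose value is \<open>V - U\<close>. The case \<open>U = V\<close> yields
  symmetry of the image; the general case yields injectivity and the derivative.\<close>

lemma act_difference:
  assumes M: "M \<in> carrier Sp6" and UV: "U \<in> symmat" "V \<in> symmat"
    and inv: "invertible (den M U)" "invertible (den M V)"
  shows "transpose (den M U) ** (act M V - transpose (act M U)) ** den M V = V - U"
proof -
  have tr: "transpose U = U" "transpose V = V" using UV by (simp_all add: symmat_def)
  note R = Sp6_relations[OF M]
  have "transpose (den M U) ** transpose (act M U) = transpose (num M U)"
    using act_den[OF inv(1)] by (metis matrix_transpose_mul)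
  then have "transpose (den M U) ** (act M V - transpose (act M U)) ** den M V
      = transpose (den M U) ** num M V - transpose (num M U) ** den M V"
    by (simp add: matrix_mult_diff_left matrix_mult_diff_right act_den[OF inv(2)] flip: matrix_mul_assoc)
  also have "\<dots> = U ** (transpose (blockC M) ** blockA M - transpose (blockA M) ** blockC M) ** V
      + (transpose (blockD M) ** blockA M - transpose (blockB M) ** blockC M) ** V
      - U ** (transpose (blockA M) ** blockD M - transpose (blockC M) ** blockB M)
      + (transpose (blockD M) ** blockB M - transpose (blockB M) ** blockD M)"
    by (simp add: den_def num_def matrix_ring_simps tr algebra_simps)
  also have "\<dots> = V - U"
    unfolding R(1-4) by (simp add: matrix_ring_simps)
  finally show ?thesis .
qed

lemma act_symmat:
  assumes "M \<in> carrier Sp6" "U \<in> symmat" "invertible (den M U)"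
  shows "act M U \<in> symmat"
proof -
  have inv: "invertible (transpose (den M U))" using assms(3) by (simp add: invertible_det_nz)
  have "transpose (den M U) ** (act M U - transpose (act M U)) ** den M U = 0 ** den M U"
    using act_difference[OF assms(1,2,2,3,3)] by (simp add: matrix_ring_simps)
  then have "transpose (den M U) ** (act M U - transpose (act M U)) = 0"
    using invertible_cancel_right[OF assms(3)] by blast
  then have "matrix_inv (transpose (den M U)) ** transpose (den M U) ** (act M U - transpose (act M U)) = 0"
    by (simp add: matrix_ring_simps flip: matrix_mul_assoc)
  then show ?thesis
    by (simp add: matrix_inv_mult[OF inv] symmat_def)
qed

lemma act_diff:
  assumes M: "M \<in> carrier Sp6" and UV: "U \<in> symmat" "V \<in> symmat"
    and inv: "invertible (den M U)" "invertible (den M V)"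
  shows "act M V - act M U = transpose (matrix_inv (den M U)) ** (V - U) ** matrix_inv (den M V)"
proof -
  have tr: "transpose (act M U) = act M U" using act_symmat[OF M UV(1) inv(1)] by (simp add: symmat_def)
  have t: "transpose (matrix_inv (den M U)) ** transpose (den M U) = mat 1"
    by (simp add: matrix_inv_mult[OF inv(1)] flip: matrix_transpose_mul)
  have "transpose (matrix_inv (den M U)) ** (V - U) ** matrix_inv (den M V) =
    (transpose (matrix_inv (den M U)) ** transpose (den M U)) ** (act M V - act M U) ** (den M V ** matrix_inv (den M V))"
    unfolding act_difference[OF assms, symmetric] tr by (simp only: matrix_mul_assoc)
  then show ?thesis by (simp add: t matrix_inv_mult[OF inv(2)])
qed

lemma act_inj:
  assumes M: "M \<in> carrier Sp6" and UV: "U \<in> symmat" "V \<in> symmat"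
    and inv: "invertible (den M U)" "invertible (den M V)" and eq: "act M U = act M V"
  shows "U = V"
proof -
  have "transpose (act M U) = act M V" using act_symmat[OF M UV(1) inv(1)] eq by (simp add: symmat_def)
  then show ?thesis using act_difference[OF M UV inv] by (simp add: matrix_ring_simps)
qed

section \<open>Entrywise derivatives, continuity and the adjugate\<close>

definition matrix_unit :: "3 \<Rightarrow> 3 \<Rightarrow> cmat" where
  "matrix_unit i j = (\<chi> a b. if a = i \<and> b = j then 1 else 0)"

lemma cmat_expansion: "X = (\<Sum>i\<in>UNIV. \<Sum>j\<in>UNIV. cscale (X $ i $ j) (matrix_unit i j))"
proof -
  have "(1 :: 3) \<noteq> 2" "(1 :: 3) \<noteq> 3" "(2 :: 3) \<noteq> 3" by simp_all
  then show ?thesis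
    by (simp add: cmat_eq_iff sum_3 matrix_unit_def)
qed

lemma has_derivative_cmatI:
  fixes f :: "'a::real_normed_vector \<Rightarrow> cmat"
  assumes "\<And>i j. ((\<lambda>V. f V $ i $ j) has_derivative (\<lambda>X. F X $ i $ j)) (at U within S)"
  shows "(f has_derivative F) (at U within S)"
proof -
  have "((\<lambda>V. \<Sum>i\<in>UNIV. \<Sum>j\<in>UNIV. cscale (f V $ i $ j) (matrix_unit i j)) has_derivative
      (\<lambda>X. \<Sum>i\<in>UNIV. \<Sum>j\<in>UNIV. cscale (F X $ i $ j) (matrix_unit i j))) (at U within S)"
    by (intro has_derivative_sum has_derivative_cscale_left assms)
  then show ?thesis by (simp flip: cmat_expansion)
qed

lemma continuous_on_cmatI:
  fixes f :: "'a::topological_space \<Rightarrow> cmat"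
  assumes "\<And>i j. continuous_on S (\<lambda>V. f V $ i $ j)"
  shows "continuous_on S f"
proof -
  have "continuous_on S (\<lambda>V. \<Sum>i\<in>UNIV. \<Sum>j\<in>UNIV. cscale (f V $ i $ j) (matrix_unit i j))"
    by (intro continuous_on_sum continuous_on_cscale_left assms)
  then show ?thesis by (simp flip: cmat_expansion)
qed

lemma bounded_bilinear_cmat_mult: "bounded_bilinear ((**) :: cmat \<Rightarrow> cmat \<Rightarrow> cmat)"
proof -
  have "bilinear ((**) :: cmat \<Rightarrow> cmat \<Rightarrow> cmat)"
    unfolding bilinear_def
    by (auto intro!: linearI simp: matrix_mult_add_left matrix_mult_add_right cmat_eq_iff cmat_mult_nth scaleR_add_right)
  then show ?thesis by (simp add: bilinear_conv_bounded_bilinear)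
qed

lemma bounded_linear_transpose: "bounded_linear (transpose :: cmat \<Rightarrow> cmat)"
  unfolding linear_conv_bounded_linear[symmetric]
  by (rule linearI) (simp_all add: cmat_eq_iff transpose_nth)

lemma bounded_linear_entry: "bounded_linear (\<lambda>X :: cmat. X $ i $ j)"
  by (intro bounded_linear_compose[OF bounded_linear_vec_nth bounded_linear_vec_nth])

lemmas cmat_continuous_intros =
  bounded_bilinear.continuous_on[OF bounded_bilinear_cmat_mult]
  bounded_linear.continuous_on[OF bounded_linear_transpose]
  bounded_linear.continuous_on[OF bounded_linear_entry]

lemma continuous_on_det_cmat: "continuous_on S f \<Longrightarrow> continuous_on S (\<lambda>x. det (f x :: cmat))"
  unfolding det_3 by (intro continuous_intros cmat_continuous_intros)

definition adjugate :: "cmat \<Rightarrow> cmat" where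
  "adjugate X = vector
    [vector [X$2$2 * X$3$3 - X$2$3 * X$3$2, X$1$3 * X$3$2 - X$1$2 * X$3$3, X$1$2 * X$2$3 - X$1$3 * X$2$2],
     vector [X$2$3 * X$3$1 - X$2$1 * X$3$3, X$1$1 * X$3$3 - X$1$3 * X$3$1, X$1$3 * X$2$1 - X$1$1 * X$2$3],
     vector [X$2$1 * X$3$2 - X$2$2 * X$3$1, X$1$2 * X$3$1 - X$1$1 * X$3$2, X$1$1 * X$2$2 - X$1$2 * X$2$1]]"

lemma adjugate_mult: "X ** adjugate X = cscale (det X) (mat 1)"
  by (simp add: cmat_eq_iff cmat_mult_nth adjugate_def vector_3 det_3 mat_def algebra_simps)

lemma cscale_mult_right: "A ** cscale c B = cscale c (A ** B)"
  and cscale_mult_left: "cscale c A ** B = cscale c (A ** B)"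
  by (simp_all add: cmat_eq_iff cmat_mult_nth algebra_simps)

lemma cscale_cscale: "cscale c (cscale d X) = cscale (c * d) X"
  by (simp add: vec_eq_iff algebra_simps)

lemma matrix_inv_adjugate: "det X \<noteq> 0 \<Longrightarrow> matrix_inv X = cscale (1 / det X) (adjugate X)"
  by (rule matrix_inv_eqI) (simp add: cscale_mult_right adjugate_mult cscale_cscale)

lemma continuous_on_matrix_inv:
  assumes f: "continuous_on S f" and "\<And>x. x \<in> S \<Longrightarrow> det (f x :: cmat) \<noteq> 0"
  shows "continuous_on S (\<lambda>x. matrix_inv (f x))"
proof -
  have "continuous_on S (\<lambda>x. adjugate (f x))"
  proof (rule continuous_on_cmatI)
    fix i j :: 3
    show "continuous_on S (\<lambda>x. adjugate (f x) $ i $ j)"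
      using exhaust_3[of i] exhaust_3[of j]
      by (elim disjE; simp only: adjugate_def vector_3; intro continuous_intros cmat_continuous_intros f)
  qed
  then have "continuous_on S (\<lambda>x. cscale (1 / det (f x)) (adjugate (f x)))"
    by (intro continuous_on_cmatI)
       (auto simp del: mult_1 intro!: continuous_intros cmat_continuous_intros continuous_on_det_cmat f assms)
  then show ?thesis
    by (rule continuous_on_eq) (simp add: assms matrix_inv_adjugate)
qed

lemma continuous_on_den [continuous_intros]: "continuous_on S f \<Longrightarrow> continuous_on S (\<lambda>x. den M (f x))"
  and continuous_on_num [continuous_intros]: "continuous_on S f \<Longrightarrow> continuous_on S (\<lambda>x. num M (f x))"
  unfolding den_def num_def by (intro continuous_intros cmat_continuous_intros; assumption)+

lemma open_den: "open {U. det (den M U) \<noteq> 0}"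
  by (intro open_Collect_neq continuous_on_det_cmat continuous_intros)

lemma dom_sp_action_eq: "dom (sp_action M) = symmat \<inter> {U. det (den M U) \<noteq> 0}"
  by (simp add: set_eq_iff dom_sp_action invertible_det_nz)

lemma openin_dom_sp_action: "openin (top_of_set symmat) (dom (sp_action M))"
  unfolding dom_sp_action_eq by (rule openin_open_Int) (rule open_den)

section \<open>The domain of the action: nonempty, connected and dense\<close>

lemma matrix_vector_mult_3: "((A :: cmat) *v x) $ k = A $ k $ 1 * x $ 1 + A $ k $ 2 * x $ 2 + A $ k $ 3 * x $ 3"
  by (simp add: matrix_vector_mult_def sum_3)

text \<open>For nonzero \<open>w\<close> in the kernel of \<open>D^t\<close>, the vector
  \<open>u = C^t w\<close> lies in the kernel of \<open>D\<close> because \<open>C D^t\<close> is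
  symmetric, and it is nonzero because \<open>A D^t - B C^t = 1\<close>. Let \<open>Z\<close> be the
  diagonal unit at a coordinate \<open>i\<close> where \<open>u\<close> is nonzero. A kernel vector
  \<open>x\<close> of \<open>C Z + D\<close> pairs with \<open>w\<close> to
  \<open>u_i x_i = 0\<close>, so \<open>x\<close> lies in the kernel of \<open>D\<close>, while
  \<open>u\<close> itself is lost.\<close>

lemma Sp6_kernel_reduction:
  assumes M: "M \<in> carrier Sp6" and sing: "\<not> invertible (blockD M)"
  obtains Z where "Z \<in> symmat" "{x. den M Z *v x = 0} \<subset> {x. blockD M *v x = 0}"
proof -
  note R = Sp6_relations[OF M]
  have "\<not> (\<exists>B. B ** transpose (blockD M) = mat 1)"
    using sing invertible_left_inverse[of "transpose (blockD M)"] by (simp add: invertible_det_nz)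
  then obtain w where w: "transpose (blockD M) *v w = 0" "w \<noteq> 0"
    unfolding matrix_left_invertible_ker by blast
  define u where "u = transpose (blockC M) *v w"
  have Du: "blockD M *v u = 0"
    unfolding u_def matrix_vector_mul_assoc R(5)[symmetric] by (simp only: w flip: matrix_vector_mul_assoc) simp
  have "u \<noteq> 0"
  proof
    assume "u = 0"
    have "blockA M ** transpose (blockD M) - blockB M ** transpose (blockC M) = mat 1"
      using arg_cong[OF R(6), of transpose] by (simp add: matrix_ring_simps)
    then have "(blockA M ** transpose (blockD M) - blockB M ** transpose (blockC M)) *v w = w" by simp
    then have "blockA M *v (transpose (blockD M) *v w) - blockB M *v u = w"
      unfolding u_def by (simp only: matrix_vector_mult_diff_rdistrib matrix_vector_mul_assoc)
    then show False unfolding w \<open>u = 0\<close> using w(2) by simp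
  qed
  then obtain i where i: "u $ i \<noteq> 0" by (auto simp: vec_eq_iff)
  define Z where "Z = matrix_unit i i"
  have Zx: "Z *v x = x $ i *s axis i 1" for x
    using exhaust_3[of i]
    by (auto simp: vec_eq_iff forall_3 matrix_vector_mult_3 Z_def matrix_unit_def axis_def)
  define dot where "dot = (\<lambda>(x :: complex^3) (y :: complex^3). x $ 1 * y $ 1 + x $ 2 * y $ 2 + x $ 3 * y $ 3)"
  have dot: "dot x (A *v y) = dot (transpose A *v x) y" for A x y
    by (simp add: dot_def matrix_vector_mult_3 transpose_nth algebra_simps del: transpose_matrix_vector)
  have x0: "x $ i = 0" if x: "den M Z *v x = 0" for x
  proof -
    have "0 = dot w (den M Z *v x)" by (simp add: x dot_def)
    also have "\<dots> = dot w (blockC M *v (Z *v x)) + dot w (blockD M *v x)"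
      by (simp add: den_def dot_def matrix_vector_mult_add_rdistrib matrix_vector_mul_assoc algebra_simps)
    also have "\<dots> = dot u (Z *v x)"
      unfolding dot w u_def by (simp add: dot_def)
    also have "\<dots> = u $ i * x $ i"
      using exhaust_3[of i] by (auto simp: Zx dot_def axis_def)
    finally show ?thesis using i by simp
  qed
  show thesis
  proof (rule that)
    show "Z \<in> symmat" by (auto simp: Z_def matrix_unit_def symmat_def transpose_def vec_eq_iff)
    have "blockD M *v x = 0" if "den M Z *v x = 0" for x
      using that x0[OF that] by (simp add: den_def matrix_vector_mult_add_rdistrib Zx flip: matrix_vector_mul_assoc)
    then show "{x. den M Z *v x = 0} \<subset> {x. blockD M *v x = 0}"
      using x0[of u] i Du by blast
  qed
qed

text \<open>The symplectic matrix of the translation \<open>U |-> U + Z\<close>; it moves a chosen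
  base point to the origin and back.\<close>

definition sp_translation :: "cmat \<Rightarrow> cmat6" where
  "sp_translation Z = block_matrix (mat 1) Z 0 (mat 1)"

lemma sp_translation_carrier: "Z \<in> symmat \<Longrightarrow> sp_translation Z \<in> carrier Sp6"
  by (simp add: sp_translation_def Sp6_def symmat_def matrix_ring_simps)

lemma den_sp_translation: "den (M ** sp_translation Z) U = den M (U + Z)"
  by (simp add: den_def blocks_mult sp_translation_def matrix_ring_simps add.assoc)

lemma vec_subspace_kernel: "vec.subspace {x. (A :: cmat) *v x = 0}"
  by (simp add: vec.subspace_def matrix_vector_right_distrib vector_scalar_commute)

text \<open>A symmetric \<open>Z\<close> for which the kernel of \<open>den M Z\<close> has least
  dimension has an invertible denominator: otherwise translating \<open>Z\<close> to the origin and
  reducing the kernel there would lower the dimension further.\<close>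

lemma dom_sp_action_nonempty:
  assumes M: "M \<in> carrier Sp6"
  obtains U where "U \<in> dom (sp_action M)"
proof -
  define m where "m = (\<lambda>Z. vec.dim {x. den M Z *v x = 0})"
  obtain Z where Z: "Z \<in> symmat" "\<And>Y. Y \<in> symmat \<Longrightarrow> m Z \<le> m Y"
    using ex_has_least_nat[of "\<lambda>Z. Z \<in> symmat" 0 m] symmat_0 by blast
  have "invertible (den M Z)"
  proof (rule ccontr)
    assume "\<not> invertible (den M Z)"
    then have "\<not> invertible (blockD (M ** sp_translation Z))"
      by (simp add: den_def blocks_mult sp_translation_def)
    then obtain Y where Y: "Y \<in> symmat" "{x. den (M ** sp_translation Z) Y *v x = 0} \<subset> {x. blockD (M ** sp_translation Z) *v x = 0}"
      using Sp6_kernel_reduction Sp6_mult[OF M sp_translation_carrier[OF Z(1)]] by blast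
    then have "{x. den M (Y + Z) *v x = 0} \<subset> {x. den M Z *v x = 0}"
      by (simp add: den_sp_translation) (simp add: den_def blocks_mult sp_translation_def)
    then have "m (Y + Z) < m Z"
      unfolding m_def by (intro vec.dim_psubset) (simp add: vec.span_eq_iff[THEN iffD2] vec_subspace_kernel)
    then show False using Z(2)[OF symmat_add[OF Y(1) Z(1)]] by simp
  qed
  then show thesis using that Z(1) by (auto simp: dom_sp_action)
qed

lemma det_line_poly: "\<exists>p. \<forall>z. det (A + cscale z B) = poly p z"
proof -
  define l where "l = (\<lambda>i j. [: A $ i $ j, B $ i $ j :])"
  have "det (A + cscale z B) = poly (l 1 1 * l 2 2 * l 3 3 + l 1 2 * l 2 3 * l 3 1 + l 1 3 * l 2 1 * l 3 2
      - l 1 1 * l 2 3 * l 3 2 - l 1 2 * l 2 1 * l 3 3 - l 1 3 * l 2 2 * l 3 1) z" for z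
    by (simp add: det_3 l_def algebra_simps)
  then show ?thesis by blast
qed

lemma den_line: "den M (U + cscale z X) = den M U + cscale z (blockC M ** X)"
  by (simp add: den_def matrix_mult_add_right cscale_mult_right)

text \<open>Along a complex line through a regular point the determinant of the denominator is a
  polynomial in one variable with nonzero constant term.\<close>

lemma finite_singular_line:
  assumes "U \<in> dom (sp_action M)"
  shows "finite {z. det (den M (U + cscale z X)) = 0}"
proof -
  obtain p where p: "\<And>z. det (den M (U + cscale z X)) = poly p z"
    unfolding den_line using det_line_poly by blast
  have "poly p 0 \<noteq> 0" using assms p[of 0] by (simp add: dom_sp_action invertible_det_nz)
  then have "p \<noteq> 0" by auto
  then show ?thesis unfolding p by (rule poly_roots_finite)
qed

text \<open>Two points of the domain are joined by the complex line through them, from which only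
  finitely many singular parameters have to be removed.\<close>

lemma connected_dom_sp_action: "connected (dom (sp_action M))"
  unfolding connected_iff_connected_component
proof (intro ballI)
  fix U V assume U: "U \<in> dom (sp_action M)" and V: "V \<in> dom (sp_action M)"
  define T where "T = {z. det (den M (U + cscale z (V - U))) = 0}"
  have "connected (UNIV - T)"
    by (rule connected_open_delete_finite) (auto simp: T_def finite_singular_line[OF U])
  moreover have "continuous_on (UNIV - T) (\<lambda>z. U + cscale z (V - U))"
    by (intro continuous_intros)
  ultimately have "connected ((\<lambda>z. U + cscale z (V - U)) ` (UNIV - T))"
    by (rule connected_continuous_image[rotated])
  moreover have "(\<lambda>z. U + cscale z (V - U)) ` (UNIV - T) \<subseteq> dom (sp_action M)"
    using U V by (auto simp: T_def dom_sp_action_eq intro!: symmat_add symmat_cscale symmat_diff)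
  moreover have "U + cscale 0 (V - U) = U" "U + cscale 1 (V - U) = V" by simp_all
  moreover have "0 \<notin> T" "1 \<notin> T"
    using U V by (auto simp: T_def dom_sp_action_eq)
  ultimately show "connected_component (dom (sp_action M)) U V"
    unfolding connected_component_def
    by (intro exI[of _ "(\<lambda>z. U + cscale z (V - U)) ` (UNIV - T)"] conjI)
       (auto intro: image_eqI[of _ _ 0] image_eqI[of _ _ 1])
qed

text \<open>On the complex line from a regular point to \<open>W\<close>, the parameters that land
  in \<open>V\<close> form a nonempty open, hence infinite set, and only finitely many of them are
  singular.\<close>

lemma dom_sp_action_dense:
  assumes M: "M \<in> carrier Sp6" and V: "openin (top_of_set symmat) V" "W \<in> V"
  shows "\<exists>U. U \<in> V \<and> U \<in> dom (sp_action M)"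
proof -
  obtain T where T: "open T" "V = symmat \<inter> T" using V(1) by (auto simp: openin_open)
  obtain U where U: "U \<in> dom (sp_action M)" using dom_sp_action_nonempty[OF M] .
  then have sym: "U \<in> symmat" "W \<in> symmat" using T V by (auto simp: dom_sp_action)
  define \<gamma> where "\<gamma> = (\<lambda>z. U + cscale z (W - U))"
  have "open (\<gamma> -` T)" unfolding \<gamma>_def using T(1) by (intro open_vimage continuous_intros)
  moreover have "1 \<in> \<gamma> -` T" using V T by (simp add: \<gamma>_def)
  ultimately have "infinite (\<gamma> -` T)"
    using finite_imp_not_open by fastforce
  then have "\<not> \<gamma> -` T \<subseteq> {z. det (den M (U + cscale z (W - U))) = 0}"
    using finite_singular_line[OF U] finite_subset by blast
  then obtain z where z: "\<gamma> z \<in> T" "det (den M (\<gamma> z)) \<noteq> 0" by (auto simp: \<gamma>_def)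
  have "\<gamma> z \<in> symmat" unfolding \<gamma>_def by (intro symmat_add symmat_cscale symmat_diff sym)
  then show ?thesis using z T by (auto simp: dom_sp_action_eq)
qed

text \<open>The factor \<open>V - U\<close> vanishes at the base point, so mere continuity of
  \<open>Q\<close> suffices. Applied to the exact difference formula for the action, this avoids
  differentiating a matrix inverse.\<close>

lemma has_derivative_mult_continuous:
  fixes A :: cmat and Q :: "cmat \<Rightarrow> cmat"
  assumes "continuous (at U within S) Q"
  shows "((\<lambda>V. A ** (V - U) ** Q V) has_derivative (\<lambda>X. A ** X ** Q U)) (at U within S)"
proof -
  interpret mult: bounded_bilinear "(**) :: cmat \<Rightarrow> cmat \<Rightarrow> cmat" by (rule bounded_bilinear_cmat_mult)
  obtain K where K: "K \<ge> 0" "\<And>(X :: cmat) (Y :: cmat). norm (X ** Y) \<le> norm X * norm Y * K"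
    using mult.nonneg_bounded by blast
  show ?thesis
    unfolding has_derivative_iff_norm
  proof
    show "bounded_linear (\<lambda>X. A ** X ** Q U)"
      by (rule bounded_linear_compose[OF mult.bounded_linear_left mult.bounded_linear_right])
    have "((\<lambda>V. norm A * K * K * norm (Q V - Q U)) \<longlongrightarrow> norm A * K * K * norm (Q U - Q U)) (at U within S)"
      using assms unfolding continuous_within by (intro tendsto_intros)
    then have lim: "((\<lambda>V. norm A * K * K * norm (Q V - Q U)) \<longlongrightarrow> 0) (at U within S)" by simp
    show "((\<lambda>V. norm (A ** (V - U) ** Q V - A ** (U - U) ** Q U - A ** (V - U) ** Q U) / norm (V - U)) \<longlongrightarrow> 0)
      (at U within S)"
    proof (rule Lim_null_comparison[OF _ lim], intro always_eventually allI)
      fix V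
      have "norm (A ** (V - U) ** Q V - A ** (U - U) ** Q U - A ** (V - U) ** Q U) = norm (A ** (V - U) ** (Q V - Q U))"
        by (simp add: matrix_mult_0_left matrix_mult_0_right matrix_mult_diff_right[of "A ** (V - U)"])
      also have "\<dots> \<le> norm (A ** (V - U)) * norm (Q V - Q U) * K"
        using K(2)[of "A ** (V - U)" "Q V - Q U"] by simp
      also have "\<dots> \<le> (norm A * norm (V - U) * K) * norm (Q V - Q U) * K"
        by (intro mult_right_mono K norm_ge_zero)
      finally show "norm (norm (A ** (V - U) ** Q V - A ** (U - U) ** Q U - A ** (V - U) ** Q U) / norm (V - U))
          \<le> norm A * K * K * norm (Q V - Q U)"
        using K(1) by (cases "V = U") (simp_all add: divide_le_eq mult_ac)
    qed
  qed
qed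

lemma sp_action_has_derivative:
  assumes M: "M \<in> carrier Sp6" and U: "U \<in> dom (sp_action M)"
  shows "((\<lambda>V. the (sp_action M V)) has_derivative
    (\<lambda>X. transpose (matrix_inv (den M U)) ** X ** matrix_inv (den M U))) (at U within symmat)"
proof -
  have U': "U \<in> symmat" "invertible (den M U)" using U by (simp_all only: dom_sp_action)
  have open_den': "open {V. det (den M V) \<noteq> 0}" "U \<in> {V. det (den M V) \<noteq> 0}"
    using open_den U' by (simp_all add: invertible_det_nz)
  have "continuous_on {V. det (den M V) \<noteq> 0} (\<lambda>V. matrix_inv (den M V))"
    by (rule continuous_on_matrix_inv) (auto intro!: continuous_intros)
  then have "isCont (\<lambda>V. matrix_inv (den M V)) U"
    using open_den' continuous_on_eq_continuous_at by blast
  then have "((\<lambda>V. transpose (matrix_inv (den M U)) ** (V - U) ** matrix_inv (den M V)) has_derivative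
      (\<lambda>X. transpose (matrix_inv (den M U)) ** X ** matrix_inv (den M U))) (at U within symmat)"
    by (rule has_derivative_mult_continuous[OF continuous_at_imp_continuous_within])
  from has_derivative_add[OF has_derivative_const[of "act M U"] this]
  have "((\<lambda>V. act M U + transpose (matrix_inv (den M U)) ** (V - U) ** matrix_inv (den M V)) has_derivative
      (\<lambda>X. transpose (matrix_inv (den M U)) ** X ** matrix_inv (den M U))) (at U within symmat)"
    by simp
  moreover have "\<forall>\<^sub>F V in at U within symmat.
      act M U + transpose (matrix_inv (den M U)) ** (V - U) ** matrix_inv (den M V) = the (sp_action M V)"
  proof -
    have "\<forall>\<^sub>F V in at U within symmat. V \<in> {V. det (den M V) \<noteq> 0}"
      using open_den' unfolding eventually_at_topological by blast
    moreover have "\<forall>\<^sub>F V in at U within symmat. V \<in> symmat"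
      by (simp add: eventually_at_filter)
    ultimately show ?thesis
    proof eventually_elim
      case (elim V)
      then have V: "V \<in> symmat" "invertible (den M V)" "V \<in> dom (sp_action M)"
        by (auto simp: invertible_det_nz dom_sp_action)
      then show ?case
        unfolding the_sp_action[OF V(3)] act_diff[OF M U'(1) V(1) U'(2) V(2), symmetric] by simp
    qed
  qed
  ultimately show ?thesis
    by (rule has_derivative_transform_eventually)
       (use U U' in \<open>simp_all add: the_sp_action matrix_ring_simps\<close>)
qed

theorem sp_action_conformal:
  assumes M: "M \<in> carrier Sp6"
  shows "conformal_transformation (sp_action M)"
  unfolding conformal_transformation_def
proof (intro conjI ballI)
  obtain U0 where "U0 \<in> dom (sp_action M)" using dom_sp_action_nonempty[OF M] .
  then show "dom (sp_action M) \<noteq> {}" by (metis empty_iff)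
  show "ran (sp_action M) \<subseteq> symmat"
    by (auto simp: ran_def sp_action_eq act_symmat[OF M] split: if_splits)
  show "inj_on (sp_action M) (dom (sp_action M))"
    by (rule inj_onI) (auto simp: sp_action_eq split: if_splits intro: act_inj[OF M])
  fix U assume U: "U \<in> dom (sp_action M)"
  \<comment> \<open>The derivative is \<open>X |-> Q^t X Q\<close>, so the conformal factor is
    \<open>det Q ^ 2\<close>, the inverse square of the determinant of the denominator.\<close>
  define Q where "Q = matrix_inv (den M U)"
  have "den M U ** Q = mat 1" using U by (simp add: Q_def dom_sp_action matrix_inv_mult)
  then have "det Q \<noteq> 0" using det_mul[of "den M U" Q] by auto
  then show "\<exists>F. ((\<lambda>V. the (sp_action M V)) has_derivative F) (at U within symmat) \<and>
      (\<forall>c. \<forall>X\<in>symmat. F (cscale c X) = cscale c (F X)) \<and>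
      (\<exists>k. k \<noteq> 0 \<and> (\<forall>X\<in>symmat. det_form (F X) = k * det_form X))"
    using sp_action_has_derivative[OF M U]
    by (intro exI[of _ "\<lambda>X. transpose Q ** X ** Q"] conjI exI[of _ "det Q ^ 2"])
       (auto simp: Q_def[symmetric] det_form_def det_mul cscale_mult_left cscale_mult_right power2_eq_square)
qed (rule openin_dom_sp_action connected_dom_sp_action)+

section \<open>Second derivatives of holomorphic maps\<close>

text \<open>The homogeneity clause turns the real linear derivative into a complex linear one, so on
  an open set this is holomorphy in nine complex variables.\<close>

definition hol_derivative_on :: "(cmat \<Rightarrow> complex) \<Rightarrow> (cmat \<Rightarrow> cmat \<Rightarrow> complex) \<Rightarrow> cmat set \<Rightarrow> bool" where
  "hol_derivative_on f F S \<longleftrightarrow>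
     (\<forall>U\<in>S. (f has_derivative F U) (at U) \<and> (\<forall>c X. F U (cscale c X) = c * F U X))"

lemma hol_derivative_onD:
  assumes "hol_derivative_on f F S" "U \<in> S"
  shows "(f has_derivative F U) (at U)" "F U (cscale c X) = c * F U X"
  using assms by (auto simp: hol_derivative_on_def)

lemma hol_derivative_on_continuous:
  assumes "hol_derivative_on f F S"
  shows "continuous_on S f"
  by (meson assms continuous_at_imp_continuous_on has_derivative_continuous hol_derivative_onD(1))

text \<open>On the line \<open>z |-> U + z X\<close> this is Cauchy's formula for the first
  derivative at 0, integrating \<open>\<phi> z / z^2\<close> over a circle of radius
  \<open>\<rho>\<close>. The parametrisation contributes \<open>2 pi i z\<close>, which leaves one
  factor \<open>z\<close> in the denominator.\<close>

lemma Cauchy_formula_derivative: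
  assumes f: "hol_derivative_on f F S" and S: "\<And>z. norm z \<le> \<rho> \<Longrightarrow> U + cscale z X \<in> S" and "0 < \<rho>"
  shows "((\<lambda>t. f (U + cscale (\<rho> * exp (2 * pi * \<i> * of_real t)) X) / (\<rho> * exp (2 * pi * \<i> * of_real t)))
    has_integral F U X) {0..1}"
proof -
  define \<phi> where "\<phi> = (\<lambda>z. f (U + cscale z X))"
  have der: "(\<phi> has_field_derivative F (U + cscale z X) X) (at z)" if "norm z \<le> \<rho>" for z
  proof -
    have 1: "((\<lambda>z. U + cscale z X) has_derivative (\<lambda>h. cscale h X)) (at z)"
      by (auto intro!: derivative_eq_intros)
    have 2: "(f has_derivative F (U + cscale z X)) (at (U + cscale z X))"
      using hol_derivative_onD[OF f S[OF that]] by blast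
    have "(\<phi> has_derivative (\<lambda>h. F (U + cscale z X) (cscale h X))) (at z)"
      unfolding \<phi>_def using has_derivative_compose[OF 1 2] .
    moreover have "(\<lambda>h. F (U + cscale z X) (cscale h X)) = (*) (F (U + cscale z X) X)"
      using hol_derivative_onD[OF f S[OF that]] by (auto simp: mult.commute)
    ultimately show ?thesis by (simp add: has_field_derivative_def)
  qed
  have cont: "continuous_on (cball 0 \<rho>) \<phi>"
    by (metis continuous_at_imp_continuous_on der DERIV_isCont mem_cball_0)
  have hol: "\<phi> holomorphic_on ball 0 \<rho>"
    unfolding holomorphic_on_def field_differentiable_def
    by (metis der has_field_derivative_at_within less_imp_le mem_ball_0)
  have "deriv \<phi> 0 = F U X"
    using der[of 0] \<open>0 < \<rho>\<close> by (simp add: DERIV_imp_deriv)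
  then have "((\<lambda>u. \<phi> u / u ^ 2) has_contour_integral 2 * pi * \<i> * F U X) (circlepath 0 \<rho>)"
    using Cauchy_has_contour_integral_higher_derivative_circlepath[OF cont hol, of 0 1] \<open>0 < \<rho>\<close>
    by (simp add: power2_eq_square)
  then have "((\<lambda>t. \<phi> (circlepath 0 \<rho> t) / (circlepath 0 \<rho> t) ^ 2 *
      (2 * pi * \<i> * \<rho> * exp (2 * pi * \<i> * of_real t))) has_integral 2 * pi * \<i> * F U X) {0..1}"
    unfolding has_contour_integral_def
    by (rule has_integral_eq[rotated]) (simp add: vector_derivative_circlepath01)
  from has_integral_mult_right[OF this, of "1 / (2 * pi * \<i>)"]
  have "((\<lambda>t. 1 / (2 * pi * \<i>) * (\<phi> (circlepath 0 \<rho> t) / (circlepath 0 \<rho> t) ^ 2 *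
      (2 * pi * \<i> * \<rho> * exp (2 * pi * \<i> * of_real t)))) has_integral F U X) {0..1}"
    by simp
  moreover have alg: "1 / a * (x / b ^ 2 * (a * b)) = x / b" if "a \<noteq> 0" "b \<noteq> 0" for a b x :: complex
    using that by (simp add: power2_eq_square)
  have "1 / (2 * pi * \<i>) * (\<phi> (circlepath 0 \<rho> t) / (circlepath 0 \<rho> t) ^ 2 *
      (2 * pi * \<i> * \<rho> * exp (2 * pi * \<i> * of_real t))) =
      f (U + cscale (\<rho> * exp (2 * pi * \<i> * of_real t)) X) / (\<rho> * exp (2 * pi * \<i> * of_real t))" for t
  proof -
    have 1: "circlepath 0 \<rho> t = \<rho> * exp (2 * pi * \<i> * of_real t)"
      by (simp add: circlepath)
    have 2: "2 * pi * \<i> * \<rho> * exp (2 * pi * \<i> * of_real t) = (2 * pi * \<i>) * (\<rho> * exp (2 * pi * \<i> * of_real t))"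
      by (simp only: mult.assoc)
    show ?thesis
      unfolding 1 2 \<phi>_def by (rule alg) (use \<open>0 < \<rho>\<close> in auto)
  qed
  ultimately show ?thesis by (simp only:)
qed

text \<open>One radius \<open>\<rho>\<close> serves all base points in a ball, so that the Cauchy
  integrals near \<open>U\<close> run over a fixed circle and can be differentiated under the
  integral sign.\<close>

lemma open_cscale_neighbourhood:
  assumes "open S" "U \<in> S"
  obtains r \<rho> where "0 < r" "0 < \<rho>" "\<And>V z. V \<in> ball U r \<Longrightarrow> norm (z::complex) \<le> \<rho> \<Longrightarrow> V + cscale z X \<in> S"
proof -
  obtain e where e: "0 < e" "ball U e \<subseteq> S"
    using assms open_contains_ball by blast
  show thesis
  proof
    \<comment> \<open>The summand 1 keeps the quotient meaningful for \<open>X = 0\<close>.\<close>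
    show "0 < e / 2" "0 < e / 2 / (norm X + 1)"
      using e by (auto simp: add_nonneg_pos)
    fix V and z :: complex assume V: "V \<in> ball U (e / 2)" and z: "norm z \<le> e / 2 / (norm X + 1)"
    have "norm (cscale z X) \<le> norm z * (norm X + 1)"
      by (simp add: norm_cscale mult_left_mono)
    also have "\<dots> \<le> e / 2"
      using z pos_le_divide_eq[of "norm X + 1" "norm z" "e / 2"] by (simp add: add_nonneg_pos)
    finally have "dist U (V + cscale z X) < e"
      using V norm_triangle_ineq[of "V - U" "cscale z X"]
      by (simp add: dist_norm norm_minus_commute algebra_simps)
    then show "V + cscale z X \<in> S"
      using e by auto
  qed
qed

text \<open>The Cauchy integral represents \<open>F V X\<close> by values of \<open>f\<close> alone.
  Differentiating under the integral sign along \<open>Y\<close> replaces \<open>f\<close> by its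
  derivative along \<open>Y\<close>, and the result is the Cauchy integral for the derivative of
  \<open>\<lambda>V. F V Y\<close> in direction \<open>X\<close>; hence the symmetry.\<close>

lemma hol_derivative_on_second:
  assumes f: "hol_derivative_on f F S" and S: "open S"
  obtains H where "\<And>X. hol_derivative_on (\<lambda>V. F V X) (\<lambda>U. H U X) S"
    "\<And>U X Y. U \<in> S \<Longrightarrow> H U X Y = H U Y X"
proof -
  define e where "e = (\<lambda>t. exp (2 * pi * \<i> * of_real t))"
  have e0: "e t \<noteq> 0" for t by (simp add: e_def)
  have conte: "continuous_on T e" for T unfolding e_def by (intro continuous_intros)
  have linF: "bounded_linear (F U)" if "U \<in> S" for U
    using hol_derivative_onD[OF f that] has_derivative_bounded_linear by blast
  have path: "continuous_on (T \<times> R) (\<lambda>(V, t). V + cscale (\<rho> * e t) X)" for T R X and \<rho> :: real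
    unfolding split_beta
    by (intro continuous_intros continuous_on_compose2[OF conte[of UNIV]]) auto
  \<comment> \<open>Continuity of the derivative is not given, but the Leibniz rule below requires
    it; it follows from the representation as an integral with continuous integrand.\<close>
  have contF: "continuous_on S (\<lambda>U. F U X)" for X
  proof -
    have "isCont (\<lambda>U. F U X) U" if U: "U \<in> S" for U
    proof -
      obtain r \<rho> where r: "0 < r" "0 < \<rho>"
        "\<And>V z. V \<in> ball U r \<Longrightarrow> norm (z::complex) \<le> \<rho> \<Longrightarrow> V + cscale z X \<in> S"
        using open_cscale_neighbourhood[OF S U] by blast
      have *: "F V X = integral (cbox 0 1) (\<lambda>t. f (V + cscale (\<rho> * e t) X) / (\<rho> * e t))" if "V \<in> ball U r" for V
        using Cauchy_formula_derivative[OF f, of \<rho> V X] r that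
        by (auto simp: e_def integral_unique)
      have "continuous_on (ball U r \<times> cbox 0 1) (\<lambda>(V, t). f (V + cscale (\<rho> * e t) X) / (\<rho> * e t))"
        unfolding split_beta
        by (intro continuous_intros continuous_on_compose2[OF hol_derivative_on_continuous[OF f]]
            continuous_on_compose2[OF conte[of UNIV]] path[unfolded split_beta])
           (use r e0 in \<open>auto simp: norm_mult e_def\<close>)
      then have "continuous_on (ball U r) (\<lambda>V. F V X)"
        by (rule continuous_on_eq[OF integral_continuous_on_param]) (use * in simp)
      then show ?thesis
        using r by (simp add: continuous_on_eq_continuous_at)
    qed
    then show ?thesis by (simp add: continuous_at_imp_continuous_on)
  qed
  have main: "\<exists>\<rho>>0. (\<forall>z. norm z \<le> \<rho> \<longrightarrow> U + cscale z X \<in> S) \<and>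
     ((\<lambda>V. F V X) has_derivative
       (\<lambda>Y. integral {0..1} (\<lambda>t. F (U + cscale (\<rho> * e t) X) Y / (\<rho> * e t)))) (at U)"
    if U: "U \<in> S" for U X
  proof -
    obtain r \<rho> where r: "0 < r" "0 < \<rho>"
      "\<And>V z. V \<in> ball U r \<Longrightarrow> norm (z::complex) \<le> \<rho> \<Longrightarrow> V + cscale z X \<in> S"
      using open_cscale_neighbourhood[OF S U] by blast
    have inS: "V + cscale (\<rho> * e t) X \<in> S" if "V \<in> ball U r" for V t
      using r that by (auto simp: norm_mult e_def)
    define fx where "fx = (\<lambda>V t. Blinfun (\<lambda>Y. F (V + cscale (\<rho> * e t) X) Y / (\<rho> * e t)))"
    have fx: "blinfun_apply (fx V t) = (\<lambda>Y. F (V + cscale (\<rho> * e t) X) Y / (\<rho> * e t))"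
      if "V \<in> ball U r" for V t
      unfolding fx_def
      by (rule bounded_linear_Blinfun_apply)
         (rule bounded_linear_compose[OF bounded_linear_divide linF[OF inS[OF that]]])
    have *: "F V X = integral (cbox 0 1) (\<lambda>t. f (V + cscale (\<rho> * e t) X) / (\<rho> * e t))" if "V \<in> ball U r" for V
      using Cauchy_formula_derivative[OF f, of \<rho> V X] r that
      by (auto simp: e_def integral_unique)
    have contfx: "continuous_on (ball U r \<times> cbox 0 1) (\<lambda>(V, t). fx V t)"
    proof (rule continuous_on_blinfun_componentwise)
      fix Y :: cmat assume "Y \<in> Basis"
      have "continuous_on (ball U r \<times> cbox 0 1)
        (\<lambda>(V, t). F (V + cscale (\<rho> * e t) X) Y / (\<rho> * e t))"
        unfolding split_beta
        by (intro continuous_intros continuous_on_compose2[OF contF]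
            continuous_on_compose2[OF conte[of UNIV]] path[unfolded split_beta])
           (use r e0 inS in auto)
      then show "continuous_on (ball U r \<times> cbox 0 1) (\<lambda>x. blinfun_apply (case x of (V, t) \<Rightarrow> fx V t) Y)"
        by (rule continuous_on_eq) (auto simp: fx)
    qed
    have "((\<lambda>V. integral (cbox 0 1) (\<lambda>t. f (V + cscale (\<rho> * e t) X) / (\<rho> * e t)))
        has_derivative blinfun_apply (integral (cbox 0 1) (fx U))) (at U within ball U r)"
    proof (rule leibniz_rule)
      fix V and t :: real assume V: "V \<in> ball U r"
      have "((\<lambda>V. f (V + cscale (\<rho> * e t) X)) has_derivative F (V + cscale (\<rho> * e t) X)) (at V)"
      proof -
        have "((\<lambda>V. V + cscale (\<rho> * e t) X) has_derivative (\<lambda>h. h)) (at V)"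
          by (auto intro!: derivative_eq_intros)
        from has_derivative_compose[OF this, of f "F (V + cscale (\<rho> * e t) X)"] show ?thesis
          using hol_derivative_onD(1)[OF f inS[OF V]] by simp
      qed
      from bounded_linear.has_derivative[OF bounded_linear_divide this, of "\<rho> * e t"]
      have "((\<lambda>V. f (V + cscale (\<rho> * e t) X) / (\<rho> * e t)) has_derivative blinfun_apply (fx V t)) (at V)"
        by (simp only: fx[OF V])
      then show "((\<lambda>V. f (V + cscale (\<rho> * e t) X) / (\<rho> * e t)) has_derivative blinfun_apply (fx V t)) (at V within ball U r)"
        by (rule has_derivative_at_withinI)
    next
      fix V assume V: "V \<in> ball U r"
      show "(\<lambda>t. f (V + cscale (\<rho> * e t) X) / (\<rho> * e t)) integrable_on cbox 0 1"
        using Cauchy_formula_derivative[OF f, of \<rho> V X] r V by (auto simp: e_def)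
    qed (use r contfx in auto)
    moreover have "fx U integrable_on cbox 0 1"
      by (rule integrable_continuous)
         (rule continuous_on_compose2[OF contfx, of _ "\<lambda>t. (U, t)", simplified],
          use r in \<open>auto intro!: continuous_intros\<close>)
    then have "blinfun_apply (integral (cbox 0 1) (fx U)) =
        (\<lambda>Y. integral {0..1} (\<lambda>t. F (U + cscale (\<rho> * e t) X) Y / (\<rho> * e t)))"
      using fx[of U] r by (auto simp: fun_eq_iff blinfun_apply_integral)
    ultimately have "((\<lambda>V. integral (cbox 0 1) (\<lambda>t. f (V + cscale (\<rho> * e t) X) / (\<rho> * e t)))
        has_derivative (\<lambda>Y. integral {0..1} (\<lambda>t. F (U + cscale (\<rho> * e t) X) Y / (\<rho> * e t)))) (at U)"
      using r by (simp add: at_within_open[of U "ball U r"])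
    then have "((\<lambda>V. F V X) has_derivative
       (\<lambda>Y. integral {0..1} (\<lambda>t. F (U + cscale (\<rho> * e t) X) Y / (\<rho> * e t)))) (at U)"
      by (rule has_derivative_transform_within_open[of _ _ _ _ "ball U r"]) (use r * in auto)
    moreover have "\<forall>z. norm z \<le> \<rho> \<longrightarrow> U + cscale z X \<in> S" using r by simp
    ultimately show ?thesis using r by blast
  qed
  \<comment> \<open>The radius in the integral depends on \<open>U\<close> and \<open>X\<close>, so
    \<open>H\<close> is defined as the derivative itself and the integral serves only as a formula
    for it.\<close>
  define H where "H = (\<lambda>U X. frechet_derivative (\<lambda>V. F V X) (at U))"
  have H: "hol_derivative_on (\<lambda>V. F V X) (\<lambda>U. H U X) S" for X
    unfolding hol_derivative_on_def
  proof (intro ballI conjI allI)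
    fix U assume U: "U \<in> S"
    obtain \<rho> where \<rho>: "\<rho> > 0" "\<And>z. norm z \<le> \<rho> \<Longrightarrow> U + cscale z X \<in> S"
      "((\<lambda>V. F V X) has_derivative
       (\<lambda>Y. integral {0..1} (\<lambda>t. F (U + cscale (\<rho> * e t) X) Y / (\<rho> * e t)))) (at U)"
      using main[OF U] by blast
    have Heq: "H U X = (\<lambda>Y. integral {0..1} (\<lambda>t. F (U + cscale (\<rho> * e t) X) Y / (\<rho> * e t)))"
      unfolding H_def using frechet_derivative_at[OF \<rho>(3)] by simp
    show "((\<lambda>V. F V X) has_derivative H U X) (at U)"
      using \<rho> Heq by simp
    fix c Y
    have "F (U + cscale (\<rho> * e t) X) (cscale c Y) = c * F (U + cscale (\<rho> * e t) X) Y" for t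
      using \<rho> by (intro hol_derivative_onD(2)[OF f]) (auto simp: norm_mult e_def)
    then have "H U X (cscale c Y) = integral {0..1} (\<lambda>t. c * (F (U + cscale (\<rho> * e t) X) Y / (\<rho> * e t)))"
      by (simp add: Heq)
    also have "\<dots> = c * H U X Y" by (simp add: Heq del: times_divide_eq_right)
    finally show "H U X (cscale c Y) = c * H U X Y" .
  qed
  show thesis
  proof (rule that[OF H])
    fix U X Y assume U: "U \<in> S"
    obtain \<rho> where \<rho>: "\<rho> > 0" "\<And>z. norm z \<le> \<rho> \<Longrightarrow> U + cscale z X \<in> S"
      "((\<lambda>V. F V X) has_derivative
       (\<lambda>Y. integral {0..1} (\<lambda>t. F (U + cscale (\<rho> * e t) X) Y / (\<rho> * e t)))) (at U)"
      using main[OF U] by blast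
    have "H U X = (\<lambda>Y. integral {0..1} (\<lambda>t. F (U + cscale (\<rho> * e t) X) Y / (\<rho> * e t)))"
      unfolding H_def using frechet_derivative_at[OF \<rho>(3)] by simp
    then have "H U X Y = integral {0..1} (\<lambda>t. F (U + cscale (\<rho> * e t) X) Y / (\<rho> * e t))"
      by simp
    also have "\<dots> = H U Y X"
      using Cauchy_formula_derivative[OF H, of \<rho> U X Y] \<rho> by (simp add: e_def integral_unique)
    finally show "H U X Y = H U Y X" .
  qed
qed

section \<open>Maps with symmetric values, and uniqueness for a linear differential system\<close>

lemma norm_transpose: "norm (transpose X :: cmat) = norm X"
proof -
  have "(norm (Y :: cmat))\<^sup>2 = (\<Sum>i\<in>UNIV. \<Sum>j\<in>UNIV. (cmod (Y $ i $ j))\<^sup>2)" for Y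
    by (simp add: norm_vec_def L2_set_def sum_nonneg)
  then have "(norm (transpose X))\<^sup>2 = (norm X)\<^sup>2"
    by (simp add: transpose_nth sum_3 add_ac)
  then show ?thesis by (simp add: power2_eq_iff_nonneg)
qed

lemma norm_symmetric_part: "norm (symmetric_part X) \<le> norm X"
  using norm_triangle_ineq[of X "transpose X"] by (simp add: symmetric_part_def norm_transpose)

lemma bounded_bilinear_cscale: "bounded_bilinear cscale"
proof -
  have "bilinear cscale"
    unfolding bilinear_def by (auto intro!: linearI simp: cscale_add_left cscale_add_right cscale_scaleR vec_eq_iff)
  then show ?thesis by (simp add: bilinear_conv_bounded_bilinear)
qed

lemma has_derivative_symmat:
  assumes f: "(f has_derivative F) (at U)" and S: "open S" "U \<in> S" and sym: "\<And>V. V \<in> S \<Longrightarrow> f V \<in> symmat"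
  shows "F X \<in> symmat"
proof -
  have "((\<lambda>V. transpose (f V)) has_derivative (\<lambda>X. transpose (F X))) (at U)"
    by (rule bounded_linear.has_derivative[OF bounded_linear_transpose f])
  then have "(f has_derivative (\<lambda>X. transpose (F X))) (at U)"
    by (rule has_derivative_transform_within_open[OF _ S]) (use sym in \<open>simp add: symmat_def\<close>)
  then have "F = (\<lambda>X. transpose (F X))" using f has_derivative_unique by blast
  then have "transpose (F X) = F X" by (rule fun_cong[symmetric])
  then show ?thesis by (simp add: symmat_def)
qed

lemma has_derivative_det_symmat:
  assumes f: "(f has_derivative F) (at U)" and S: "open S" "U \<in> S" and sym: "\<And>V. V \<in> S \<Longrightarrow> f V \<in> symmat"
  shows "((\<lambda>V. det (f V)) has_derivative (\<lambda>X. ddet (f U) (F X))) (at U)"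
proof -
  have e: "((\<lambda>V. f V $ i $ j) has_derivative (\<lambda>X. F X $ i $ j)) (at U)" for i j
    by (rule bounded_linear.has_derivative[OF bounded_linear_entry f])
  have "((\<lambda>V. f V$1$1 * f V$2$2 * f V$3$3 + 2 * f V$1$2 * f V$1$3 * f V$2$3
           - f V$1$1 * (f V$2$3)^2 - f V$2$2 * (f V$1$3)^2 - f V$3$3 * (f V$1$2)^2)
        has_derivative (\<lambda>X. ddet (f U) (F X))) (at U)"
    by (rule has_derivative_eq_rhs, (rule derivative_intros e)+)
       (simp add: fun_eq_iff ddet_def power2_eq_square algebra_simps)
  then show ?thesis
    by (rule has_derivative_transform_within_open[OF _ S])
       (simp add: det_form_symmat[OF sym, unfolded det_form_def])
qed

lemma hol_second_derivative_cmat: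
  fixes g :: "cmat \<Rightarrow> cmat"
  assumes S: "open S" and g: "\<And>U. U \<in> S \<Longrightarrow> (g has_derivative G U) (at U)"
    and lin: "\<And>U c X. U \<in> S \<Longrightarrow> G U (cscale c X) = cscale c (G U X)"
  obtains H where "\<And>U X. U \<in> S \<Longrightarrow> ((\<lambda>V. G V X) has_derivative H U X) (at U)"
    "\<And>U c X Y. U \<in> S \<Longrightarrow> H U X (cscale c Y) = cscale c (H U X Y)"
    "\<And>U X Y. U \<in> S \<Longrightarrow> H U X Y = H U Y X"
proof -
  have "\<exists>H. (\<forall>X. hol_derivative_on (\<lambda>V. G V X $ i $ j) (\<lambda>U. H U X) S) \<and> (\<forall>U\<in>S. \<forall>X Y. H U X Y = H U Y X)" for i j
  proof -
    have "hol_derivative_on (\<lambda>V. g V $ i $ j) (\<lambda>U X. G U X $ i $ j) S"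
      unfolding hol_derivative_on_def
      using bounded_linear.has_derivative[OF bounded_linear_entry g] by (simp add: lin)
    from hol_derivative_on_second[OF this S] show ?thesis by metis
  qed
  then obtain h where h: "\<And>i j X. hol_derivative_on (\<lambda>V. G V X $ i $ j) (\<lambda>U. h i j U X) S"
    "\<And>i j U X Y. U \<in> S \<Longrightarrow> h i j U X Y = h i j U Y X"
    by metis
  define H :: "cmat \<Rightarrow> cmat \<Rightarrow> cmat \<Rightarrow> cmat" where "H = (\<lambda>U X Y. \<chi> i j. h i j U X Y)"
  show thesis
  proof
    fix U X c Y assume U: "U \<in> S"
    show "((\<lambda>V. G V X) has_derivative H U X) (at U)"
      by (rule has_derivative_cmatI) (use hol_derivative_onD(1)[OF h(1) U] in \<open>simp add: H_def\<close>)
    show "H U X (cscale c Y) = cscale c (H U X Y)"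
      using hol_derivative_onD(2)[OF h(1) U] by (simp add: H_def vec_eq_iff)
    show "H U X Y = H U Y X" using h(2)[OF U] by (simp add: H_def)
  qed
qed

text \<open>The equation bounds the derivative of \<open>R\<close> by a multiple of
  \<open>R\<close>. On a small ball the mean value inequality then bounds the maximum of
  \<open>norm (R V)\<close> by half of itself, since \<open>R\<close> vanishes at the
  centre.\<close>

lemma linear_system_vanishing:
  fixes R T :: "cmat \<Rightarrow> cmat"
  assumes S: "open S" "U \<in> S" and R: "\<And>V. V \<in> S \<Longrightarrow> (R has_derivative (\<lambda>Z. R V ** symmetric_part Z ** T V)) (at V)"
    and T: "continuous_on S T" and 0: "R U = 0"
  obtains r where "0 < r" "\<And>V. V \<in> ball U r \<Longrightarrow> R V = 0"
proof -
  interpret mult: bounded_bilinear "(**) :: cmat \<Rightarrow> cmat \<Rightarrow> cmat" by (rule bounded_bilinear_cmat_mult)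
  obtain K where K: "K \<ge> 0" "\<And>(X :: cmat) (Y :: cmat). norm (X ** Y) \<le> norm X * norm Y * K"
    using mult.nonneg_bounded by blast
  obtain s where s: "s > 0" "cball U s \<subseteq> S" using S open_contains_cball by blast
  have "compact (T ` cball U s)"
    using T s by (intro compact_continuous_image compact_cball) (rule continuous_on_subset)
  then obtain B where B: "B > 0" "\<And>V. V \<in> cball U s \<Longrightarrow> norm (T V) \<le> B"
    by (metis bounded_pos compact_imp_bounded imageI)
  \<comment> \<open>Two matrix products cost a factor \<open>K\<close> each and \<open>B\<close>
    bounds \<open>T\<close>, so \<open>q\<close> times \<open>norm (R V)\<close> bounds the
    derivative at \<open>V\<close>. The radius \<open>r\<close> is then taken so small that
    \<open>q * r\<close> is at most one half.\<close>
  define q where "q = K * K * B"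
  have q: "q \<ge> 0" using K B by (simp add: q_def)
  define r where "r = min s (1 / (2 * (q + 1)))"
  have r: "r > 0" "r \<le> s" "q * r \<le> 1 / 2"
  proof -
    show "r > 0" "r \<le> s" using s q by (simp_all add: r_def)
    have "q * r \<le> q * (1 / (2 * (q + 1)))" using q by (intro mult_left_mono) (simp_all add: r_def)
    also have "\<dots> \<le> 1 / 2" using q by (simp add: divide_simps)
    finally show "q * r \<le> 1 / 2" .
  qed
  have inS: "V \<in> S" "V \<in> cball U s" if "V \<in> cball U r" for V
    using that s r by auto
  have "continuous_on (cball U r) (\<lambda>V. norm (R V))"
    by (intro continuous_on_norm continuous_at_imp_continuous_on ballI has_derivative_continuous) (use R inS in blast)
  then obtain W where W: "W \<in> cball U r" "\<And>V. V \<in> cball U r \<Longrightarrow> norm (R V) \<le> norm (R W)"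
    using continuous_attains_sup[OF compact_cball, of U r] r by (metis cball_eq_empty not_le less_imp_not_less)
  have "norm (R W - R U) \<le> (norm (R W) * q) * norm (W - U)"
  proof (rule differentiable_bound[of "cball U r"])
    fix V assume V: "V \<in> cball U r"
    show "(R has_derivative (\<lambda>Z. R V ** symmetric_part Z ** T V)) (at V within cball U r)"
      using R[OF inS(1)[OF V]] has_derivative_at_withinI by blast
    show "onorm (\<lambda>Z. R V ** symmetric_part Z ** T V) \<le> norm (R W) * q"
    proof (rule onorm_bound)
      show "0 \<le> norm (R W) * q" using q by simp
      fix Z
      have "norm (R V ** symmetric_part Z ** T V) \<le> norm (R V ** symmetric_part Z) * norm (T V) * K"
        by (rule K(2))
      also have "\<dots> \<le> (norm (R V) * norm (symmetric_part Z) * K) * norm (T V) * K"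
        by (intro mult_right_mono K norm_ge_zero)
      also have "\<dots> \<le> (norm (R W) * norm Z * K) * B * K"
        by (intro mult_right_mono mult_mono K norm_ge_zero W(2) V B(2) inS(2) norm_symmetric_part mult_nonneg_nonneg)
      also have "\<dots> = norm (R W) * q * norm Z" by (simp add: q_def mult_ac)
      finally show "norm (R V ** symmetric_part Z ** T V) \<le> norm (R W) * q * norm Z" .
    qed
  qed (use W r in auto)
  also have "\<dots> \<le> norm (R W) * q * r"
    using W q by (intro mult_left_mono) (auto simp: dist_norm norm_minus_commute)
  also have "\<dots> \<le> norm (R W) * (1 / 2)"
    using r mult_left_mono[OF r(3), of "norm (R W)"] by (simp add: mult.assoc)
  finally have "norm (R W) = 0" using 0 by simp
  then have "R V = 0" if "V \<in> ball U r" for V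
    using W(2)[of V] that by simp
  then show thesis using that r by blast
qed

section \<open>Jets of conformal transformations\<close>

lemma linear_cmat_expansion:
  assumes "linear L" "\<And>c X. L (cscale c X) = cscale c (L X)"
  shows "L X = (\<Sum>i\<in>UNIV. \<Sum>j\<in>UNIV. cscale (X $ i $ j) (L (matrix_unit i j)))"
  by (subst cmat_expansion) (simp add: linear_sum[OF assms(1)] assms(2))

text \<open>
  The map \<open>g\<close> is a conformal transformation precomposed with \<open>symmetric_part\<close>, which makes its domain
  an open subset of the whole matrix space; \<open>G\<close>, \<open>H\<close>, \<open>K\<close> are its first three derivatives.
\<close>

locale conformal_jet =
  fixes g :: "cmat \<Rightarrow> cmat" and G :: "cmat \<Rightarrow> cmat \<Rightarrow> cmat"
    and H :: "cmat \<Rightarrow> cmat \<Rightarrow> cmat \<Rightarrow> cmat" and K :: "cmat \<Rightarrow> cmat \<Rightarrow> cmat \<Rightarrow> cmat \<Rightarrow> cmat" and S :: "cmat set"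
  assumes open_S: "open S" and sym_S: "\<And>U. U \<in> S \<Longrightarrow> symmetric_part U \<in> S"
    and g: "\<And>U. U \<in> S \<Longrightarrow> (g has_derivative G U) (at U)"
    and G: "\<And>U X. U \<in> S \<Longrightarrow> ((\<lambda>V. G V X) has_derivative H U X) (at U)"
    and H: "\<And>U X Y. U \<in> S \<Longrightarrow> ((\<lambda>V. H V X Y) has_derivative K U X Y) (at U)"
    and G_cscale: "\<And>U c X. U \<in> S \<Longrightarrow> G U (cscale c X) = cscale c (G U X)"
    and H_cscale: "\<And>U c X Y. U \<in> S \<Longrightarrow> H U X (cscale c Y) = cscale c (H U X Y)"
    and H_sym: "\<And>U X Y. U \<in> S \<Longrightarrow> H U X Y = H U Y X"
    and K_sym: "\<And>U X Y Z. U \<in> S \<Longrightarrow> K U X Y Z = K U X Z Y"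
    and G_symmat: "\<And>U X. U \<in> S \<Longrightarrow> G U X \<in> symmat"
    and G_symmetric_part: "\<And>U X. U \<in> S \<Longrightarrow> G U X = G (symmetric_part U) (symmetric_part X)"
    and G_det: "\<And>U. U \<in> S \<Longrightarrow> \<exists>k. k \<noteq> 0 \<and> (\<forall>X\<in>symmat. det (G U X) = k * det X)"
begin

text \<open>The existential factor of \<open>G_det\<close>, recovered from its value at the identity
  matrix, where \<open>det\<close> is 1. In this form it is a polynomial in entries of the
  derivative and hence differentiable.\<close>

definition factor :: "cmat \<Rightarrow> complex" where
  "factor U = det (G U (mat 1))"

lemma G_linear: "U \<in> S \<Longrightarrow> linear (G U)"
  using g has_derivative_linear by blast

lemma H_linear: "U \<in> S \<Longrightarrow> linear (H U X)"
  using G has_derivative_linear by blast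

lemma G_similitude:
  assumes U: "U \<in> S"
  shows "det_similitude (factor U) (G U)"
proof -
  obtain k where k: "k \<noteq> 0" "\<And>X. X \<in> symmat \<Longrightarrow> det (G U X) = k * det X" using G_det[OF U] by blast
  have "factor U = k" using k(2)[OF symmat_1] by (simp add: factor_def)
  moreover have "linear_on_symmat (G U)"
    unfolding linear_on_symmat_def
    using G_linear[OF U] G_cscale[OF U] G_symmat[OF U] by (simp add: linear_add)
  ultimately show ?thesis using k by (simp add: det_similitude_def)
qed

lemma G_inj: "U \<in> S \<Longrightarrow> X \<in> symmat \<Longrightarrow> Y \<in> symmat \<Longrightarrow> G U X = G U Y \<longleftrightarrow> X = Y"
  using det_similitude_bij[OF G_similitude] by (auto simp: bij_betw_def inj_on_def)

lemma H_symmat: "U \<in> S \<Longrightarrow> H U X Y \<in> symmat"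
  using has_derivative_symmat[OF G open_S] G_symmat by blast

lemma H_symmetric_part:
  assumes U: "U \<in> S"
  shows "H U X Y = H (symmetric_part U) (symmetric_part X) (symmetric_part Y)"
proof -
  have "((\<lambda>V. G (symmetric_part V) (symmetric_part X)) has_derivative
      (\<lambda>Y. H (symmetric_part U) (symmetric_part X) (symmetric_part Y))) (at U)"
    using has_derivative_compose[OF bounded_linear.has_derivative[OF bounded_linear_symmetric_part has_derivative_ident]
        G[OF sym_S[OF U], of "symmetric_part X"]] .
  then have "((\<lambda>V. G V X) has_derivative
      (\<lambda>Y. H (symmetric_part U) (symmetric_part X) (symmetric_part Y))) (at U)"
    by (rule has_derivative_transform_within_open[OF _ open_S U]) (rule G_symmetric_part[symmetric])
  then have "H U X = (\<lambda>Y. H (symmetric_part U) (symmetric_part X) (symmetric_part Y))"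
    using G[OF U] has_derivative_unique by blast
  then show ?thesis by simp
qed

text \<open>Differentiating \<open>det (G V Y) = factor V * det Y\<close> in \<open>V\<close> along
  \<open>X\<close> gives this with \<open>c\<close> the derivative of \<open>factor\<close>; the
  symmetry of \<open>H\<close> puts \<open>X\<close> and \<open>Y\<close> into the required
  order.\<close>

lemma ddet_H:
  assumes U: "U \<in> S"
  obtains c where "\<And>Y. Y \<in> symmat \<Longrightarrow> ddet (G U Y) (H U X Y) = c * det Y"
proof
  fix Y assume Y: "Y \<in> symmat"
  have d: "((\<lambda>V. det (G V Y)) has_derivative (\<lambda>X. ddet (G U Y) (H U Y X))) (at U)" for Y
    by (rule has_derivative_det_symmat[OF G[OF U] open_S U]) (rule G_symmat)
  have "((\<lambda>V. factor V * det Y) has_derivative (\<lambda>X. ddet (G U (mat 1)) (H U (mat 1) X) * det Y)) (at U)"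
    unfolding factor_def by (rule has_derivative_mult_left[OF d])
  then have "((\<lambda>V. det (G V Y)) has_derivative (\<lambda>X. ddet (G U (mat 1)) (H U (mat 1) X) * det Y)) (at U)"
    by (rule has_derivative_transform_within_open[OF _ open_S U])
       (use G_similitude Y in \<open>simp add: det_similitude_def\<close>)
  then have "(\<lambda>X. ddet (G U Y) (H U Y X)) = (\<lambda>X. ddet (G U (mat 1)) (H U (mat 1) X) * det Y)"
    using d has_derivative_unique by blast
  then show "ddet (G U Y) (H U X Y) = ddet (G U (mat 1)) (H U (mat 1) X) * det Y"
    using H_sym[OF U, of X Y] by metis
qed

text \<open>Pulling \<open>H U X\<close> back by the invertible map \<open>G U\<close> gives, for
  each \<open>X\<close>, an infinitesimal conformal symmetry of \<open>det\<close>; the symmetry of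
  second derivatives places the whole family in the first prolongation.\<close>

lemma second_order_structure:
  assumes U: "U \<in> S"
  shows "\<exists>T\<in>symmat. \<forall>X\<in>symmat. \<forall>Y\<in>symmat. H U X Y = G U (X ** T ** Y + Y ** T ** X)"
proof -
  note sim = G_similitude[OF U]
  have lin: "linear_on_symmat (G U)" and k: "factor U \<noteq> 0" using sim by (simp_all add: det_similitude_def)
  have surj: "G U ` symmat = symmat" using det_similitude_bij[OF sim] by (simp add: bij_betw_def)
  define a where "a = (\<lambda>X Y. inv_into symmat (G U) (H U X Y))"
  have a_sym: "a X Y \<in> symmat" and Ga: "G U (a X Y) = H U X Y" for X Y
    using H_symmat[OF U, of X Y] surj by (auto simp: a_def intro: inv_into_into f_inv_into_f)
  have a_lin: "linear_on_symmat (a X)" for X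
    unfolding linear_on_symmat_def
  proof (intro conjI ballI allI)
    fix Y Z c assume Y: "Y \<in> symmat" and Z: "Z \<in> symmat"
    show "a X (Y + Z) = a X Y + a X Z"
      by (rule G_inj[OF U, THEN iffD1])
         (simp_all add: a_sym Ga symmat_add linear_on_symmatD(1)[OF lin] linear_add[OF H_linear[OF U]])
  next
    fix c Y
    show "a X (cscale c Y) = cscale c (a X Y)"
      by (rule G_inj[OF U, THEN iffD1])
         (simp_all add: a_sym Ga symmat_cscale linear_on_symmat_scale[OF lin] H_cscale[OF U])
  qed (rule a_sym)
  have "\<exists>A. \<forall>Y\<in>symmat. a X Y = A ** Y + Y ** transpose A" for X
  proof -
    obtain c where c: "\<And>Y. Y \<in> symmat \<Longrightarrow> ddet (G U Y) (H U X Y) = c * det Y"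
      using ddet_H[OF U] by blast
    have "ddet Y (a X Y) = c / factor U * det Y" if Y: "Y \<in> symmat" for Y
    proof -
      have "factor U * ddet Y (a X Y) = c * det Y"
        using det_similitude_ddet[OF sim Y a_sym[of X Y]] c[OF Y] by (simp add: Ga)
      then show ?thesis using k by (simp add: field_simps)
    qed
    from det_symmetry_algebra[OF a_lin this] show ?thesis by metis
  qed
  then obtain A where A: "\<And>X Y. Y \<in> symmat \<Longrightarrow> a X Y = A X ** Y + Y ** transpose (A X)" by metis
  have comm: "a X Y = a Y X" for X Y using H_sym[OF U] by (simp add: a_def)
  obtain T where T: "T \<in> symmat" "\<And>X Y. X \<in> symmat \<Longrightarrow> Y \<in> symmat \<Longrightarrow> a X Y = X ** T ** Y + Y ** T ** X"
    using det_symmetry_prolongation[of a A] A comm by blast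
  have "H U X Y = G U (X ** T ** Y + Y ** T ** X)" if "X \<in> symmat" "Y \<in> symmat" for X Y
    using T(2)[OF that] Ga by metis
  then show ?thesis using T(1) by blast
qed

definition T :: "cmat \<Rightarrow> cmat" where
  "T U = (SOME T. T \<in> symmat \<and> (\<forall>X\<in>symmat. \<forall>Y\<in>symmat. H U X Y = G U (X ** T ** Y + Y ** T ** X)))"

lemma T:
  assumes "U \<in> S"
  shows "T U \<in> symmat" "X \<in> symmat \<Longrightarrow> Y \<in> symmat \<Longrightarrow> H U X Y = G U (X ** T U ** Y + Y ** T U ** X)"
proof -
  have "\<exists>T. T \<in> symmat \<and> (\<forall>X\<in>symmat. \<forall>Y\<in>symmat. H U X Y = G U (X ** T ** Y + Y ** T ** X))"
    using second_order_structure[OF assms] by blast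
  then have "T U \<in> symmat \<and> (\<forall>X\<in>symmat. \<forall>Y\<in>symmat. H U X Y = G U (X ** T U ** Y + Y ** T U ** X))"
    unfolding T_def by (rule someI_ex)
  then show "T U \<in> symmat" "X \<in> symmat \<Longrightarrow> Y \<in> symmat \<Longrightarrow> H U X Y = G U (X ** T U ** Y + Y ** T U ** X)" by auto
qed

text \<open>At \<open>X = Y = mat 1\<close> the defining relation of \<open>T\<close> can be solved
  for \<open>G U (T U)\<close>; since \<open>G U\<close> is injective, this ties the chosen matrix
  to the derivatives.\<close>

lemma G_T:
  assumes U: "U \<in> S"
  shows "G U (T U) = cscale (1/2) (H U (mat 1) (mat 1))"
proof -
  have "H U (mat 1) (mat 1) = G U (T U + T U)" using T(2)[OF U symmat_1 symmat_1] by simp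
  also have "\<dots> = G U (T U) + G U (T U)" by (rule linear_add[OF G_linear[OF U]])
  finally show ?thesis by (simp add: vec_eq_iff)
qed

lemma T_symmetric_part:
  assumes U: "U \<in> S"
  shows "T (symmetric_part U) = T U"
proof -
  note U' = sym_S[OF U]
  have "G (symmetric_part U) (T (symmetric_part U)) = G U (T U)"
    unfolding G_T[OF U] G_T[OF U'] H_symmetric_part[OF U, of "mat 1" "mat 1"]
    by (simp add: symmetric_part_id symmat_1)
  also have "\<dots> = G (symmetric_part U) (T U)"
    using G_symmetric_part[OF U, of "T U"] T(1)[OF U] by (simp add: symmetric_part_id)
  finally show ?thesis using G_inj[OF U' T(1)[OF U'] T(1)[OF U]] by simp
qed

lemma H_T:
  assumes U: "U \<in> S"
  shows "H U X Y = G U (symmetric_part X ** T U ** symmetric_part Y + symmetric_part Y ** T U ** symmetric_part X)"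
proof -
  have "H U X Y = H U (symmetric_part X) (symmetric_part Y)"
    using H_symmetric_part[OF U, of X Y] H_symmetric_part[OF U, of "symmetric_part X" "symmetric_part Y"] by simp
  then show ?thesis using T(2)[OF U symmetric_part_symmat symmetric_part_symmat] by simp
qed

text \<open>The similitude property strips off \<open>G U\<close> without inverting it, so the
  pairing of \<open>T\<close> with any fixed \<open>Y\<close> becomes a rational expression in
  entries of \<open>G\<close> and \<open>H\<close>.\<close>

lemma ddet_T:
  assumes U: "U \<in> S" and Y: "Y \<in> symmat"
  shows "ddet Y (T U) = ddet (G U Y) (cscale (1/2) (H U (mat 1) (mat 1))) / factor U"
  using det_similitude_ddet[OF G_similitude[OF U] Y T(1)[OF U]] G_similitude[OF U]
  by (simp add: G_T[OF U] det_similitude_def)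

lemma T_differentiable:
  assumes U: "U \<in> S"
  obtains T' where "(T has_derivative T') (at U)"
proof -
  have e: "(\<lambda>V. f V $ i $ j) differentiable (at U)" if "f differentiable (at U)" for f :: "cmat \<Rightarrow> cmat" and i j
    using that bounded_linear.has_derivative[OF bounded_linear_entry] unfolding differentiable_def by blast
  have dG: "(\<lambda>V. G V X $ i $ j) differentiable (at U)" for X i j
    using G[OF U] by (intro e) (auto simp: differentiable_def)
  have dH: "(\<lambda>V. H V X Y $ i $ j) differentiable (at U)" for X Y i j
    using H[OF U] by (intro e) (auto simp: differentiable_def)
  have "factor U \<noteq> 0" using G_similitude[OF U] by (simp add: det_similitude_def)
  have dfactor: "factor differentiable (at U)"
    unfolding factor_def[abs_def] det_3
    by (intro differentiable_add differentiable_diff differentiable_mult dG)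
  have "(\<lambda>V. ddet (G V Y) (cscale (1/2) (H V (mat 1) (mat 1))) / factor V) differentiable (at U)" for Y
    unfolding ddet_def cscale_nth power2_eq_square
    by (intro differentiable_divide differentiable_add differentiable_diff differentiable_mult dG dH dfactor
        differentiable_const \<open>factor U \<noteq> 0\<close>)
  then have d: "\<exists>D. ((\<lambda>V. ddet (G V Y) (cscale (1/2) (H V (mat 1) (mat 1))) / factor V) has_derivative D) (at U)" for Y
    by (simp add: differentiable_def)
  have dT: "(\<lambda>V. ddet Y (T V)) differentiable (at U)" if Y: "Y \<in> symmat" for Y
  proof -
    obtain D where "((\<lambda>V. ddet (G V Y) (cscale (1/2) (H V (mat 1) (mat 1))) / factor V) has_derivative D) (at U)"
      using d by blast
    then have "((\<lambda>V. ddet Y (T V)) has_derivative D) (at U)"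
      by (rule has_derivative_transform_within_open[OF _ open_S U]) (rule ddet_T[OF _ Y, symmetric])
    then show ?thesis by (auto simp: differentiable_def)
  qed
  have T11: "(\<lambda>V. T V $ 1 $ 1) differentiable (at U)"
    and T22: "(\<lambda>V. T V $ 2 $ 2) differentiable (at U)"
    and T33: "(\<lambda>V. T V $ 3 $ 3) differentiable (at U)"
    using dT[of "smat 0 1 1 0 0 0"] dT[of "smat 1 0 1 0 0 0"] dT[of "smat 1 1 0 0 0 0"] by (simp_all add: ddet_def)
  \<comment> \<open>At these test matrices \<open>ddet\<close> returns minus a diagonal entry of
    \<open>T\<close> minus twice an off-diagonal one.\<close>
  have "(\<lambda>V. - (1/2) * (ddet (smat 0 0 1 1 0 0) (T V) + T V $ 3 $ 3)) differentiable (at U)"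
    "(\<lambda>V. - (1/2) * (ddet (smat 0 1 0 0 1 0) (T V) + T V $ 2 $ 2)) differentiable (at U)"
    "(\<lambda>V. - (1/2) * (ddet (smat 1 0 0 0 0 1) (T V) + T V $ 1 $ 1)) differentiable (at U)"
    by (intro differentiable_mult differentiable_add differentiable_const dT smat_in_symmat T11 T22 T33)+
  then have T12: "(\<lambda>V. T V $ 1 $ 2) differentiable (at U)"
    and T13: "(\<lambda>V. T V $ 1 $ 3) differentiable (at U)"
    and T23: "(\<lambda>V. T V $ 2 $ 3) differentiable (at U)"
    by (simp_all add: ddet_def)
  have lower: "(\<lambda>V. T V $ i $ j) differentiable (at U)" if d: "(\<lambda>V. T V $ j $ i) differentiable (at U)" for i j
  proof -
    have eq: "T V $ j $ i = T V $ i $ j" if "V \<in> S" for V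
      using T(1)[OF that] transpose_nth[of "T V" i j] by (simp add: symmat_def)
    obtain D where "((\<lambda>V. T V $ j $ i) has_derivative D) (at U)"
      using d by (auto simp: differentiable_def)
    then have "((\<lambda>V. T V $ i $ j) has_derivative D) (at U)"
      by (rule has_derivative_transform_within_open[OF _ open_S U]) (rule eq)
    then show ?thesis by (auto simp: differentiable_def)
  qed
  have "(\<lambda>V. T V $ i $ j) differentiable (at U)" for i j
    using exhaust_3[of i] exhaust_3[of j]
    by (elim disjE; simp only: T11 T22 T33 T12 T13 T23 lower[OF T12] lower[OF T13] lower[OF T23])
  then have "\<forall>i j. \<exists>D. ((\<lambda>V. T V $ i $ j) has_derivative D) (at U)" by (simp add: differentiable_def)
  then obtain D where D: "\<And>i j. ((\<lambda>V. T V $ i $ j) has_derivative D i j) (at U)" by metis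
  have "(T has_derivative (\<lambda>X. \<chi> i j. D i j X)) (at U)"
    by (rule has_derivative_cmatI) (simp add: D)
  then show thesis by (rule that)
qed

text \<open>Derivatives of \<open>G\<close> are available only for a fixed second argument, so
  \<open>m V\<close> is expanded in matrix units and the product rule is applied to each
  summand.\<close>

lemma has_derivative_G_compose:
  assumes U: "U \<in> S" and m: "(m has_derivative m') (at U)"
  shows "((\<lambda>V. G V (m V)) has_derivative (\<lambda>Z. H U (m U) Z + G U (m' Z))) (at U)"
proof -
  have "((\<lambda>V. \<Sum>i\<in>UNIV. \<Sum>j\<in>UNIV. cscale (m V $ i $ j) (G V (matrix_unit i j))) has_derivative
     (\<lambda>Z. \<Sum>i\<in>UNIV. \<Sum>j\<in>UNIV. cscale (m U $ i $ j) (H U (matrix_unit i j) Z) + cscale (m' Z $ i $ j) (G U (matrix_unit i j)))) (at U)"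
    by (intro has_derivative_sum bounded_bilinear.FDERIV[OF bounded_bilinear_cscale] G[OF U]
        bounded_linear.has_derivative[OF bounded_linear_entry m])
  moreover have "(\<Sum>i\<in>UNIV. \<Sum>j\<in>UNIV. cscale (m U $ i $ j) (H U (matrix_unit i j) Z) + cscale (m' Z $ i $ j) (G U (matrix_unit i j)))
      = H U (m U) Z + G U (m' Z)" for Z
  proof -
    have "H U (m U) Z = H U Z (m U)" by (rule H_sym[OF U])
    also have "\<dots> = (\<Sum>i\<in>UNIV. \<Sum>j\<in>UNIV. cscale (m U $ i $ j) (H U Z (matrix_unit i j)))"
      by (rule linear_cmat_expansion[OF H_linear[OF U] H_cscale[OF U]])
    also have "\<dots> = (\<Sum>i\<in>UNIV. \<Sum>j\<in>UNIV. cscale (m U $ i $ j) (H U (matrix_unit i j) Z))"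
      using H_sym[OF U] by simp
    finally show ?thesis
      using linear_cmat_expansion[OF G_linear[OF U] G_cscale[OF U], of "m' Z"] by (simp add: sum.distrib)
  qed
  ultimately have "((\<lambda>V. \<Sum>i\<in>UNIV. \<Sum>j\<in>UNIV. cscale (m V $ i $ j) (G V (matrix_unit i j))) has_derivative
      (\<lambda>Z. H U (m U) Z + G U (m' Z))) (at U)" by simp
  then show ?thesis
    by (rule has_derivative_transform_within_open[OF _ open_S U])
       (rule linear_cmat_expansion[OF G_linear G_cscale, symmetric])
qed

text \<open>Differentiating \<open>H U X Y = G U (X T Y + Y T X)\<close> once more writes the third
  derivative as \<open>G U (M X Y Z)\<close>. Its symmetry in \<open>Y\<close> and \<open>Z\<close>
  passes to \<open>M\<close> by injectivity, and becomes a second prolongation condition on the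
  defect of the Riccati equation.\<close>

lemma T_Riccati:
  assumes U: "U \<in> S"
  shows "(T has_derivative (\<lambda>Z. T U ** symmetric_part Z ** T U)) (at U)"
proof -
  obtain T' where T': "(T has_derivative T') (at U)" using T_differentiable[OF U] .
  obtain T'' where T'': "(T has_derivative T'') (at (symmetric_part U))" using T_differentiable[OF sym_S[OF U]] .
  have "((\<lambda>V. T (symmetric_part V)) has_derivative (\<lambda>Z. T'' (symmetric_part Z))) (at U)"
    using has_derivative_compose[OF bounded_linear.has_derivative[OF bounded_linear_symmetric_part has_derivative_ident] T''] .
  then have "(T has_derivative (\<lambda>Z. T'' (symmetric_part Z))) (at U)"
    by (rule has_derivative_transform_within_open[OF _ open_S U]) (rule T_symmetric_part)
  then have "T' = (\<lambda>Z. T'' (symmetric_part Z))" using T' has_derivative_unique by blast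
  then have T'_sym: "T' (symmetric_part Z) = T' Z" for Z by simp
  have T'_symmat: "T' Z \<in> symmat" for Z
    by (rule has_derivative_symmat[OF T' open_S U]) (rule T(1))
  define M where "M = (\<lambda>X Y Z. X ** T U ** Y ** T U ** Z + Y ** T U ** X ** T U ** Z
      + Z ** T U ** X ** T U ** Y + Z ** T U ** Y ** T U ** X + X ** T' Z ** Y + Y ** T' Z ** X)"
  have tr: "transpose X = X" if "X \<in> symmat" for X using that by (simp add: symmat_def)
  have prod_symmat: "X ** A ** Y + Y ** A ** X \<in> symmat" if "X \<in> symmat" "Y \<in> symmat" "A \<in> symmat" for X Y A
    using that by (simp add: symmat_def matrix_ring_simps add.commute)
  have K_eq: "K U X Y Z = G U (M X Y Z)" if X: "X \<in> symmat" and Y: "Y \<in> symmat" and Z: "Z \<in> symmat" for X Y Z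
  proof -
    define m where "m = (\<lambda>V. X ** T V ** Y + Y ** T V ** X)"
    have m: "(m has_derivative (\<lambda>Z. X ** T' Z ** Y + Y ** T' Z ** X)) (at U)"
    proof -
      have "bounded_linear (\<lambda>A. X ** A ** Y + Y ** A ** X)"
        by (intro bounded_linear_add bounded_linear_compose[OF bounded_bilinear.bounded_linear_left[OF bounded_bilinear_cmat_mult]
            bounded_bilinear.bounded_linear_right[OF bounded_bilinear_cmat_mult]])
      from bounded_linear.has_derivative[OF this T'] show ?thesis unfolding m_def .
    qed
    have "((\<lambda>V. H V X Y) has_derivative (\<lambda>Z. H U (m U) Z + G U (X ** T' Z ** Y + Y ** T' Z ** X))) (at U)"
      by (rule has_derivative_transform_within_open[OF has_derivative_G_compose[OF U m] open_S U])
         (use T(2) X Y in \<open>simp add: m_def\<close>)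
    then have "K U X Y = (\<lambda>Z. H U (m U) Z + G U (X ** T' Z ** Y + Y ** T' Z ** X))"
      using H[OF U] has_derivative_unique by blast
    then have "K U X Y Z = H U (m U) Z + G U (X ** T' Z ** Y + Y ** T' Z ** X)" by simp
    also have "H U (m U) Z = G U (m U ** T U ** Z + Z ** T U ** m U)"
      using T(2)[OF U _ Z] prod_symmat[OF X Y T(1)[OF U]] by (simp add: m_def)
    finally have "K U X Y Z = G U (m U ** T U ** Z + Z ** T U ** m U + (X ** T' Z ** Y + Y ** T' Z ** X))"
      by (simp add: linear_add[OF G_linear[OF U]])
    also have "m U ** T U ** Z + Z ** T U ** m U + (X ** T' Z ** Y + Y ** T' Z ** X) = M X Y Z"
      by (simp add: m_def M_def matrix_ring_simps add_ac)
    finally show ?thesis .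
  qed
  have M_symmat: "M X Y Z \<in> symmat" if "X \<in> symmat" "Y \<in> symmat" "Z \<in> symmat" for X Y Z
    using that T(1)[OF U] T'_symmat[of Z] unfolding symmat_def M_def
    by (simp add: matrix_ring_simps add_ac)
  have M_eq: "M X Y Z = M X Z Y" if XYZ: "X \<in> symmat" "Y \<in> symmat" "Z \<in> symmat" for X Y Z
    using K_sym[OF U, of X Y Z] K_eq[OF XYZ] K_eq[OF XYZ(1,3,2)]
      G_inj[OF U M_symmat[OF XYZ] M_symmat[OF XYZ(1,3,2)]] by simp
  \<comment> \<open>Replacing \<open>T' Z\<close> by \<open>D Z + T U ** Z ** T U\<close> in
    \<open>M\<close> groups its products with two factors \<open>T U\<close> into pairs exchanged by
    swapping \<open>Y\<close> and \<open>Z\<close>, so only the terms with \<open>D\<close> survive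
    in the symmetry relation.\<close>
  define D where "D = (\<lambda>Z. T' Z - T U ** Z ** T U)"
  have "D Z = 0" if "Z \<in> symmat" for Z
  proof (rule det_symmetry_second_prolongation[OF _ _ that])
    show "D Z \<in> symmat" if "Z \<in> symmat" for Z
      using that T(1)[OF U] T'_symmat[of Z] by (simp add: D_def symmat_def matrix_ring_simps)
    show "X ** D Z ** Y + Y ** D Z ** X = X ** D Y ** Z + Z ** D Y ** X"
      if "X \<in> symmat" "Y \<in> symmat" "Z \<in> symmat" for X Y Z
      using M_eq[OF that] by (simp add: D_def M_def matrix_ring_simps algebra_simps)
  qed
  from this[OF symmetric_part_symmat] have "T' Z = T U ** symmetric_part Z ** T U" for Z
    using T'_sym[of Z] by (simp add: D_def)
  then have "T' = (\<lambda>Z. T U ** symmetric_part Z ** T U)" by blast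
  then show ?thesis using T' by simp
qed


lemma ball_symmetric_part:
  assumes "U \<in> symmat" "V \<in> ball U r"
  shows "symmetric_part V \<in> ball U r"
proof -
  have "U - symmetric_part V = symmetric_part (U - V)"
    using assms(1) linear_diff[OF bounded_linear.linear[OF bounded_linear_symmetric_part], of U V]
    by (simp add: symmetric_part_id)
  then show ?thesis
    using assms(2) norm_symmetric_part[of "U - V"] by (simp add: dist_norm)
qed

text \<open>
  The Riccati equation is solved by \<open>T V = (1 - T U\<^sub>0 (V - U\<^sub>0))\<^sup>-\<^sup>1 T U\<^sub>0\<close>, so that
  \<open>E\<close> below plays the role of the denominator of a fractional linear transformation.
\<close>

lemma derivative_near:
  assumes U: "U \<in> S" "U \<in> symmat"
  defines "E \<equiv> \<lambda>V. mat 1 - T U ** symmetric_part (V - U)"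
  obtains r where "0 < r" "ball U r \<subseteq> S" "\<And>V. V \<in> ball U r \<Longrightarrow> invertible (E V)"
    "\<And>V X. V \<in> ball U r \<Longrightarrow> X \<in> symmat \<Longrightarrow> G V (transpose (E V) ** X ** E V) = G U X"
proof -
  interpret mult: bounded_bilinear "(**) :: cmat \<Rightarrow> cmat \<Rightarrow> cmat" by (rule bounded_bilinear_cmat_mult)
  have tr: "transpose (T V) = T V" if "V \<in> S" for V using T(1)[OF that] by (simp add: symmat_def)
  have trs: "transpose (symmetric_part Z) = symmetric_part Z" for Z
    using symmetric_part_symmat by (simp add: symmat_def)
  have EU: "E U = mat 1"
    by (simp add: E_def linear_0[OF bounded_linear.linear[OF bounded_linear_symmetric_part]] matrix_mult_0_right)
  have E: "(E has_derivative (\<lambda>Z. - (T U ** symmetric_part Z))) (at V)" for V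
  proof -
    have "((\<lambda>V. V - U) has_derivative (\<lambda>Z. Z)) (at V)"
      by (auto intro!: derivative_eq_intros)
    from bounded_linear.has_derivative[OF bounded_linear_compose[OF mult.bounded_linear_right bounded_linear_symmetric_part] this]
    have "((\<lambda>V. mat 1 - T U ** symmetric_part (V - U)) has_derivative (\<lambda>Z. 0 - T U ** symmetric_part Z)) (at V)"
      by (intro has_derivative_diff has_derivative_const)
    then show ?thesis by (simp add: E_def)
  qed
  have contE: "continuous_on A E" for A
    by (intro continuous_at_imp_continuous_on ballI has_derivative_continuous[OF E])
  \<comment> \<open>\<open>R\<close> is the defect of the claimed solution. By the Riccati equation
    it satisfies a linear system with value 0 at \<open>U\<close>, which forces it to vanish
    nearby.\<close>
  define R where "R = (\<lambda>V. E V ** T V - T U)"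
  have R: "(R has_derivative (\<lambda>Z. R V ** symmetric_part Z ** T V)) (at V)" if V: "V \<in> S" for V
  proof -
    have "(R has_derivative (\<lambda>Z. (E V ** (T V ** symmetric_part Z ** T V) + (- (T U ** symmetric_part Z)) ** T V) - 0)) (at V)"
      unfolding R_def by (intro has_derivative_diff has_derivative_const mult.FDERIV E T_Riccati V)
    moreover have "(E V ** (T V ** symmetric_part Z ** T V) + (- (T U ** symmetric_part Z)) ** T V) - 0 =
        R V ** symmetric_part Z ** T V" for Z
      by (simp add: R_def matrix_ring_simps)
    ultimately show ?thesis by simp
  qed
  have contT: "continuous_on S T"
    by (intro continuous_at_imp_continuous_on ballI has_derivative_continuous[OF T_Riccati])
  have "R U = 0" by (simp add: R_def EU)
  then obtain r1 where r1: "0 < r1" "\<And>V. V \<in> ball U r1 \<Longrightarrow> R V = 0"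
    using linear_system_vanishing[OF open_S U(1) R contT] by blast
  obtain r2 where r2: "0 < r2" "ball U r2 \<subseteq> S" using open_S U(1) open_contains_ball by blast
  have "open {V. det (E V) \<noteq> 0}"
    by (intro open_Collect_neq continuous_on_det_cmat contE continuous_on_const)
  moreover have "U \<in> {V. det (E V) \<noteq> 0}" by (simp add: EU)
  ultimately obtain r3 where r3: "0 < r3" "ball U r3 \<subseteq> {V. det (E V) \<noteq> 0}"
    using open_contains_ball by blast
  define r where "r = min r1 (min r2 r3)"
  have r: "0 < r" "ball U r \<subseteq> ball U r1" "ball U r \<subseteq> ball U r2" "ball U r \<subseteq> ball U r3"
    using r1 r2 r3 by (auto simp: r_def)
  show thesis
  proof (rule that[of r])
    show "0 < r" "ball U r \<subseteq> S" using r r2 by auto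
    show "invertible (E V)" if "V \<in> ball U r" for V
      using that r(4) r3(2) by (auto simp: invertible_det_nz)
    fix V X assume V: "V \<in> ball U r" and X: "X \<in> symmat"
    define m where "m = (\<lambda>V. transpose (E V) ** X ** E V)"
    have m_symmat: "m V \<in> symmat" for V
      using X by (simp add: m_def symmat_def matrix_ring_simps)
    \<comment> \<open>The product rule yields \<open>G V\<close> applied to
      \<open>m T Z + Z T m\<close> plus the derivative of \<open>m\<close>; with
      \<open>E V ** T V = T U\<close> these two cancel.\<close>
    have "((\<lambda>V. G V (m V)) has_derivative (\<lambda>Z. 0)) (at V within ball U r)" if V: "V \<in> ball U r" for V
    proof -
      have VS: "V \<in> S" using V r r2 by auto
      have ET: "E V ** T V = T U" using r1(2)[of V] V r by (auto simp: R_def)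
      have TE: "T V ** transpose (E V) = T U"
        using arg_cong[OF ET, of transpose] by (simp add: matrix_transpose_mul tr VS U)
      define m' where "m' = (\<lambda>Z. (transpose (E V) ** X) ** (- (T U ** symmetric_part Z)) +
          (transpose (- (T U ** symmetric_part Z)) ** X) ** E V)"
      have "((\<lambda>V. transpose (E V) ** X) has_derivative (\<lambda>Z. transpose (- (T U ** symmetric_part Z)) ** X)) (at V)"
        by (rule bounded_linear.has_derivative[OF mult.bounded_linear_left
              bounded_linear.has_derivative[OF bounded_linear_transpose E]])
      then have "(m has_derivative m') (at V)"
        unfolding m_def m'_def by (rule mult.FDERIV[OF _ E])
      from has_derivative_G_compose[OF VS this]
      have "((\<lambda>V. G V (m V)) has_derivative (\<lambda>Z. H V (m V) Z + G V (m' Z))) (at V)" .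
      moreover have "H V (m V) Z + G V (m' Z) = 0" for Z
      proof -
        have "H V (m V) Z = G V (m V ** T V ** symmetric_part Z + symmetric_part Z ** T V ** m V)"
          unfolding H_T[OF VS] symmetric_part_id[OF m_symmat] ..
        also have "m V ** T V ** symmetric_part Z + symmetric_part Z ** T V ** m V =
            transpose (E V) ** X ** (E V ** T V) ** symmetric_part Z + symmetric_part Z ** (T V ** transpose (E V)) ** X ** E V"
          by (simp add: m_def matrix_mul_assoc)
        also have "\<dots> = - m' Z"
          unfolding ET TE by (simp add: m'_def matrix_ring_simps trs tr U)
        finally show ?thesis by (simp add: linear_neg[OF G_linear[OF VS]])
      qed
      ultimately show ?thesis by (simp add: has_derivative_at_withinI)
    qed
    then have "G V (m V) = G U (m U)"
      by (rule has_derivative_zero_unique[OF convex_ball]) (use V r in auto)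
    then show "G V (transpose (E V) ** X ** E V) = G U X"
      by (simp add: m_def EU)
  qed
qed

text \<open>The matrix \<open>M\<close> is built to reproduce the value of \<open>g\<close>, its
  first derivative and the field \<open>T\<close> at \<open>U\<close>. The local formula for the
  derivative then gives both maps the same first derivative on a whole ball, and they agree at its
  centre.\<close>

lemma locally_sp_action:
  assumes U: "U \<in> S" "U \<in> symmat" and gU: "g U \<in> symmat"
  obtains M r where "M \<in> carrier Sp6" "0 < r" "ball U r \<subseteq> S"
    "\<And>V. V \<in> ball U r \<Longrightarrow> V \<in> symmat \<Longrightarrow> sp_action M V = Some (g V)"
proof -
  define E where "E = (\<lambda>V. mat 1 - T U ** symmetric_part (V - U))"
  obtain r where r: "0 < r" "ball U r \<subseteq> S" "\<And>V. V \<in> ball U r \<Longrightarrow> invertible (E V)"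
    "\<And>V X. V \<in> ball U r \<Longrightarrow> X \<in> symmat \<Longrightarrow> G V (transpose (E V) ** X ** E V) = G U X"
    using derivative_near[OF U] unfolding E_def by blast
  obtain P where P: "invertible P" "\<And>X. X \<in> symmat \<Longrightarrow> G U X = P ** X ** transpose P"
    using det_similitude_congruence[OF G_similitude[OF U(1)]] by blast
  define Q where "Q = matrix_inv P"
  have PQ: "P ** Q = mat 1" "Q ** P = mat 1" using matrix_inv_mult[OF P(1)] by (simp_all add: Q_def)
  have QP_t: "transpose Q ** transpose P = mat 1" "transpose P ** transpose Q = mat 1"
    using PQ by (simp_all flip: matrix_transpose_mul)
  have trT: "transpose (T U) = T U" using T(1)[OF U(1)] by (simp add: symmat_def)
  \<comment> \<open>\<open>N\<close> acts by \<open>X |-> P X (1 - T X)^{-1} P^t\<close> with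
    \<open>T = T U\<close>: its derivative at 0 is congruence by \<open>P\<close>, and
    \<open>T\<close> governs its second derivative. The translations move \<open>U\<close> to 0 and
    0 to \<open>g U\<close>.\<close>
  define N where "N = block_matrix P 0 (- (transpose Q ** T U)) (transpose Q)"
  have "T U ** Q ** P = T U"
    by (simp add: PQ flip: matrix_mul_assoc)
  then have N: "N \<in> carrier Sp6"
    using PQ QP_t by (simp add: N_def Sp6_def matrix_ring_simps trT)
  define M where "M = sp_translation (g U) ** (N ** sp_translation (- U))"
  have negU: "- U \<in> symmat" using U by (simp add: symmat_iff)
  have M: "M \<in> carrier Sp6"
    unfolding M_def by (intro Sp6_mult sp_translation_carrier N gU negU)
  have den_M: "den M V = transpose Q ** E V" if "V \<in> symmat" for V
  proof -
    have "V - U \<in> symmat" using that U symmat_diff by blast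
    then show ?thesis
      by (simp add: den_def M_def N_def E_def blocks_mult sp_translation_def matrix_ring_simps symmetric_part_id)
  qed
  have inv: "invertible (transpose Q)" using QP_t invertible_def by blast
  have dom: "V \<in> dom (sp_action M)" if "V \<in> ball U r" "V \<in> symmat" for V
    using that r(3) inv by (simp add: dom_sp_action den_M invertible_mult)
  have inv_den: "matrix_inv (den M V) = matrix_inv (E V) ** transpose P" if "V \<in> ball U r" "V \<in> symmat" for V
  proof (rule matrix_inv_eqI)
    have "den M V ** (matrix_inv (E V) ** transpose P) = transpose Q ** (E V ** matrix_inv (E V)) ** transpose P"
      by (simp add: den_M[OF that(2)] matrix_mul_assoc)
    then show "den M V ** (matrix_inv (E V) ** transpose P) = mat 1"
      by (simp add: matrix_inv_mult[OF r(3)[OF that(1)]] QP_t)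
  qed
  have deriv_eq: "transpose (matrix_inv (den M V)) ** X ** matrix_inv (den M V) = G V X"
    if V: "V \<in> ball U r" "V \<in> symmat" and X: "X \<in> symmat" for V X
  proof -
    define F where "F = matrix_inv (E V)"
    have FE: "F ** E V = mat 1" "E V ** F = mat 1" using matrix_inv_mult[OF r(3)[OF V(1)]] by (simp_all add: F_def)
    have FE_t: "transpose (E V) ** transpose F = mat 1" using FE by (simp flip: matrix_transpose_mul)
    have Y: "transpose F ** X ** F \<in> symmat" using X by (simp add: symmat_def matrix_ring_simps)
    have "transpose (E V) ** (transpose F ** X ** F) ** E V = (transpose (E V) ** transpose F) ** X ** (F ** E V)"
      by (simp only: matrix_mul_assoc)
    then have "G V X = G U (transpose F ** X ** F)" using r(4)[OF V(1) Y] by (simp add: FE FE_t)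
    also have "\<dots> = P ** (transpose F ** X ** F) ** transpose P" by (rule P(2)[OF Y])
    finally show ?thesis
      by (simp add: inv_den[OF V] matrix_ring_simps flip: F_def)
  qed
  define h where "h = (\<lambda>V. g V - the (sp_action M (symmetric_part V)))"
  have h: "(h has_derivative (\<lambda>Z. 0)) (at V within ball U r)" if V: "V \<in> ball U r" for V
  proof -
    let ?V = "symmetric_part V"
    have sV: "?V \<in> ball U r" "?V \<in> symmat"
      using ball_symmetric_part[OF U(2) V] symmetric_part_symmat by blast+
    have VS: "V \<in> S" using V r by auto
    have "((\<lambda>W. the (sp_action M W)) has_derivative
        (\<lambda>X. transpose (matrix_inv (den M ?V)) ** X ** matrix_inv (den M ?V))) (at ?V within range symmetric_part)"
      by (rule has_derivative_subset[OF sp_action_has_derivative[OF M dom[OF sV]]])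
         (use symmetric_part_symmat in auto)
    from has_derivative_in_compose[OF bounded_linear.has_derivative[OF bounded_linear_symmetric_part has_derivative_ident] this]
    have "((\<lambda>W. the (sp_action M (symmetric_part W))) has_derivative
        (\<lambda>X. transpose (matrix_inv (den M ?V)) ** symmetric_part X ** matrix_inv (den M ?V))) (at V)" .
    then have "((\<lambda>W. the (sp_action M (symmetric_part W))) has_derivative (\<lambda>X. G ?V (symmetric_part X))) (at V)"
      by (simp only: deriv_eq[OF sV symmetric_part_symmat])
    from has_derivative_diff[OF g[OF VS] this]
    have "(h has_derivative (\<lambda>X. G V X - G ?V (symmetric_part X))) (at V)"
      unfolding h_def .
    then show ?thesis
      by (simp add: G_symmetric_part[OF VS, symmetric] has_derivative_at_withinI)
  qed
  have act_U: "act M U = g U"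
  proof (rule act_eqI)
    show "invertible (den M U)" using dom[of U] r U by (simp add: dom_sp_action)
    show "g U ** den M U = num M U"
      by (simp add: den_def num_def M_def N_def blocks_mult sp_translation_def matrix_ring_simps)
  qed
  have "sp_action M V = Some (g V)" if V: "V \<in> ball U r" "V \<in> symmat" for V
  proof -
    have "h V = h U"
      by (rule has_derivative_zero_unique[OF convex_ball h V(1)]) (use r in auto)
    moreover have "h U = 0"
      using the_sp_action[OF dom[of U]] r U act_U by (simp add: h_def symmetric_part_id)
    ultimately have "g V = the (sp_action M V)"
      using V(2) by (simp add: h_def symmetric_part_id)
    then show ?thesis using dom[OF V] by (auto simp: dom_def)
  qed
  then show thesis using that M r by blast
qed

end

section \<open>The group of conformal automorphisms\<close>

lemma conformal_transformation_locally_sp_action: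
  assumes f: "conformal_transformation f" and U: "U \<in> dom f"
  obtains M N where "M \<in> carrier Sp6" "openin (top_of_set symmat) N" "U \<in> N" "N \<subseteq> dom f"
    "\<And>V. V \<in> N \<Longrightarrow> f V = sp_action M V"
proof -
  have dom: "openin (top_of_set symmat) (dom f)" and ran: "ran f \<subseteq> symmat"
    using f by (simp_all add: conformal_transformation_def)
  obtain B where B: "open B" "dom f = symmat \<inter> B" using dom by (auto simp: openin_open)
  have "\<forall>V\<in>dom f. \<exists>F. ((\<lambda>V. the (f V)) has_derivative F) (at V within symmat) \<and>
        (\<forall>c. \<forall>X\<in>symmat. F (cscale c X) = cscale c (F X)) \<and>
        (\<exists>k. k \<noteq> 0 \<and> (\<forall>X\<in>symmat. det_form (F X) = k * det_form X))"
    using f by (simp add: conformal_transformation_def)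
  from bchoice[OF this] obtain F where F': "\<forall>V\<in>dom f. ((\<lambda>V. the (f V)) has_derivative F V) (at V within symmat) \<and>
        (\<forall>c. \<forall>X\<in>symmat. F V (cscale c X) = cscale c (F V X)) \<and>
        (\<exists>k. k \<noteq> 0 \<and> (\<forall>X\<in>symmat. det (F V X) = k * det X))"
    unfolding det_form_def by blast
  then have F: "\<And>V. V \<in> dom f \<Longrightarrow> ((\<lambda>V. the (f V)) has_derivative F V) (at V within symmat)"
    "\<And>V c X. V \<in> dom f \<Longrightarrow> X \<in> symmat \<Longrightarrow> F V (cscale c X) = cscale c (F V X)"
    "\<And>V. V \<in> dom f \<Longrightarrow> \<exists>k. k \<noteq> 0 \<and> (\<forall>X\<in>symmat. det (F V X) = k * det X)"
    by blast+
  \<comment> \<open>The preimage under the projection is open in the full matrix space and meets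
    \<open>symmat\<close> exactly in the domain of \<open>f\<close>.\<close>
  define S where "S = symmetric_part -` B"
  have S_dom: "V \<in> S \<longleftrightarrow> symmetric_part V \<in> dom f" for V
    unfolding B(2) by (simp add: S_def symmetric_part_symmat)
  have S: "open S"
    unfolding S_def
    by (intro open_vimage B(1) bounded_linear.continuous_on[OF bounded_linear_symmetric_part] continuous_on_id)
  define g where "g = (\<lambda>V. the (f (symmetric_part V)))"
  define G where "G = (\<lambda>V X. F (symmetric_part V) (symmetric_part X))"
  have g: "(g has_derivative G V) (at V)" if "V \<in> S" for V
  proof -
    have "((\<lambda>W. the (f W)) has_derivative F (symmetric_part V)) (at (symmetric_part V) within range symmetric_part)"
      by (rule has_derivative_subset[OF F(1)]) (use that S_dom symmetric_part_symmat in auto)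
    from has_derivative_in_compose[OF bounded_linear.has_derivative[OF bounded_linear_symmetric_part has_derivative_ident] this]
    show ?thesis unfolding g_def G_def .
  qed
  have g_symmat: "g V \<in> symmat" if "V \<in> S" for V
    using that ran unfolding S_dom g_def by (auto simp: ran_def)
  have G_cscale: "G V (cscale c X) = cscale c (G V X)" if "V \<in> S" for V c X
    using that F(2)[OF _ symmetric_part_symmat] by (simp add: G_def S_dom symmetric_part_cscale)
  obtain H where H: "\<And>U X. U \<in> S \<Longrightarrow> ((\<lambda>V. G V X) has_derivative H U X) (at U)"
    "\<And>U c X Y. U \<in> S \<Longrightarrow> H U X (cscale c Y) = cscale c (H U X Y)"
    "\<And>U X Y. U \<in> S \<Longrightarrow> H U X Y = H U Y X"
    using hol_second_derivative_cmat[OF S g G_cscale] by blast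
  \<comment> \<open>The same regularity result, applied to \<open>V |-> G V X\<close> for each fixed
    \<open>X\<close>, supplies the third derivatives.\<close>
  have "\<exists>K. \<forall>U\<in>S. (\<forall>Y. ((\<lambda>V. H V X Y) has_derivative K U Y) (at U)) \<and> (\<forall>Y Z. K U Y Z = K U Z Y)" for X
    using hol_second_derivative_cmat[OF S H(1)[of _ X] H(2)[of _ X]] by metis
  then obtain K where K: "\<And>U X Y. U \<in> S \<Longrightarrow> ((\<lambda>V. H V X Y) has_derivative K X U Y) (at U)"
    "\<And>U X Y Z. U \<in> S \<Longrightarrow> K X U Y Z = K X U Z Y"
    by metis
  interpret conformal_jet g G H "\<lambda>U X. K X U" S
  proof
    show "symmetric_part V \<in> S" if "V \<in> S" for V using that by (simp add: S_dom)
    show "G V X \<in> symmat" if "V \<in> S" for V X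
      using has_derivative_symmat[OF g[OF that] S that] g_symmat by blast
    show "G V X = G (symmetric_part V) (symmetric_part X)" for V X by (simp add: G_def)
    show "\<exists>k. k \<noteq> 0 \<and> (\<forall>X\<in>symmat. det (G V X) = k * det X)" if "V \<in> S" for V
      using F(3) that by (simp add: S_dom G_def symmetric_part_id)
  qed (fact S g H K G_cscale)+
  have Us: "U \<in> symmat" using U B by blast
  then have US: "U \<in> S" using U by (simp add: S_dom symmetric_part_id)
  obtain M r where M: "M \<in> carrier Sp6" and r: "0 < r" "ball U r \<subseteq> S"
    "\<And>V. V \<in> ball U r \<Longrightarrow> V \<in> symmat \<Longrightarrow> sp_action M V = Some (g V)"
    using locally_sp_action[OF US Us g_symmat[OF US]] by blast
  have in_dom: "V \<in> dom f" if "V \<in> symmat \<inter> ball U r" for V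
    using that r(2) S_dom[of V] by (auto simp: symmetric_part_id)
  show thesis
  proof (rule that[OF M])
    show "openin (top_of_set symmat) (symmat \<inter> ball U r)" by (simp add: openin_open_Int)
    show "U \<in> symmat \<inter> ball U r" using Us r by simp
    show "symmat \<inter> ball U r \<subseteq> dom f" using in_dom by blast
    fix V assume V: "V \<in> symmat \<inter> ball U r"
    then obtain W where "f V = Some W" using in_dom by blast
    then show "f V = sp_action M V"
      using r(3)[of V] V by (simp add: g_def symmetric_part_id)
  qed
qed

text \<open>The equation \<open>f U ** den M U = num M U\<close> remains meaningful where
  \<open>den M U\<close> is singular. It holds on a dense subset of the domain of \<open>f\<close>
  and extends by continuity; the symplectic relations then exclude singular points.\<close>

lemma conformal_transformation_map_le:
  assumes f: "conformal_transformation f" and M: "M \<in> carrier Sp6"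
    and eq: "\<And>U. U \<in> dom f \<Longrightarrow> U \<in> dom (sp_action M) \<Longrightarrow> f U = sp_action M U"
  shows "f \<subseteq>\<^sub>m sp_action M"
  unfolding map_le_def
proof
  fix U assume U: "U \<in> dom f"
  have dom: "openin (top_of_set symmat) (dom f)"
    using f by (simp add: conformal_transformation_def)
  have "continuous (at V within dom f) (\<lambda>V. the (f V))" if "V \<in> dom f" for V
  proof -
    have "continuous (at V within symmat) (\<lambda>V. the (f V))"
      using f that has_derivative_continuous unfolding conformal_transformation_def by blast
    then show ?thesis using openin_imp_subset[OF dom] continuous_within_subset by blast
  qed
  then have cont: "continuous_on (dom f) (\<lambda>V. the (f V) ** den M V - num M V)"
    by (intro continuous_on_diff cmat_continuous_intros continuous_on_den continuous_on_num continuous_on_id)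
       (simp add: continuous_on_eq_continuous_within)
  have zero: "the (f V) ** den M V - num M V = 0" if "V \<in> dom f" "V \<in> dom (sp_action M)" for V
    using that act_den by (simp add: eq the_sp_action dom_sp_action)
  have "the (f U) ** den M U - num M U = 0"
  proof (rule ccontr)
    assume nz: "the (f U) ** den M U - num M U \<noteq> 0"
    define N where "N = dom f \<inter> (\<lambda>V. the (f V) ** den M V - num M V) -` (- {0})"
    have "openin (top_of_set (dom f)) N"
      unfolding N_def by (rule continuous_openin_preimage_gen[OF cont]) auto
    then have "openin (top_of_set symmat) N"
      using dom openin_trans by blast
    moreover have "U \<in> N" using U nz by (simp add: N_def)
    ultimately obtain V where "V \<in> N" "V \<in> dom (sp_action M)"
      using dom_sp_action_dense[OF M] by blast
    then show False using zero[of V] by (simp add: N_def)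
  qed
  then have fU: "the (f U) ** den M U = num M U" by simp
  note R = Sp6_relations[OF M]
  have "(transpose (blockA M) - transpose (blockC M) ** the (f U)) ** den M U
      = transpose (blockA M) ** den M U - transpose (blockC M) ** num M U"
    by (simp add: matrix_mult_diff_left fU flip: matrix_mul_assoc)
  also have "\<dots> = (transpose (blockA M) ** blockC M - transpose (blockC M) ** blockA M) ** U
      + (transpose (blockA M) ** blockD M - transpose (blockC M) ** blockB M)"
    by (simp add: den_def num_def matrix_ring_simps algebra_simps)
  also have "\<dots> = mat 1"
    unfolding R(1,3) by (simp add: matrix_ring_simps)
  finally have "invertible (den M U)" using invertible_left_inverse by blast
  then have "U \<in> dom (sp_action M)"
    using U openin_imp_subset[OF dom] by (auto simp only: dom_sp_action)
  then show "f U = sp_action M U" using eq[OF U] by simp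
qed

text \<open>Substituting \<open>U + z X\<close> and comparing coefficients of \<open>z\<close> and
  \<open>z^2\<close> gives a relation for \<open>A X\<close> and \<open>X C X = 0\<close>. With
  \<open>X = mat 1\<close> these yield \<open>C = 0\<close> and \<open>A = D\<close>, and a matrix
  commuting with all symmetric matrices is scalar.\<close>

lemma fixed_on_open_imp_scalar:
  assumes V: "openin (top_of_set symmat) V" "U \<in> V"
    and fixed: "\<And>W. W \<in> V \<Longrightarrow> A ** W + B = W ** (C ** W + D)"
  obtains a where "A = cscale a (mat 1)" "B = 0" "C = 0" "D = cscale a (mat 1)"
proof -
  obtain T where T: "open T" "V = symmat \<inter> T" using V(1) by (auto simp: openin_open)
  have U: "U \<in> symmat" "U \<in> T" using V T by auto
  have jets: "X ** C ** X = 0 \<and> A ** X = X ** (C ** U + D) + U ** C ** X" if X: "X \<in> symmat" for X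
  proof -
    obtain r \<rho> where r: "0 < r" "0 < \<rho>" "\<And>W z. W \<in> ball U r \<Longrightarrow> norm (z::complex) \<le> \<rho> \<Longrightarrow> W + cscale z X \<in> T"
      using open_cscale_neighbourhood[OF T(1) U(2)] by blast
    define L where "L = A ** X - (X ** (C ** U + D) + U ** C ** X)"
    have *: "cscale z L = cscale (z^2) (X ** C ** X)" if "norm z \<le> \<rho>" for z
    proof -
      have "U + cscale z X \<in> V" "U + cscale 0 X \<in> V"
        using r(3)[of U z] r(3)[of U 0] r(1,2) that U X T(2) by (auto intro: symmat_add symmat_cscale)
      note fixed[OF this(1)] fixed[OF this(2)]
      then have e: "A ** U + B = U ** (C ** U + D)"
        and e': "A ** (U + cscale z X) + B = (U + cscale z X) ** (C ** (U + cscale z X) + D)"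
        by simp_all
      have "cscale z L = (A ** (U + cscale z X) + B) - (A ** U + B)
          - ((U + cscale z X) ** (C ** (U + cscale z X) + D) - U ** (C ** U + D)) + cscale (z^2) (X ** C ** X)"
        by (simp add: L_def matrix_ring_simps cscale_mult_left cscale_mult_right cscale_add_right cscale_cscale
            power2_eq_square) (simp add: vec_eq_iff algebra_simps)
      then show ?thesis unfolding e e' by simp
    qed
    have "L $ i $ j = 0 \<and> (X ** C ** X) $ i $ j = 0" for i j
    proof -
      \<comment> \<open>The values \<open>z = \<rho>\<close> and \<open>z = -\<rho>\<close> separate
        the linear from the quadratic coefficient.\<close>
      have "\<rho> * L $ i $ j = \<rho>^2 * (X ** C ** X) $ i $ j" "- \<rho> * L $ i $ j = \<rho>^2 * (X ** C ** X) $ i $ j"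
        using arg_cong[OF *[of "of_real \<rho>"], of "\<lambda>Y. Y $ i $ j"] arg_cong[OF *[of "- of_real \<rho>"], of "\<lambda>Y. Y $ i $ j"] r(2)
        by simp_all
      then show ?thesis using r(2) by simp
    qed
    then have "L = 0" "X ** C ** X = 0" by (simp_all add: vec_eq_iff)
    then show ?thesis by (simp add: L_def)
  qed
  have C: "C = 0" using jets[OF symmat_1] by simp
  then have AD: "A ** X = X ** D" if "X \<in> symmat" for X
    using jets[OF that] by (simp add: matrix_ring_simps)
  then have "A = D" using AD[OF symmat_1] by simp
  have entry: "(D ** X) $ i $ j = (X ** D) $ i $ j" if "X \<in> symmat" for X i j
    using AD[OF that] by (simp add: \<open>A = D\<close>)
  have "D $ 2 $ 1 = 0" "D $ 3 $ 1 = 0" "D $ 1 $ 2 = 0" "D $ 1 $ 3 = 0" "D $ 3 $ 2 = 0" "D $ 2 $ 3 = 0"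
    using entry[of E11 2 1] entry[of E11 3 1] entry[of E11 1 2] entry[of E11 1 3] entry[of E22 3 2] entry[of E22 2 3]
    by (simp_all add: cmat_mult_nth)
  moreover have "D $ 2 $ 2 = D $ 1 $ 1" "D $ 3 $ 3 = D $ 1 $ 1"
    using entry[of E12 2 1] entry[of E13 3 1] by (simp_all add: cmat_mult_nth)
  ultimately have "D = cscale (D $ 1 $ 1) (mat 1)"
    by (simp add: cmat_eq_iff mat_def)
  moreover have "B = 0"
    using fixed[OF V(2)] AD[OF U(1)] by (simp add: C matrix_ring_simps)
  ultimately show thesis using that \<open>A = D\<close> C by metis
qed

text \<open>The quotient \<open>K\<close> of the two matrices fixes every point of an open set and
  is therefore a scalar \<open>a\<close> times the identity; the relation
  \<open>A^t D - C^t B = 1\<close> gives \<open>a^2 = 1\<close>.\<close>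

lemma sp_action_eqD:
  assumes M: "M \<in> carrier Sp6" and N: "N \<in> carrier Sp6"
    and V: "openin (top_of_set symmat) V" "V \<noteq> {}" "V \<subseteq> dom (sp_action M)"
    and eq: "\<And>U. U \<in> V \<Longrightarrow> sp_action M U = sp_action N U"
  shows "M = N \<or> M = - N"
proof -
  define K where "K = sp_inverse N ** M"
  have K: "K \<in> carrier Sp6" unfolding K_def by (intro Sp6_mult Sp6_inverse N M)
  have fixed: "num K U = U ** den K U" if "U \<in> V" for U
  proof -
    define W where "W = act M U"
    have domM: "U \<in> dom (sp_action M)" using that V(3) by blast
    then have domN: "U \<in> dom (sp_action N)" using eq[OF that] by (simp add: domIff)
    have inv: "invertible (den M U)" "invertible (den N U)" using domM domN by (simp_all add: dom_sp_action)
    have "act M U = act N U"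
      using eq[OF that] the_sp_action[OF domM] the_sp_action[OF domN] by simp
    then have W: "W ** den M U = num M U" "W ** den N U = num N U"
      using act_den[OF inv(1)] act_den[OF inv(2)] by (simp_all add: W_def)
    have one: "num (mat 1) U = U" "den (mat 1) U = mat 1"
      by (simp_all add: num_def den_def matrix_mult_0_left)
    note e = num_den_mult[OF W(2), of "sp_inverse N", unfolded Sp6_inverse(1)[OF N] one, symmetric]
    have "num (sp_inverse N) W ** den N U = (U ** den (sp_inverse N) W) ** den N U"
      by (simp add: e flip: matrix_mul_assoc)
    then have "num (sp_inverse N) W = U ** den (sp_inverse N) W"
      by (rule invertible_cancel_right[OF inv(2)])
    then show ?thesis
      using num_den_mult[OF W(1), of "sp_inverse N"] by (simp add: K_def matrix_mul_assoc)
  qed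
  obtain U where "U \<in> V" using V(2) by blast
  then obtain a where a: "blockA K = cscale a (mat 1)" "blockB K = 0" "blockC K = 0" "blockD K = cscale a (mat 1)"
    using fixed_on_open_imp_scalar[OF V(1)] fixed unfolding num_def den_def by metis
  have "transpose (blockA K) ** blockD K = mat 1"
    using Sp6_relations(3)[OF K] by (simp add: a matrix_mult_0_right)
  then have "a * a = 1"
    by (simp add: a cmat_eq_iff cmat_mult_nth transpose_nth mat_def)
  then have "a = 1 \<or> a = - 1" by (simp add: square_eq_1_iff)
  then have "K = mat 1 \<or> K = - mat 1"
  proof
    assume "a = 1"
    then have "K = mat 1" by (intro block_eqI) (simp_all add: a)
    then show ?thesis ..
  next
    assume "a = - 1"
    then have "K = - mat 1" by (intro block_eqI) (simp_all add: a vec_eq_iff)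
    then show ?thesis ..
  qed
  moreover have "M = N ** K"
    by (simp add: K_def matrix_mul_assoc Sp6_inverse(2)[OF N])
  ultimately show ?thesis by (auto simp: matrix_mult_minus_right)
qed

lemma sp_action_minus: "sp_action (- M) = sp_action M"
proof
  fix U
  have nd: "num (- M) U = - num M U" "den (- M) U = - den M U"
    by (simp_all add: num_def den_def matrix_ring_simps)
  have inv: "invertible (- X) \<longleftrightarrow> invertible X" for X :: cmat
    by (simp add: invertible_det_nz det_3) algebra
  have "act (- M) U = act M U" if "invertible (den M U)"
    by (rule act_eqI) (simp_all add: nd inv that act_den matrix_mult_minus_right)
  then show "sp_action (- M) U = sp_action M U"
    by (simp add: sp_action_eq nd inv)
qed

text \<open>Local representations that overlap agree up to sign and hence define the same action.
  The points near which \<open>f\<close> agrees with one fixed \<open>M\<close> therefore form a set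
  that is open and closed in the connected domain.\<close>

lemma conformal_transformation_extends:
  assumes f: "conformal_transformation f"
  obtains M where "M \<in> carrier Sp6" "f \<subseteq>\<^sub>m sp_action M"
proof -
  let ?agree = "\<lambda>M N. openin (top_of_set symmat) N \<and> N \<subseteq> dom f \<and> (\<forall>V\<in>N. f V = sp_action M V)"
  have dom: "openin (top_of_set symmat) (dom f)" "connected (dom f)" "dom f \<noteq> {}"
    using f by (simp_all add: conformal_transformation_def)
  have loc: "\<exists>M\<in>carrier Sp6. \<exists>N. ?agree M N \<and> U \<in> N" if "U \<in> dom f" for U
    using conformal_transformation_locally_sp_action[OF f that] by metis
  obtain U0 where U0: "U0 \<in> dom f" using dom by blast
  then obtain M N0 where M: "M \<in> carrier Sp6" and N0: "?agree M N0" "U0 \<in> N0" using loc by blast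
  define A where "A = \<Union>{N. ?agree M N}"
  \<comment> \<open>\<open>B\<close> collects the neighbourhoods with a symplectic representation
    that do not meet \<open>A\<close>; together with \<open>A\<close> they exhaust the domain of
    \<open>f\<close>.\<close>
  define B where "B = \<Union>{N. ?agree M N \<and> N \<inter> A = {} \<or> (\<exists>M'\<in>carrier Sp6. ?agree M' N) \<and> N \<inter> A = {}}"
  have sub: "A \<subseteq> dom f" "B \<subseteq> dom f" by (auto simp: A_def B_def)
  have open_A: "openin (top_of_set symmat) A" unfolding A_def by (rule openin_Union) blast
  have open_B: "openin (top_of_set symmat) B" unfolding B_def by (rule openin_Union) blast
  have "U \<in> A \<union> B" if U: "U \<in> dom f" for U
  proof -
    obtain M' N where M': "M' \<in> carrier Sp6" and N: "?agree M' N" "U \<in> N" using loc[OF U] by blast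
    show ?thesis
    proof (cases "N \<inter> A = {}")
      case True
      then show ?thesis using M' N unfolding B_def by blast
    next
      case False
      then obtain N1 where N1: "?agree M N1" "N \<inter> N1 \<noteq> {}" unfolding A_def by blast
      have "sp_action M W = sp_action M' W \<and> W \<in> dom (sp_action M)" if W: "W \<in> N \<inter> N1" for W
      proof -
        have "f W = sp_action M W" "f W = sp_action M' W" "W \<in> dom f" using W N N1 by auto
        then show ?thesis by (metis domIff)
      qed
      then have "M = M' \<or> M = - M'"
        using N N1 by (intro sp_action_eqD[OF M M', of "N \<inter> N1"]) (auto intro: openin_Int)
      then have "sp_action M' = sp_action M" by (auto simp: sp_action_minus)
      then have "?agree M N" using N by simp
      then show ?thesis using N(2) unfolding A_def by blast
    qed
  qed
  moreover have "A \<inter> B = {}" unfolding B_def by blast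
  moreover have "A \<noteq> {}" using N0 unfolding A_def by blast
  moreover have "openin (top_of_set (dom f)) A" "openin (top_of_set (dom f)) B"
    using open_A open_B sub openin_imp_subset[OF dom(1)] openin_subset_trans by blast+
  ultimately have "B = {}"
    using dom(2) unfolding connected_openin by blast
  then have "f U = sp_action M U" if "U \<in> dom f" for U
    using \<open>\<And>U. U \<in> dom f \<Longrightarrow> U \<in> A \<union> B\<close> that unfolding A_def by blast
  then show thesis using that[OF M] by (simp add: map_le_def)
qed

section \<open>Inextensible transformations, their product and the group isomorphism\<close>

theorem conformal_automorphism_iff:
  "conformal_automorphism f \<longleftrightarrow> (\<exists>M\<in>carrier Sp6. f = sp_action M)"
proof
  assume f: "conformal_automorphism f"
  then obtain M where "M \<in> carrier Sp6" "f \<subseteq>\<^sub>m sp_action M"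
    using conformal_transformation_extends by (auto simp: conformal_automorphism_def)
  then show "\<exists>M\<in>carrier Sp6. f = sp_action M"
    using f sp_action_conformal unfolding conformal_automorphism_def by metis
next
  assume "\<exists>M\<in>carrier Sp6. f = sp_action M"
  then obtain M where M: "M \<in> carrier Sp6" "f = sp_action M" by blast
  have "h = sp_action M" if "conformal_transformation h" "sp_action M \<subseteq>\<^sub>m h" for h
  proof (rule map_le_antisym[OF conformal_transformation_map_le[OF that(1) M(1)] that(2)])
    show "h U = sp_action M U" if "U \<in> dom (sp_action M)" for U
      using \<open>sp_action M \<subseteq>\<^sub>m h\<close> that by (simp add: map_le_def)
  qed
  then show "conformal_automorphism f"
    using sp_action_conformal[OF M(1)] by (simp add: conformal_automorphism_def M(2))
qed

lemma conformal_mult_sp_action: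
  assumes M: "M \<in> carrier Sp6" and N: "N \<in> carrier Sp6"
  shows "conformal_mult (sp_action M) (sp_action N) = sp_action (M ** N)"
  unfolding conformal_mult_def
proof (rule the_equality)
  \<comment> \<open>Where both \<open>N\<close> and the product act, the composite is defined.
    Density of the domain of the product makes this set nonempty.\<close>
  define V where "V = dom (sp_action N) \<inter> dom (sp_action (M ** N))"
  have V: "openin (top_of_set symmat) V"
    unfolding V_def by (intro openin_Int openin_dom_sp_action)
  obtain U0 where "U0 \<in> dom (sp_action N)" using dom_sp_action_nonempty[OF N] .
  then have "V \<noteq> {}"
    using dom_sp_action_dense[OF Sp6_mult[OF M N] openin_dom_sp_action] unfolding V_def by blast
  moreover have "U \<in> dom (sp_action M \<circ>\<^sub>m sp_action N) \<and> sp_action (M ** N) U = (sp_action M \<circ>\<^sub>m sp_action N) U"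
    if U: "U \<in> V" for U
  proof -
    obtain W where W: "sp_action N U = Some W" using U by (auto simp: V_def)
    then have "W \<in> symmat" by (auto simp: sp_action_eq act_symmat[OF N] split: if_splits)
    then have "W \<in> dom (sp_action M)" using sp_action_mult(2)[OF W] U by (simp add: V_def)
    then obtain Z where Z: "sp_action M W = Some Z" by blast
    then show ?thesis using sp_action_mult(1)[OF W Z] W by (simp add: map_comp_def dom_def)
  qed
  ultimately show "conformal_automorphism (sp_action (M ** N)) \<and>
      (\<exists>V. openin (top_of_set symmat) V \<and> V \<noteq> {} \<and> V \<subseteq> dom (sp_action M \<circ>\<^sub>m sp_action N) \<and>
        (\<forall>U\<in>V. sp_action (M ** N) U = (sp_action M \<circ>\<^sub>m sp_action N) U))"
    using V Sp6_mult[OF M N] by (auto simp: conformal_automorphism_iff intro!: exI[of _ V])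
next
  fix h
  assume h: "conformal_automorphism h \<and>
      (\<exists>V. openin (top_of_set symmat) V \<and> V \<noteq> {} \<and> V \<subseteq> dom (sp_action M \<circ>\<^sub>m sp_action N) \<and>
        (\<forall>U\<in>V. h U = (sp_action M \<circ>\<^sub>m sp_action N) U))"
  then obtain L V where L: "L \<in> carrier Sp6" "h = sp_action L"
    and V: "openin (top_of_set symmat) V" "V \<noteq> {}" "V \<subseteq> dom (sp_action M \<circ>\<^sub>m sp_action N)"
      "\<And>U. U \<in> V \<Longrightarrow> h U = (sp_action M \<circ>\<^sub>m sp_action N) U"
    by (auto simp: conformal_automorphism_iff)
  have eq: "sp_action L U = sp_action (M ** N) U \<and> U \<in> dom (sp_action L)" if U: "U \<in> V" for U
  proof -
    obtain Z where Z: "(sp_action M \<circ>\<^sub>m sp_action N) U = Some Z" using V(3) U by blast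
    then obtain W where W: "sp_action N U = Some W" "sp_action M W = Some Z"
      by (auto simp: map_comp_Some_iff)
    then show ?thesis using sp_action_mult(1)[OF W] V(4)[OF U] L Z by (simp add: dom_def)
  qed
  then have "L = M ** N \<or> L = - (M ** N)"
    using sp_action_eqD[OF L(1) Sp6_mult[OF M N] V(1,2)] by blast
  then show "h = sp_action (M ** N)" using L(2) by (auto simp: sp_action_minus)
qed

lemma sp_action_one: "sp_action (mat 1) = Some |` symmat"
proof
  fix U
  have "num (mat 1) U = U" "den (mat 1) U = mat 1" by (simp_all add: num_def den_def matrix_mult_0_left)
  moreover have "invertible (mat 1 :: cmat)" by (simp add: invertible_det_nz)
  ultimately show "sp_action (mat 1) U = (Some |` symmat) U"
    using act_eqI[of "mat 1" U U] by (simp add: sp_action_eq restrict_map_def)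
qed

lemma Sp6_uminus_one: "- mat 1 \<in> carrier Sp6"
  by (simp add: Sp6_def matrix_ring_simps)

text \<open>Since \<open>M\<close> and \<open>- M\<close> act alike, the action is two-to-one on
  \<open>Sp6\<close>, and the isomorphism with the automorphism group is that of the quotient by the
  sign.\<close>

theorem theorem2:
  shows "group Sp6 \<and> group conformal_group \<and>
         sp_action \<in> epi Sp6 conformal_group \<and>
         kernel Sp6 conformal_group sp_action = {mat 1, - mat 1} \<and>
         Sp6 Mod {mat 1, - mat 1} \<cong> conformal_group"
proof -
  have image: "sp_action ` carrier Sp6 = carrier conformal_group"
    by (auto simp: conformal_group_def conformal_automorphism_iff)
  have hom: "sp_action \<in> hom Sp6 conformal_group"
    using image by (intro homI) (auto simp: Sp6_simps conformal_group_def conformal_mult_sp_action)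
  \<comment> \<open>The image of a group under a homomorphism is a group. As the action is onto,
    this transfers the group laws to \<open>conformal_group\<close>, whose product is given only by
    a definite description.\<close>
  have "conformal_group\<lparr>carrier := sp_action ` carrier Sp6, one := sp_action \<one>\<^bsub>Sp6\<^esub>\<rparr> = conformal_group"
    unfolding image by (simp add: conformal_group_def Sp6_simps sp_action_one)
  then have grp: "group conformal_group"
    using group.hom_imp_img_group[OF Sp6_group hom] by simp
  interpret group_hom Sp6 conformal_group sp_action
    using Sp6_group grp hom by (simp add: group_hom_def group_hom_axioms_def)
  have "M = mat 1 \<or> M = - mat 1" if M: "M \<in> carrier Sp6" "sp_action M = Some |` symmat" for M
  proof (rule sp_action_eqD[OF M(1) Sp6_one openin_dom_sp_action])
    show "dom (sp_action M) \<noteq> {}"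
      using sp_action_conformal[OF M(1)] by (simp add: conformal_transformation_def)
    show "sp_action M U = sp_action (mat 1) U" for U
      by (simp only: M(2) sp_action_one)
  qed simp
  then have kernel: "kernel Sp6 conformal_group sp_action = {mat 1, - mat 1}"
    by (auto simp: kernel_def conformal_group_def Sp6_one Sp6_uminus_one sp_action_one sp_action_minus)
  show ?thesis
    using Sp6_group grp hom image kernel FactGroup_iso[OF image] by (simp add: epi_def)
qed

end
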